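(* Let $f:C^k(V,\mathbb{R})\to C^k(W,\mathbb{R})$, where $k=0,1,\dots,\infty$, be an isomorphism of multiplicative semigroups. If $k\ge1$, then there exists a $C^k$ diffeomorphism $\phi:W\to V$ such that $$f(x)=x\circ\phi,\qquad x\in C^k(V,\mathbb{R}).$$ If $k=0$, then there exist a homeomorphism $\phi:W\to V$ and a continuous positive function $\alpha$ on $W$ such that $$f(x)(w)=\mathrm{sgn}(x\circ\phi(w))\,|x\circ\phi(w)|^{\alpha(w)},\qquad w\in W,\ x\in C(V,\mathbb{R}).$$
   Context: All manifolds are Hausdorff. $V$ and $W$ are finite dimensional $C^\infty$ manifolds, possibly with boundary, not necessarily paracompact or connected. $C^k(V,\mathbb{R})$ is the semigroup of real valued $C^k$ functions on $V$ under pointwise multiplication ($C^0=C$), and similarly for $W$. $\mathrm{sgn}(t)$ is $1,0,-1$ according as $t>0$, $t=0$, $t<0$.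
   Formalization: The manifolds V and W are assumed to have no component of dimension 0 (no isolated points), since for V = W a point the semigroup is R, and t ↦ t^3 (k ≥ 1) or a discontinuous multiplicative bijection (k = 0) contradicts the claim. *)

theory Defs
  imports "HOL-Analysis.Analysis" "HOL-Algebra.Group" "HOL-Library.Extended_Nat"
begin

primrec Cn_on_open :: "nat \<Rightarrow> 'a::euclidean_space set \<Rightarrow> ('a \<Rightarrow> 'b::real_normed_vector) \<Rightarrow> bool"
  where
    "Cn_on_open 0 U f \<longleftrightarrow> continuous_on U f"
  | "Cn_on_open (Suc n) U f \<longleftrightarrow>
       (\<forall>a\<in>U. f differentiable (at a)) \<and>
       (\<forall>v. Cn_on_open n U (\<lambda>a. frechet_derivative f (at a) v))"

text \<open>On an arbitrary subset of a Euclidean space (for instance a relatively open subset of a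
  half-space, or of a linear subspace), being $C^k$ means extending locally to a $C^k$ function
  on an open set of the ambient space.\<close>

definition Ck_on :: "enat \<Rightarrow> 'a::euclidean_space set \<Rightarrow> ('a \<Rightarrow> 'b::real_normed_vector) \<Rightarrow> bool"
  where
    "Ck_on k A f \<longleftrightarrow>
       (\<forall>a\<in>A. \<exists>U g. open U \<and> a \<in> U \<and> (\<forall>n. enat n \<le> k \<longrightarrow> Cn_on_open n U g) \<and>
                   (\<forall>x\<in>A \<inter> U. g x = f x))"

text \<open>A chart is a pair of its domain and its coordinate map. Only the values of the coordinate map
  on the domain matter.\<close>

type_synonym ('p, 'a) chart = "'p set \<times> ('p \<Rightarrow> 'a)"

text \<open>A chart takes values in a relatively open subset of a set \<open>{x \<in> S. 0 \<le> u \<bullet> x}\<close>,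
  which is a closed half-space of the linear subspace \<open>S\<close>, or all of \<open>S\<close> (for instance when
  \<open>u = 0\<close>). As \<open>S\<close> may depend on the chart, components of different dimensions
  are allowed; \<open>dim S\<close> is the dimension of the manifold on the domain of the chart.
  Dimension \<open>0\<close> is excluded: on a one-point manifold \<open>C\<^sup>k\<close> is the multiplicative semigroup
  of the reals, which has automorphisms such as $t \mapsto t^3$ that are not the identity, and also
  discontinuous ones.\<close>

definition is_chart :: "'p topology \<Rightarrow> ('p, 'a::euclidean_space) chart \<Rightarrow> bool"
  where
    "is_chart X = (\<lambda>(U, h). openin X U \<and>
       (\<exists>S u. subspace S \<and> S \<noteq> {0} \<and> openin (top_of_set {x \<in> S. 0 \<le> u \<bullet> x}) (h ` U)) \<and>
       homeomorphic_map (subtopology X U) (top_of_set (h ` U)) h)"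

definition smooth_atlas :: "'p topology \<Rightarrow> ('p, 'a::euclidean_space) chart set \<Rightarrow> bool"
  where
    "smooth_atlas X \<A> \<longleftrightarrow>
       (\<forall>c\<in>\<A>. is_chart X c) \<and>
       (\<Union>(U, h)\<in>\<A>. U) = topspace X \<and>
       (\<forall>(U, h)\<in>\<A>. \<forall>(U', h')\<in>\<A>. Ck_on \<infinity> (h ` (U \<inter> U')) (h' \<circ> inv_into U h))"

definition smooth_manifold :: "'p topology \<Rightarrow> ('p, 'a::euclidean_space) chart set \<Rightarrow> bool"
  where
    "smooth_manifold X \<A> \<longleftrightarrow> Hausdorff_space X \<and> smooth_atlas X \<A>"

text \<open>Real functions on the manifold are represented by functions on the whole type that are
  \<open>undefined\<close> off the carrier \<open>topspace X\<close>, so that equality is equality on the carrier.\<close>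

definition Ck_semigroup ::
  "enat \<Rightarrow> 'p topology \<Rightarrow> ('p, 'a::euclidean_space) chart set \<Rightarrow> ('p \<Rightarrow> real) monoid"
  where
    "Ck_semigroup k X \<A> =
       \<lparr>carrier = {x \<in> extensional (topspace X). \<forall>(U, h)\<in>\<A>. Ck_on k (h ` U) (x \<circ> inv_into U h)},
        mult = (\<lambda>x y. restrict (\<lambda>p. x p * y p) (topspace X)),
        one = restrict (\<lambda>p. 1) (topspace X)\<rparr>"

definition Ck_map ::
  "enat \<Rightarrow> 'q topology \<Rightarrow> ('q, 'b::euclidean_space) chart set \<Rightarrow>
     'p topology \<Rightarrow> ('p, 'a::euclidean_space) chart set \<Rightarrow> ('q \<Rightarrow> 'p) \<Rightarrow> bool"
  where
    "Ck_map k Y \<B> X \<A> \<phi> \<longleftrightarrow>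
       continuous_map Y X \<phi> \<and>
       (\<forall>(U', h')\<in>\<B>. \<forall>(U, h)\<in>\<A>. Ck_on k (h' ` (U' \<inter> \<phi> -` U)) (h \<circ> \<phi> \<circ> inv_into U' h'))"

definition Ck_diffeomorphism ::
  "enat \<Rightarrow> 'q topology \<Rightarrow> ('q, 'b::euclidean_space) chart set \<Rightarrow>
     'p topology \<Rightarrow> ('p, 'a::euclidean_space) chart set \<Rightarrow> ('q \<Rightarrow> 'p) \<Rightarrow> bool"
  where
    "Ck_diffeomorphism k Y \<B> X \<A> \<phi> \<longleftrightarrow>
       bij_betw \<phi> (topspace Y) (topspace X) \<and>
       Ck_map k Y \<B> X \<A> \<phi> \<and>
       Ck_map k X \<A> Y \<B> (inv_into (topspace Y) \<phi>)"

end

theory Submission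
  imports Defs
begin

text \<open>Write \<open>f\<close> for the isomorphism. For \<open>w\<close> in \<open>W\<close> take \<open>z\<close> whose only zero is \<open>w\<close>. The functions on \<open>W\<close>
  vanishing near \<open>w\<close> are those \<open>t\<close> with \<open>z u t = t\<close> for some \<open>u\<close>; as this is expressed by multiplication,
  the preimage of \<open>z\<close> under \<open>f\<close> has exactly one zero \<open>\<phi> w\<close>, and \<open>f x\<close> vanishes at \<open>w\<close> if and only if
  \<open>x\<close> vanishes at \<open>\<phi> w\<close>. Hence \<open>\<phi>\<close> is a homeomorphism, and the value of \<open>f x\<close> at \<open>w\<close> depends only on the germ
  of \<open>x\<close> at \<open>\<phi> w\<close>.

  Call \<open>v = \<phi> w\<close> good if \<open>\<bar>u v\<bar> < 1\<close> implies \<open>\<bar>f u w\<bar> \<le> 1\<close> for all \<open>u\<close>. If \<open>\<bar>u\<bar> < 1\<close> near \<open>v\<close>, high powers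
  of \<open>u\<close>, cut off near \<open>v\<close>, are small together with their derivatives. So if bad points accumulated, such
  powers could be glued to a single $C^k$ function with unbounded image. Therefore the bad points
  are isolated. At a good point \<open>f\<close> is monotone on positive constants, so it acts on them as \<open>c \<mapsto> c powr \<alpha>\<close>,
  and \<open>f x w\<close> depends only on \<open>x v\<close>. By continuity the resulting formula holds everywhere.

  For \<open>k \<ge> 1\<close> the formula shows that \<open>x \<circ> \<phi>\<close> is $C^k$ for all \<open>x\<close>, and differentiability of
  \<open>\<bar>t\<bar> powr \<alpha>\<close> at \<open>0\<close> forces \<open>\<alpha> \<ge> 1\<close>; by symmetry \<open>\<alpha> = 1\<close>.\<close>

section \<open>Calculus of $C^n$ functions on open sets\<close>

text \<open>Nothing is known about continuity of \<open>f\<close>; the analytic input is that each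
  single \<open>f x\<close> is continuous. A priori \<open>f x w\<close> could depend wildly on the
  germ of \<open>x\<close>, through derivatives or through a discontinuous solution of Cauchy's
  equation. The gluing is a gliding hump argument against this: an excess
  \<open>\<bar>f u w\<bar> > 1\<close> is amplified geometrically by
  \<open>f (u ^ N) w = f u w ^ N\<close>, while each differentiation of \<open>u ^ N\<close> costs
  only a factor polynomial in \<open>N\<close>, which the geometric decay of \<open>u ^ N\<close>
  absorbs. One isolated excess contradicts nothing, so the argument stops at isolated bad points;
  they are then reached as limits of good points, which requires positive dimension.

  All functions are built in one chart and extended by zero, which preserves C^k because small
  closed balls of a chart are compact, hence closed in a Hausdorff space.

  For \<open>k = \<infinity>\<close> a hump can be made small only in finitely many derivatives at
  once. The \<open>j\<close>-th hump is therefore controlled up to order \<open>j\<close>, and each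
  fixed order ignores finitely many humps.\<close>

lemma Cn_on_open_subset: "Cn_on_open n U f \<Longrightarrow> V \<subseteq> U \<Longrightarrow> Cn_on_open n V f"
  by (induction n arbitrary: f) (auto intro: continuous_on_subset)

text \<open>On an open set the values determine the derivative, so the two functions share their
  \<open>frechet_derivative\<close> there and the induction passes to directional
  derivatives.\<close>

lemma Cn_on_open_cong:
  assumes "open U" "\<And>x. x \<in> U \<Longrightarrow> f x = g x" "Cn_on_open n U f"
  shows "Cn_on_open n U g"
  using assms(2,3)
proof (induction n arbitrary: f g)
  case 0
  then show ?case by (metis Cn_on_open.simps(1) continuous_on_cong)
next
  case (Suc n)
  have g: "(g has_derivative frechet_derivative f (at a)) (at a)" if "a \<in> U" for a
  proof (rule has_derivative_transform_within_open[OF _ assms(1) that])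
    show "(f has_derivative frechet_derivative f (at a)) (at a)"
      using Suc.prems(2) that frechet_derivative_works by auto
  qed (use Suc.prems in auto)
  then have "frechet_derivative f (at a) = frechet_derivative g (at a)" if "a \<in> U" for a
    using that frechet_derivative_at by blast
  then have "Cn_on_open n U (\<lambda>a. frechet_derivative g (at a) v)" for v
    using Suc.IH[of "\<lambda>a. frechet_derivative f (at a) v" "\<lambda>a. frechet_derivative g (at a) v"]
      Suc.prems(2) by auto
  then show ?case using g by (auto simp: differentiable_def)
qed

text \<open>Frees later proofs from the choice operator in \<open>frechet_derivative\<close>: any
  explicit candidate \<open>D\<close> for the derivative will do.\<close>

lemma Cn_on_open_SucI:
  assumes "open U" "\<And>a. a \<in> U \<Longrightarrow> (f has_derivative D a) (at a)"
    and "\<And>v. Cn_on_open n U (\<lambda>a. D a v)"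
  shows "Cn_on_open (Suc n) U f"
proof -
  have "D a = frechet_derivative f (at a)" if "a \<in> U" for a
    using assms(2)[OF that] by (rule frechet_derivative_at)
  then have "Cn_on_open n U (\<lambda>a. frechet_derivative f (at a) v)" for v
    by (intro Cn_on_open_cong[OF assms(1) _ assms(3)]) auto
  then show ?thesis using assms(2) by (auto simp: differentiable_def)
qed

lemma Cn_on_open_SucD:
  assumes "Cn_on_open (Suc n) U f"
  shows "a \<in> U \<Longrightarrow> (f has_derivative frechet_derivative f (at a)) (at a)"
    and "Cn_on_open n U (\<lambda>a. frechet_derivative f (at a) v)"
  using assms frechet_derivative_works by auto

lemma Cn_on_open_Suc_imp: "Cn_on_open (Suc n) U f \<Longrightarrow> Cn_on_open n U f"
proof (induction n arbitrary: f)
  case 0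
  then show ?case
    by (auto intro!: continuous_at_imp_continuous_on differentiable_imp_continuous_within)
next
  case (Suc n)
  from Suc.prems have "\<forall>a\<in>U. f differentiable (at a)"
    "\<And>v. Cn_on_open (Suc n) U (\<lambda>a. frechet_derivative f (at a) v)"
    by (simp_all del: Cn_on_open.simps(2) add: Cn_on_open.simps(2)[of "Suc n"])
  then show ?case using Suc.IH by simp
qed

lemma Cn_on_open_le: "Cn_on_open n U f \<Longrightarrow> m \<le> n \<Longrightarrow> Cn_on_open m U f"
  by (induction n) (simp, metis Cn_on_open_Suc_imp le_Suc_eq)

lemma Cn_on_open_imp_continuous_on: "Cn_on_open n U f \<Longrightarrow> continuous_on U f"
  using Cn_on_open_le[of n U f 0] by simp

lemma Cn_on_open_const: "open U \<Longrightarrow> Cn_on_open n U (\<lambda>_. c)"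
proof (induction n arbitrary: c)
  case (Suc n)
  show ?case
    by (rule Cn_on_open_SucI[OF Suc.prems, where D = "\<lambda>_ _. 0"]) (use Suc in auto)
qed auto

lemma Cn_on_open_bounded_linear_compose:
  assumes "open U" "bounded_linear L" "Cn_on_open n U f"
  shows "Cn_on_open n U (\<lambda>x. L (f x))"
  using assms(3)
proof (induction n arbitrary: f)
  case 0
  then show ?case
    using assms(2) by (simp add: bounded_linear.continuous_on)
next
  case (Suc n)
  show ?case
  proof (rule Cn_on_open_SucI[OF assms(1)])
    show "((\<lambda>x. L (f x)) has_derivative (\<lambda>v. L (frechet_derivative f (at a) v))) (at a)"
      if "a \<in> U" for a
      using bounded_linear.has_derivative[OF assms(2) Cn_on_open_SucD(1)[OF Suc.prems that]] .
    show "Cn_on_open n U (\<lambda>a. L (frechet_derivative f (at a) v))" for v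
      by (rule Suc.IH[OF Cn_on_open_SucD(2)[OF Suc.prems]])
  qed
qed

lemma Cn_on_open_id: "open U \<Longrightarrow> Cn_on_open n U (\<lambda>x. x)"
proof (cases n)
  case (Suc m)
  assume "open U"
  then show ?thesis unfolding Suc
    by (rule Cn_on_open_SucI[where D = "\<lambda>_ v. v"]) (auto intro: Cn_on_open_const \<open>open U\<close>)
qed auto

lemma Cn_on_open_add:
  assumes "open U" "Cn_on_open n U f" "Cn_on_open n U g"
  shows "Cn_on_open n U (\<lambda>x. f x + g x)"
  using assms(2,3)
proof (induction n arbitrary: f g)
  case 0
  then show ?case by (simp add: continuous_on_add)
next
  case (Suc n)
  show ?case
  proof (rule Cn_on_open_SucI[OF assms(1)])
    show "((\<lambda>x. f x + g x) has_derivative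
        (\<lambda>v. frechet_derivative f (at a) v + frechet_derivative g (at a) v)) (at a)"
      if "a \<in> U" for a
      using has_derivative_add[OF Cn_on_open_SucD(1)[OF Suc.prems(1) that]
          Cn_on_open_SucD(1)[OF Suc.prems(2) that]] .
  qed (intro Suc.IH Cn_on_open_SucD(2)[OF Suc.prems(1)] Cn_on_open_SucD(2)[OF Suc.prems(2)])
qed

lemma Cn_on_open_sum:
  assumes "open U" "\<And>i. i \<in> I \<Longrightarrow> Cn_on_open n U (f i)"
  shows "Cn_on_open n U (\<lambda>x. \<Sum>i\<in>I. f i x)"
  using assms(2)
  by (induction I rule: infinite_finite_induct)
    (auto intro: Cn_on_open_const Cn_on_open_add assms(1))

lemma Cn_on_open_mult:
  fixes f g :: "'a::euclidean_space \<Rightarrow> real"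
  assumes "open U" "Cn_on_open n U f" "Cn_on_open n U g"
  shows "Cn_on_open n U (\<lambda>x. f x * g x)"
  using assms(2,3)
proof (induction n arbitrary: f g)
  case 0
  then show ?case by (simp add: continuous_on_mult)
next
  case (Suc n)
  show ?case
  proof (rule Cn_on_open_SucI[OF assms(1)])
    show "((\<lambda>x. f x * g x) has_derivative
        (\<lambda>v. f a * frechet_derivative g (at a) v + frechet_derivative f (at a) v * g a)) (at a)"
      if "a \<in> U" for a
      using has_derivative_mult[OF Cn_on_open_SucD(1)[OF Suc.prems(1) that]
          Cn_on_open_SucD(1)[OF Suc.prems(2) that]] .
    show "Cn_on_open n U
        (\<lambda>a. f a * frechet_derivative g (at a) v + frechet_derivative f (at a) v * g a)" for v
      by (intro Cn_on_open_add[OF assms(1)] Suc.IH Cn_on_open_SucD(2)[OF Suc.prems(1)]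
          Cn_on_open_SucD(2)[OF Suc.prems(2)] Suc.prems[THEN Cn_on_open_Suc_imp])
  qed
qed

lemma Cn_on_open_power:
  fixes f :: "'a::euclidean_space \<Rightarrow> real"
  assumes "open U" "Cn_on_open n U f"
  shows "Cn_on_open n U (\<lambda>x. f x ^ m)"
  by (induction m) (auto intro: Cn_on_open_const Cn_on_open_mult assms)

lemma linear_eq_sum_Basis:
  fixes L :: "'a::euclidean_space \<Rightarrow> real"
  assumes "linear L"
  shows "L v = (\<Sum>b\<in>Basis. (v \<bullet> b) * L b)"
proof -
  have "L v = L (\<Sum>b\<in>Basis. (v \<bullet> b) *\<^sub>R b)" by (simp add: euclidean_representation)
  also have "\<dots> = (\<Sum>b\<in>Basis. (v \<bullet> b) * L b)"
    using assms by (simp add: linear_sum linear_cmul)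
  finally show ?thesis .
qed

text \<open>The chain rule evaluates the derivative of \<open>g\<close> in a direction that moves
  with \<open>a\<close>, whereas \<open>Cn_on_open\<close> speaks of fixed directions. Expanding
  that direction in the basis leaves sums of products with fixed directions, to which the induction
  hypothesis applies.\<close>

lemma Cn_on_open_compose:
  fixes f :: "'a::euclidean_space \<Rightarrow> 'b::euclidean_space" and g :: "'b \<Rightarrow> real"
  assumes "open U" "open V" "f ` U \<subseteq> V" "Cn_on_open n U f" "Cn_on_open n V g"
  shows "Cn_on_open n U (\<lambda>x. g (f x))"
  using assms(4,5)
proof (induction n arbitrary: g)
  case 0
  then show ?case using assms(3) by (auto intro: continuous_on_compose2)
next
  case (Suc n)
  note df = Cn_on_open_SucD[OF Suc.prems(1)] and dg = Cn_on_open_SucD[OF Suc.prems(2)]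
  let ?D = "\<lambda>a v. \<Sum>b\<in>Basis. (frechet_derivative f (at a) v \<bullet> b) * frechet_derivative g (at (f a)) b"
  show ?case
  proof (rule Cn_on_open_SucI[OF assms(1)])
    fix a assume a: "a \<in> U"
    then have "f a \<in> V" using assms(3) by auto
    note D = dg(1)[OF this]
    have "((\<lambda>x. g (f x)) has_derivative
        (\<lambda>v. frechet_derivative g (at (f a)) (frechet_derivative f (at a) v))) (at a)"
      using diff_chain_at[OF df(1)[OF a] D] by (simp add: o_def)
    moreover have "(\<lambda>v. frechet_derivative g (at (f a)) (frechet_derivative f (at a) v)) = ?D a"
      by (intro ext linear_eq_sum_Basis has_derivative_linear[OF D])
    ultimately show "((\<lambda>x. g (f x)) has_derivative ?D a) (at a)" by metis
  next
    fix v
    have "Cn_on_open n U (\<lambda>a. frechet_derivative g (at (f a)) b)" for b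
      by (rule Suc.IH[OF Cn_on_open_Suc_imp[OF Suc.prems(1)] dg(2)])
    moreover have "Cn_on_open n U (\<lambda>a. frechet_derivative f (at a) v \<bullet> b)" for b
      by (rule Cn_on_open_bounded_linear_compose[OF assms(1) bounded_linear_inner_left df(2)])
    ultimately show "Cn_on_open n U (\<lambda>a. ?D a v)"
      by (intro Cn_on_open_sum Cn_on_open_mult assms(1))
  qed
qed

text \<open>Needed for the gluing, where the bounds \<open>deriv_le\<close> are available for basis
  directions.\<close>

lemma Cn_on_open_Suc_Basis:
  fixes f :: "'a::euclidean_space \<Rightarrow> real"
  assumes "open U" "\<And>a. a \<in> U \<Longrightarrow> f differentiable (at a)"
    and "\<And>b. b \<in> Basis \<Longrightarrow> Cn_on_open n U (\<lambda>a. frechet_derivative f (at a) b)"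
  shows "Cn_on_open (Suc n) U f"
proof (rule Cn_on_open_SucI[OF assms(1)])
  fix a assume "a \<in> U"
  then have D: "(f has_derivative frechet_derivative f (at a)) (at a)"
    using assms(2) frechet_derivative_works by blast
  moreover have "frechet_derivative f (at a) = (\<lambda>v. \<Sum>b\<in>Basis. (v \<bullet> b) * frechet_derivative f (at a) b)"
    by (intro ext linear_eq_sum_Basis has_derivative_linear[OF D])
  ultimately show "(f has_derivative (\<lambda>v. \<Sum>b\<in>Basis. (v \<bullet> b) * frechet_derivative f (at a) b)) (at a)"
    by metis
qed (intro Cn_on_open_sum Cn_on_open_mult assms Cn_on_open_const)

lemma Cn_on_open_Suc_real:
  fixes f :: "real \<Rightarrow> real"
  assumes "open U" "\<And>a. a \<in> U \<Longrightarrow> (f has_real_derivative f' a) (at a)" "Cn_on_open n U f'"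
  shows "Cn_on_open (Suc n) U f"
proof (rule Cn_on_open_SucI[OF assms(1)])
  show "(f has_derivative (\<lambda>v. f' a * v)) (at a)" if "a \<in> U" for a
    using assms(2)[OF that] by (simp add: has_field_derivative_def)
qed (intro Cn_on_open_mult assms Cn_on_open_const)

lemma Cn_on_open_exp: "Cn_on_open n (UNIV :: real set) exp"
proof (induction n)
  case (Suc n)
  then show ?case by (intro Cn_on_open_Suc_real[where f' = exp]) auto
qed (auto intro!: continuous_intros)

lemma Cn_on_open_inverse: "Cn_on_open n (- {0 :: real}) inverse"
proof (induction n)
  case (Suc n)
  show ?case
  proof (rule Cn_on_open_Suc_real)
    show "(inverse has_real_derivative - 1 * (inverse a * inverse a)) (at a)" if "a \<in> - {0}" for a :: real
      using that DERIV_inverse[of a] by (simp add: power2_eq_square)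
    show "Cn_on_open n (- {0 :: real}) (\<lambda>a. - 1 * (inverse a * inverse a))"
      by (intro Cn_on_open_mult Cn_on_open_const Suc) auto
  qed auto
qed (auto intro!: continuous_intros)

lemma Cn_on_open_ln: "Cn_on_open n {0 :: real <..} ln"
proof (cases n)
  case (Suc m)
  show ?thesis unfolding Suc
  proof (rule Cn_on_open_Suc_real)
    show "(ln has_real_derivative inverse a) (at a)" if "a \<in> {0<..}" for a :: real
      using that by (simp add: DERIV_ln)
    show "Cn_on_open m {0 :: real <..} inverse"
      by (rule Cn_on_open_subset[OF Cn_on_open_inverse]) auto
  qed auto
qed (auto intro!: continuous_intros)

section \<open>Differentiability of finite or infinite order\<close>

definition Ck_open :: "enat \<Rightarrow> 'a::euclidean_space set \<Rightarrow> ('a \<Rightarrow> 'b::real_normed_vector) \<Rightarrow> bool"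
  where "Ck_open k U f \<longleftrightarrow> (\<forall>n. enat n \<le> k \<longrightarrow> Cn_on_open n U f)"

lemma Ck_open_subset: "Ck_open k U f \<Longrightarrow> V \<subseteq> U \<Longrightarrow> Ck_open k V f"
  by (auto simp: Ck_open_def intro: Cn_on_open_subset)

lemma Ck_open_mult:
  fixes f g :: "'a::euclidean_space \<Rightarrow> real"
  shows "open U \<Longrightarrow> Ck_open k U f \<Longrightarrow> Ck_open k U g \<Longrightarrow> Ck_open k U (\<lambda>x. f x * g x)"
  by (auto simp: Ck_open_def intro: Cn_on_open_mult)

lemma Ck_open_compose:
  fixes f :: "'a::euclidean_space \<Rightarrow> 'b::euclidean_space" and g :: "'b \<Rightarrow> real"
  shows "open U \<Longrightarrow> open V \<Longrightarrow> f ` U \<subseteq> V \<Longrightarrow> Ck_open k U f \<Longrightarrow> Ck_open k V g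
    \<Longrightarrow> Ck_open k U (\<lambda>x. g (f x))"
  by (auto simp: Ck_open_def intro: Cn_on_open_compose)

lemma Ck_open_imp_continuous_on: "Ck_open k U f \<Longrightarrow> continuous_on U f"
  unfolding Ck_open_def by (metis Cn_on_open.simps(1) zero_enat_def zero_le)

lemma Ck_on_iff:
  "Ck_on k A f \<longleftrightarrow>
     (\<forall>a\<in>A. \<exists>U g. open U \<and> a \<in> U \<and> Ck_open k U g \<and> (\<forall>x\<in>A \<inter> U. g x = f x))"
  by (simp add: Ck_on_def Ck_open_def)

section \<open>Smooth bump functions\<close>

text \<open>For \<open>m = 0\<close> this is the classical flat function exp (-1/t). The extra
  powers of \<open>inverse t\<close> make the family closed under differentiation up to linear
  combinations, so smoothness follows by one induction over all \<open>m\<close>.\<close>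

definition flat_exp :: "nat \<Rightarrow> real \<Rightarrow> real" where
  "flat_exp m t = (if t > 0 then exp (- inverse t) * inverse t ^ m else 0)"

lemma flat_exp_has_derivative:
  "(flat_exp m has_real_derivative flat_exp (m + 2) t + - real m * flat_exp (m + 1) t) (at t)"
proof -
  consider "t > 0" | "t < 0" | "t = 0" by linarith
  then show ?thesis
  proof cases
    case 1
    have D: "((\<lambda>t. exp (- inverse t) * inverse t ^ m) has_real_derivative
       exp (- inverse t) * inverse t ^ (m + 2) + - real m * (exp (- inverse t) * inverse t ^ (m + 1))) (at t)"
    proof -
      have "((\<lambda>t. inverse t ^ m) has_real_derivative - real m * inverse t ^ (m + 1)) (at t)"
        using 1 DERIV_power[OF DERIV_inverse[of t], of m] by (cases m) (auto simp: algebra_simps)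
      moreover have "((\<lambda>t. exp (- inverse t)) has_real_derivative exp (- inverse t) * inverse t ^ 2) (at t)"
        using 1 by (auto intro!: derivative_eq_intros simp: power2_eq_square)
      ultimately show ?thesis
        by (rule DERIV_cong[OF DERIV_mult[rotated]]) (simp add: power_add power2_eq_square algebra_simps)
    qed
    show ?thesis
      using 1 has_field_derivative_transform_within_open[OF D, of "{0<..}" "flat_exp m"]
      by (auto simp: flat_exp_def)
  next
    case 2
    have D: "((\<lambda>t. 0) has_real_derivative 0) (at t)" by simp
    show ?thesis
      using 2 has_field_derivative_transform_within_open[OF D, of "{..<0}" "flat_exp m"]
      by (auto simp: flat_exp_def)
  next
    case 3
    \<comment> \<open>At 0 the right-hand difference quotient becomes, with \<open>inverse h\<close>
      as variable, a power divided by an exponential at infinity.\<close>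
    have "((\<lambda>h. inverse h ^ (m + 1) / exp (inverse h)) \<longlongrightarrow> 0) (at_right (0 :: real))"
      by (rule filterlim_compose[OF tendsto_power_div_exp_0 filterlim_inverse_at_top_right])
    then have "((\<lambda>h. (flat_exp m (0 + h) - flat_exp m 0) / h) \<longlongrightarrow> 0) (at_right 0)"
      by (rule tendsto_cong[THEN iffD1, rotated])
        (auto simp: eventually_at_filter flat_exp_def exp_minus field_simps)
    moreover have "((\<lambda>h. (flat_exp m (0 + h) - flat_exp m 0) / h) \<longlongrightarrow> 0) (at_left 0)"
      by (rule tendsto_eventually) (auto simp: eventually_at_filter flat_exp_def)
    ultimately have "(flat_exp m has_real_derivative 0) (at 0)"
      unfolding DERIV_def by (intro filterlim_split_at)
    then show ?thesis using 3 by (simp add: flat_exp_def)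
  qed
qed

lemma Cn_on_open_flat_exp: "Cn_on_open n UNIV (flat_exp m)"
proof (induction n arbitrary: m)
  case 0
  show ?case
    by (simp, rule DERIV_continuous_on, rule flat_exp_has_derivative)
next
  case (Suc n)
  show ?case
    by (rule Cn_on_open_Suc_real[OF open_UNIV flat_exp_has_derivative])
      (intro Cn_on_open_add Cn_on_open_mult Cn_on_open_const Suc open_UNIV)
qed

lemma smooth_bump:
  fixes c :: "'a::euclidean_space"
  assumes "r > 0"
  shows "\<exists>\<beta> :: 'a \<Rightarrow> real. (\<forall>n. Cn_on_open n UNIV \<beta>) \<and> (\<forall>z. 0 \<le> \<beta> z) \<and> (\<forall>z. \<beta> z \<le> 1) \<and>
    (\<forall>z. z \<in> ball c (r / 2) \<longrightarrow> \<beta> z = 1) \<and> (\<forall>z. \<beta> z \<noteq> 0 \<longrightarrow> z \<in> ball c r)"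
proof -
  \<comment> \<open>This is 4/3 times 1 - (dist c z / r)^2, scaled so that \<open>s\<close> is at
    least 1 up to distance \<open>r / 2\<close> and at most 0 from distance \<open>r\<close> on. The
    squared norm is written in coordinates so that the closure rules for sums and products
    apply.\<close>
  define s where "s = (\<lambda>z. 4 / 3 + - (4 / 3 / r\<^sup>2) * (\<Sum>b\<in>Basis. ((z - c) \<bullet> b) * ((z - c) \<bullet> b)))"
  let ?E = "flat_exp 0"
  \<comment> \<open>The usual smooth step: the denominator never vanishes because \<open>s z\<close>
    or 1 - \<open>s z\<close> is positive.\<close>
  define \<beta> where "\<beta> = (\<lambda>z. ?E (s z) * inverse (?E (s z) + ?E (1 + - 1 * s z)))"
  have pos: "?E t + ?E (1 + - 1 * t) > 0" for t
    by (auto simp: flat_exp_def add_pos_pos add_pos_nonneg add_nonneg_pos)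
  have Ege: "?E t \<ge> 0" for t by (simp add: flat_exp_def)
  note U = open_UNIV
  have coord: "Cn_on_open n UNIV (\<lambda>z. (z - c) \<bullet> b)" for n b
    unfolding inner_diff_left diff_conv_add_uminus
    by (intro Cn_on_open_add Cn_on_open_bounded_linear_compose[OF _ bounded_linear_inner_left]
        Cn_on_open_id Cn_on_open_const U)
  have s: "Cn_on_open n UNIV s" for n
    unfolding s_def
    by (intro Cn_on_open_add Cn_on_open_mult Cn_on_open_const Cn_on_open_sum coord U)
  have s': "Cn_on_open n UNIV (\<lambda>z. 1 + - 1 * s z)" for n
    by (intro Cn_on_open_add Cn_on_open_mult Cn_on_open_const s U)
  have Es: "Cn_on_open n UNIV (\<lambda>z. ?E (s z))" for n
    by (rule Cn_on_open_compose[OF U U _ s Cn_on_open_flat_exp]) simp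
  have Es': "Cn_on_open n UNIV (\<lambda>z. ?E (1 + - 1 * s z))" for n
    by (rule Cn_on_open_compose[OF U U _ s' Cn_on_open_flat_exp]) simp
  have inv: "Cn_on_open n UNIV (\<lambda>z. inverse (?E (s z) + ?E (1 + - 1 * s z)))" for n
  proof (rule Cn_on_open_compose[OF U _ _ _ Cn_on_open_inverse])
    show "(\<lambda>z. ?E (s z) + ?E (1 + - 1 * s z)) ` UNIV \<subseteq> - {0}"
      using pos by (auto simp: less_le)
  qed (intro Cn_on_open_add Es Es' U open_Compl closed_singleton)+
  show ?thesis
  proof (intro exI conjI allI impI)
    show "Cn_on_open n UNIV \<beta>" for n
      unfolding \<beta>_def by (intro Cn_on_open_mult U Es inv)
    show "0 \<le> \<beta> z" for z
      unfolding \<beta>_def using pos[of "s z"] Ege by (intro mult_nonneg_nonneg) (auto simp: less_imp_le)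
    show "\<beta> z \<le> 1" for z
      unfolding \<beta>_def divide_inverse[symmetric] using pos[of "s z"] Ege by (subst divide_le_eq_1_pos) auto
    have s_eq: "s z = 4 / 3 - 4 / 3 * (dist c z / r)\<^sup>2" for z
      unfolding s_def euclidean_inner[symmetric]
      by (simp add: dist_norm power2_norm_eq_inner[symmetric] norm_minus_commute power_divide)
    show "\<beta> z = 1" if "z \<in> ball c (r / 2)" for z
    proof -
      have "(dist c z / r)\<^sup>2 \<le> (1 / 2)\<^sup>2"
        using that assms by (intro power_mono) (auto simp: field_simps)
      then have "s z \<ge> 1" by (simp add: s_eq power2_eq_square)
      then show ?thesis by (simp add: \<beta>_def flat_exp_def)
    qed
    show "z \<in> ball c r" if "\<beta> z \<noteq> 0" for z
    proof (rule ccontr)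
      assume "z \<notin> ball c r"
      then have "(dist c z / r)\<^sup>2 \<ge> 1\<^sup>2"
        using assms by (intro power_mono) (auto simp: field_simps)
      then have "s z \<le> 0" by (simp add: s_eq)
      then show False using that by (simp add: \<beta>_def flat_exp_def)
    qed
  qed
qed

section \<open>Gluing a sequence of functions with shrinking supports\<close>

text \<open>A bound on the C^n norm over the whole space, through iterated partial derivatives along
  the basis. It is meaningful together with \<open>Cn_on_open n UNIV g\<close>, since
  \<open>frechet_derivative\<close> is arbitrary where no derivative exists.\<close>

primrec deriv_le :: "nat \<Rightarrow> real \<Rightarrow> ('a::euclidean_space \<Rightarrow> real) \<Rightarrow> bool" where
  "deriv_le 0 e g \<longleftrightarrow> (\<forall>x. \<bar>g x\<bar> \<le> e)"
| "deriv_le (Suc n) e g \<longleftrightarrow>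
     (\<forall>x. \<bar>g x\<bar> \<le> e) \<and> (\<forall>b\<in>Basis. deriv_le n e (\<lambda>x. frechet_derivative g (at x) b))"

lemma deriv_leD: "deriv_le n e g \<Longrightarrow> \<bar>g x\<bar> \<le> e"
  by (cases n) auto

lemma deriv_le_mono: "deriv_le n e g \<Longrightarrow> e \<le> e' \<Longrightarrow> deriv_le n e' g"
  by (induction n arbitrary: g) (simp_all, (meson order_trans)+)

lemma deriv_le_add:
  assumes "Cn_on_open n UNIV f" "Cn_on_open n UNIV g" "deriv_le n e f" "deriv_le n e' g"
  shows "deriv_le n (e + e') (\<lambda>x. f x + g x)"
  using assms
proof (induction n arbitrary: f g)
  case 0
  show ?case unfolding deriv_le.simps
  proof
    show "\<bar>f x + g x\<bar> \<le> e + e'" for x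
      using deriv_leD[OF 0(3), of x] deriv_leD[OF 0(4), of x] by linarith
  qed
next
  case (Suc n)
  have D: "frechet_derivative (\<lambda>x. f x + g x) (at x) b =
      frechet_derivative f (at x) b + frechet_derivative g (at x) b" for x b
  proof -
    have "((\<lambda>x. f x + g x) has_derivative
        (\<lambda>b. frechet_derivative f (at x) b + frechet_derivative g (at x) b)) (at x)"
      by (rule has_derivative_add[OF Cn_on_open_SucD(1)[OF Suc.prems(1)]
            Cn_on_open_SucD(1)[OF Suc.prems(2)]]) auto
    then show ?thesis by (rule fun_cong[OF frechet_derivative_at[symmetric]])
  qed
  show ?case unfolding deriv_le.simps D
  proof (intro conjI ballI allI)
    show "\<bar>f x + g x\<bar> \<le> e + e'" for x
      using deriv_leD[OF Suc.prems(3), of x] deriv_leD[OF Suc.prems(4), of x] by linarith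
    show "deriv_le n (e + e')
        (\<lambda>x. frechet_derivative f (at x) b + frechet_derivative g (at x) b)" if "b \<in> Basis" for b
      by (rule Suc.IH[OF Cn_on_open_SucD(2)[OF Suc.prems(1)] Cn_on_open_SucD(2)[OF Suc.prems(2)]])
        (use Suc.prems that in auto)
  qed
qed

lemma frechet_derivative_eq_0:
  assumes "open U" "x \<in> U" "\<And>y. y \<in> U \<Longrightarrow> f y = 0"
  shows "frechet_derivative f (at x) = (\<lambda>_. 0)"
proof -
  have "(f has_derivative (\<lambda>_. 0)) (at x)"
    by (rule has_derivative_transform_within_open[OF has_derivative_const[of 0] assms(1,2)])
      (simp add: assms(3))
  then show ?thesis by (rule frechet_derivative_at[symmetric])
qed

lemma frechet_derivative_eq_0_off_closed:
  assumes "closed K" "x \<notin> K" "\<And>y. y \<notin> K \<Longrightarrow> f y = 0"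
  shows "frechet_derivative f (at x) b = 0"
  using frechet_derivative_eq_0[of "- K" x f] assms by (auto simp: open_Compl)

lemma compact_support_deriv_le:
  fixes g :: "'a::euclidean_space \<Rightarrow> real"
  assumes "compact K" "Cn_on_open n UNIV g" "\<And>x. x \<notin> K \<Longrightarrow> g x = 0"
  shows "\<exists>M. deriv_le n M g"
  using assms(2,3)
proof (induction n arbitrary: g)
  have bounded: "\<exists>M. \<forall>x. \<bar>g x\<bar> \<le> M"
    if "continuous_on UNIV g" "\<And>x. x \<notin> K \<Longrightarrow> g x = 0" for g :: "'a \<Rightarrow> real"
  proof -
    have "bounded (g ` K)"
      by (intro compact_imp_bounded compact_continuous_image continuous_on_subset[OF that(1)] assms) auto
    then obtain M where "\<And>x. x \<in> K \<Longrightarrow> \<bar>g x\<bar> \<le> M" by (auto simp: bounded_iff)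
    then have "\<bar>g x\<bar> \<le> max M 0" for x using that(2)[of x] by (cases "x \<in> K") fastforce+
    then show ?thesis by blast
  qed
  {
    case 0
    then show ?case using bounded[of g] by simp
  next
    case (Suc n)
    have "\<exists>M. deriv_le n M (\<lambda>x. frechet_derivative g (at x) b)" for b
      by (rule Suc.IH[OF Cn_on_open_SucD(2)[OF Suc.prems(1)]])
        (use Suc.prems(2) compact_imp_closed[OF assms(1)] frechet_derivative_eq_0_off_closed in blast)
    then obtain M where M: "\<And>b. deriv_le n (M b) (\<lambda>x. frechet_derivative g (at x) b)" by metis
    obtain M0 where M0: "\<And>x. \<bar>g x\<bar> \<le> M0"
      using bounded[OF Cn_on_open_imp_continuous_on[OF Suc.prems(1)]] Suc.prems(2) by blast
    let ?M = "\<bar>M0\<bar> + (\<Sum>b\<in>Basis. \<bar>M b\<bar>)"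
    have "M b \<le> ?M" if "b \<in> Basis" for b
      using member_le_sum[OF that, of "\<lambda>b. \<bar>M b\<bar>"] by auto
    moreover have "M0 \<le> ?M"
      using sum_nonneg[of "Basis :: 'a set" "\<lambda>b. \<bar>M b\<bar>"] by linarith
    ultimately have "deriv_le (Suc n) ?M g"
      by (auto intro: deriv_le_mono[OF M] order_trans[OF M0])
    then show ?case ..
  }
qed

text \<open>The scalars \<open>c N\<close> absorb the factors produced by differentiating \<open>u ^ N\<close>.\<close>

lemma eventually_deriv_le_mult_power:
  fixes a u :: "'a::euclidean_space \<Rightarrow> real" and c :: "nat \<Rightarrow> real"
  assumes "0 < \<rho>" "\<rho> < 1" "\<And>x. \<bar>u x\<bar> \<le> \<rho>" "compact K"
    and "Cn_on_open n UNIV u" "Cn_on_open n UNIV a" "\<And>x. x \<notin> K \<Longrightarrow> a x = 0"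
    and "\<And>q. 0 \<le> q \<Longrightarrow> q < 1 \<Longrightarrow> (\<lambda>N. c N * q ^ N) \<longlonglongrightarrow> 0" and "e > 0"
  shows "\<forall>\<^sub>F N in sequentially. deriv_le n e (\<lambda>x. c N * (a x * u x ^ (N - s)))"
  using assms(5-)
proof (induction n arbitrary: a c e s)
  have base: "\<forall>\<^sub>F N in sequentially. \<forall>x. \<bar>c N * (a x * u x ^ (N - s))\<bar> \<le> e"
    if "Cn_on_open n UNIV a" "\<And>x. x \<notin> K \<Longrightarrow> a x = 0"
      "\<And>q. 0 \<le> q \<Longrightarrow> q < 1 \<Longrightarrow> (\<lambda>N. c N * q ^ N) \<longlonglongrightarrow> 0" "e > 0"
    for n a e s and c :: "nat \<Rightarrow> real"
  proof -
    from compact_support_deriv_le[OF assms(4) that(1,2)] obtain M where M: "deriv_le n M a" by blast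
    have "(\<lambda>N. \<bar>c N * \<rho> ^ N\<bar> * (\<bar>M\<bar> / \<rho> ^ s)) \<longlonglongrightarrow> 0 * (\<bar>M\<bar> / \<rho> ^ s)"
      by (intro tendsto_mult_right tendsto_rabs_zero that(3)) (use assms in auto)
    then have "\<forall>\<^sub>F N in sequentially. \<bar>c N * \<rho> ^ N\<bar> * (\<bar>M\<bar> / \<rho> ^ s) < e"
      using that(4) by (auto dest: order_tendstoD)
    moreover have "\<forall>\<^sub>F N in sequentially. N \<ge> s" by (rule eventually_ge_at_top)
    ultimately show ?thesis
    proof eventually_elim
      case (elim N)
      show ?case
      proof
        fix x
        have "\<bar>c N * (a x * u x ^ (N - s))\<bar> = \<bar>c N\<bar> * (\<bar>a x\<bar> * \<bar>u x\<bar> ^ (N - s))"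
          by (simp add: abs_mult power_abs)
        also have "\<dots> \<le> \<bar>c N\<bar> * (\<bar>M\<bar> * \<rho> ^ (N - s))"
          using deriv_leD[OF M, of x] assms(1,3)
          by (intro mult_mono power_mono mult_nonneg_nonneg) auto
        also have "\<rho> ^ (N - s) = \<rho> ^ N / \<rho> ^ s"
          using assms(1) elim by (simp add: power_diff)
        also have "\<bar>c N\<bar> * (\<bar>M\<bar> * (\<rho> ^ N / \<rho> ^ s)) = \<bar>c N * \<rho> ^ N\<bar> * (\<bar>M\<bar> / \<rho> ^ s)"
          using assms(1) by (simp add: abs_mult)
        finally show "\<bar>c N * (a x * u x ^ (N - s))\<bar> \<le> e" using elim by linarith
      qed
    qed
  qed
  {
    case 0
    then show ?case using base[of 0 a c e s] by simp
  next
    case (Suc n)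
    note du = Cn_on_open_SucD[OF Suc.prems(1)] and da = Cn_on_open_SucD[OF Suc.prems(2)]
    let ?D = "\<lambda>f x. frechet_derivative f (at x)"
    \<comment> \<open>Both terms have the shape of the claim: the first with \<open>a\<close>
      replaced by its derivative, the second with \<open>a\<close> multiplied by a derivative of
      \<open>u\<close>, \<open>c N\<close> by \<open>real (N - s)\<close>, and \<open>s\<close>
      raised by one. Truncated subtraction is harmless, as for \<open>N \<le> s\<close> the second
      factor is 0.\<close>
    have D: "?D (\<lambda>x. c N * (a x * u x ^ (N - s))) x b =
        c N * (?D a x b * u x ^ (N - s)) +
        (c N * real (N - s)) * ((a x * ?D u x b) * u x ^ (N - Suc s))" for N x b
    proof -
      have "((\<lambda>x. c N * (a x * u x ^ (N - s))) has_derivative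
          (\<lambda>b. c N * (?D a x b * u x ^ (N - s)) +
            (c N * real (N - s)) * ((a x * ?D u x b) * u x ^ (N - Suc s)))) (at x)"
        by (auto intro!: derivative_eq_intros da(1) du(1) simp: algebra_simps)
      then show ?thesis by (rule fun_cong[OF frechet_derivative_at[symmetric]])
    qed
    have Da0: "?D a x b = 0" if "x \<notin> K" for x b
      using frechet_derivative_eq_0_off_closed compact_imp_closed[OF assms(4)] Suc.prems(3) that by blast
    have c': "(\<lambda>N. (c N * real (N - s)) * q ^ N) \<longlonglongrightarrow> 0" if "0 \<le> q" "q < 1" for q
    proof -
      \<comment> \<open>Splitting \<open>q ^ N\<close> into two copies of \<open>p ^ N\<close> lets
        one copy absorb the new factor \<open>real (N - s)\<close> and leaves the other for
        \<open>c N\<close>.\<close>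
      define p where "p = sqrt q"
      have p: "0 \<le> p" "p < 1" "q = p * p" using that by (auto simp: p_def)
      have "(\<lambda>N. real (N - s) * p ^ N) \<longlonglongrightarrow> 0"
      proof (rule tendsto_sandwich[OF _ _ tendsto_const])
        show "(\<lambda>N. real N * p ^ N) \<longlonglongrightarrow> 0"
          using powser_times_n_limit_0[of p] p by auto
      qed (use p in \<open>auto intro!: always_eventually mult_right_mono\<close>)
      from tendsto_mult[OF Suc.prems(4)[OF p(1,2)] this]
      show ?thesis by (simp add: p(3) power_mult_distrib mult_ac)
    qed
    have "\<forall>\<^sub>F N in sequentially. deriv_le n e (\<lambda>x. ?D (\<lambda>x. c N * (a x * u x ^ (N - s))) x b)" for b
    proof -
      have Cn1: "Cn_on_open n UNIV (\<lambda>x. ?D a x b)" by (rule da(2))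
      have Cn2: "Cn_on_open n UNIV (\<lambda>x. a x * ?D u x b)"
        by (intro Cn_on_open_mult open_UNIV Suc.prems(2)[THEN Cn_on_open_Suc_imp] du(2))
      have "\<forall>\<^sub>F N in sequentially. deriv_le n (e / 2) (\<lambda>x. c N * (?D a x b * u x ^ (N - s)))"
        by (rule Suc.IH[OF Suc.prems(1)[THEN Cn_on_open_Suc_imp] Cn1])
          (use Da0 Suc.prems in auto)
      moreover have "\<forall>\<^sub>F N in sequentially. deriv_le n (e / 2)
          (\<lambda>x. (c N * real (N - s)) * ((a x * ?D u x b) * u x ^ (N - Suc s)))"
        by (rule Suc.IH[OF Suc.prems(1)[THEN Cn_on_open_Suc_imp] Cn2 _ c'])
          (use Suc.prems in auto)
      ultimately show ?thesis
      proof eventually_elim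
        case (elim N)
        have Cu: "Cn_on_open n UNIV (\<lambda>x. u x ^ m)" for m
          by (intro Cn_on_open_power open_UNIV Suc.prems(1)[THEN Cn_on_open_Suc_imp])
        have "deriv_le n (e / 2 + e / 2) (\<lambda>x. c N * (?D a x b * u x ^ (N - s)) +
            (c N * real (N - s)) * ((a x * ?D u x b) * u x ^ (N - Suc s)))"
          by (rule deriv_le_add[OF _ _ elim])
            (intro Cn_on_open_mult Cn_on_open_const open_UNIV Cn1 Cn2 Cu)+
        then show ?case unfolding D by simp
      qed
    qed
    then have "\<forall>\<^sub>F N in sequentially. \<forall>b\<in>Basis.
        deriv_le n e (\<lambda>x. ?D (\<lambda>x. c N * (a x * u x ^ (N - s))) x b)"
      by (intro eventually_ball_finite) auto
    moreover have "\<forall>\<^sub>F N in sequentially. \<forall>x. \<bar>c N * (a x * u x ^ (N - s))\<bar> \<le> e"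
      by (rule base[OF Suc.prems(2)]) (use Suc.prems in auto)
    ultimately show ?case by eventually_elim simp
  }
qed

text \<open>One factor \<open>u x\<close> is split off to serve as the compactly supported
  \<open>a\<close>. The maximum with 1/2 provides the strictly positive bound required
  there.\<close>

lemma eventually_deriv_le_power:
  fixes u :: "'a::euclidean_space \<Rightarrow> real"
  assumes "\<rho> < 1" "\<And>x. \<bar>u x\<bar> \<le> \<rho>" "compact K" "Cn_on_open n UNIV u"
    "\<And>x. x \<notin> K \<Longrightarrow> u x = 0" "e > 0"
  shows "\<forall>\<^sub>F N in sequentially. deriv_le n e (\<lambda>x. u x ^ N)"
proof -
  have "\<forall>\<^sub>F N in sequentially. deriv_le n e (\<lambda>x. 1 * (u x * u x ^ (N - 1)))"
  proof (rule eventually_deriv_le_mult_power[of "max \<rho> (1/2)", OF _ _ _ assms(3,4,4,5) _ assms(6)])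
    show "\<bar>u x\<bar> \<le> max \<rho> (1/2)" for x using assms(2)[of x] by simp
    show "(\<lambda>N. 1 * q ^ N) \<longlonglongrightarrow> 0" if "0 \<le> q" "q < 1" for q :: real
      using LIMSEQ_realpow_zero[OF that] by simp
  qed (use assms in auto)
  moreover have "\<forall>\<^sub>F N in sequentially. N \<ge> (1::nat)" by (rule eventually_ge_at_top)
  ultimately show ?thesis
  proof eventually_elim
    case (elim N)
    then have "u x * u x ^ (N - 1) = u x ^ N" for x by (cases N) auto
    then show ?case using elim by simp
  qed
qed

section \<open>Summing humps on disjoint annuli\<close>

lemma suminf_eq_single:
  fixes f :: "nat \<Rightarrow> real"
  assumes "\<And>i. i \<noteq> j \<Longrightarrow> f i = 0"
  shows "suminf f = f j"
  using suminf_finite[of "{j}" f] assms by auto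

lemma halving_le:
  fixes d :: "nat \<Rightarrow> real"
  assumes "\<And>j. 0 < d j" "\<And>j. d (Suc j) \<le> d j / 2"
  shows "i \<le> j \<Longrightarrow> d j \<le> d i" "i < j \<Longrightarrow> d j \<le> d i / 2"
proof -
  have mono: "d (i + l) \<le> d i" for i l
  proof (induction l)
    case (Suc l)
    show ?case using Suc assms(1)[of "i + l"] assms(2)[of "i + l"] by simp
  qed simp
  show "d j \<le> d i" if "i \<le> j" using mono[of i "j - i"] that by simp
  show "d j \<le> d i / 2" if "i < j"
  proof -
    from that obtain l where "j = Suc i + l" using less_iff_Suc_add by auto
    then show ?thesis using mono[of "Suc i" l] assms(2)[of i] by simp
  qed
qed

lemma halving_tendsto_0:
  fixes d :: "nat \<Rightarrow> real"
  assumes "\<And>j. 0 < d j" "\<And>j. d (Suc j) \<le> d j / 2"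
  shows "d \<longlonglongrightarrow> 0"
proof (rule tendsto_sandwich[OF _ _ tendsto_const])
  have "d j \<le> d 0 * (1 / 2) ^ j" for j
  proof (induction j)
    case (Suc j)
    then show ?case using assms(2)[of j] by simp
  qed simp
  then show "\<forall>\<^sub>F j in sequentially. d j \<le> d 0 * (1 / 2) ^ j" by simp
  have "(\<lambda>j. d 0 * (1 / 2) ^ j) \<longlonglongrightarrow> d 0 * 0"
    by (intro tendsto_intros LIMSEQ_realpow_zero) auto
  then show "(\<lambda>j. d 0 * (1 / 2) ^ j) \<longlonglongrightarrow> 0" by simp
  show "\<forall>\<^sub>F j in sequentially. 0 \<le> d j"
    using assms(1) by (intro always_eventually allI less_imp_le)
qed

text \<open>As \<open>d\<close> at least halves, 5/4 * d (Suc j) is at most 5/8 * d j, below 3/4 * d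
  j. Hence the annuli are disjoint and at most one summand is nonzero at any point.\<close>

lemma suminf_annuli:
  fixes F :: "nat \<Rightarrow> 'a::metric_space \<Rightarrow> real" and d :: "nat \<Rightarrow> real"
  assumes d: "\<And>j. 0 < d j" "\<And>j. d (Suc j) \<le> d j / 2"
    and supp: "\<And>j z. F j z \<noteq> 0 \<Longrightarrow> 3 / 4 * d j \<le> dist a z \<and> dist a z \<le> 5 / 4 * d j"
    and z: "3 / 4 * d i \<le> dist a z" "dist a z \<le> 5 / 4 * d i"
  shows "(\<Sum>j. F j z) = F i z"
proof (rule suminf_eq_single[of i "\<lambda>j. F j z"], rule ccontr)
  fix j assume "j \<noteq> i" "F j z \<noteq> 0"
  with supp[of j z] z show False
    using halving_le(2)[of d i j, OF d] halving_le(2)[of d j i, OF d] d(1)[of i] d(1)[of j]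
    by (cases i j rule: linorder_cases) simp_all
qed

text \<open>Away from \<open>a\<close> the sum is locally finite. At \<open>a\<close> the square in
  \<open>(d j)\<^sup>2\<close> matters: the sum is of second order there, so it has derivative 0,
  and the sum of the derivatives satisfies the same hypotheses one order lower. The index
  \<open>j0\<close> allows bounds that hold only for late humps, as happens for
  \<open>k = \<infinity>\<close>.\<close>

lemma Cn_on_open_glue:
  fixes F :: "nat \<Rightarrow> 'a::euclidean_space \<Rightarrow> real" and d :: "nat \<Rightarrow> real"
  assumes d: "\<And>j. 0 < d j" "\<And>j. d (Suc j) \<le> d j / 2"
    and "\<And>j. Cn_on_open n UNIV (F j)"
    and "\<And>j z. F j z \<noteq> 0 \<Longrightarrow> 3 / 4 * d j \<le> dist a z \<and> dist a z \<le> 5 / 4 * d j"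
    and "\<And>j. j \<ge> j0 \<Longrightarrow> deriv_le n ((d j)\<^sup>2) (F j)"
  shows "Cn_on_open n UNIV (\<lambda>z. \<Sum>j. F j z)"
  using assms(3-)
proof (induction n arbitrary: F)
  have d_mono: "d j \<le> d i" if "i \<le> j" for i j
    using halving_le(1)[of d, OF d that] .
  have d_lim: "\<exists>m. 5 / 4 * d m < t" if "t > 0" for t
  proof -
    have "\<forall>\<^sub>F j in sequentially. d j < 4 / 5 * t"
      by (rule order_tendstoD(2)[OF halving_tendsto_0[of d, OF d]]) (use that in auto)
    then obtain m where "d m < 4 / 5 * t" by (meson eventually_sequentially order_refl)
    then show ?thesis by (intro exI[of _ m]) simp
  qed
  let ?supp = "\<lambda>F :: nat \<Rightarrow> 'a \<Rightarrow> real. \<forall>j z. F j z \<noteq> 0 \<longrightarrow> 3 / 4 * d j \<le> dist a z \<and> dist a z \<le> 5 / 4 * d j"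
  have single: "(\<Sum>j. F j z) = F i z" if "F i z \<noteq> 0" "?supp F" for F i z
    by (rule suminf_annuli[of d F a, OF d]) (use that in blast)+
  have away: "(\<Sum>j. F j z) = (\<Sum>j<m. F j z)" if "5 / 4 * d m < dist a z" "?supp F" for F m z
  proof (rule suminf_finite)
    fix j assume "j \<notin> {..<m}"
    then have "d j \<le> d m" using d_mono[of m j] by simp
    then show "F j z = 0" using that by force
  qed simp
  have quad: "\<bar>\<Sum>j. F j z\<bar> \<le> 2 * (dist a z)\<^sup>2"
    if "?supp F" "\<And>j. j \<ge> j0 \<Longrightarrow> deriv_le n ((d j)\<^sup>2) (F j)" "dist a z < 3 / 4 * d j0" for F n z
  proof (cases "\<exists>i. F i z \<noteq> 0")
    case True
    then obtain i where i: "F i z \<noteq> 0" by blast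
    then have di: "d i \<le> 4 / 3 * dist a z" using that(1) by fastforce
    have "i \<ge> j0"
    proof (rule ccontr)
      assume "\<not> i \<ge> j0"
      then have "d j0 \<le> d i" using d_mono[of i j0] by simp
      then show False using di that(3) by simp
    qed
    then have "\<bar>F i z\<bar> \<le> (d i)\<^sup>2" using deriv_leD[OF that(2)] by blast
    \<comment> \<open>The inner radius 3/4 * d i of the annulus gives the factor 4/3, and 16/9 is at
      most 2.\<close>
    also have "\<dots> \<le> (4 / 3 * dist a z)\<^sup>2" using di d(1)[of i] by (intro power_mono) auto
    also have "\<dots> \<le> 2 * (dist a z)\<^sup>2" by (simp add: power_mult_distrib power2_eq_square)
    finally show ?thesis using single[of F i z] i that(1) by simp
  qed simp
  let ?G = "\<lambda>F z. \<Sum>j. F j z"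
  \<comment> \<open>The pair \<open>m\<close>, \<open>T\<close> is chosen before \<open>F\<close>,
    so one neighbourhood serves the series and its termwise derivatives simultaneously.\<close>
  have away_open: "\<exists>m T. open T \<and> z \<in> T \<and> (\<forall>F. ?supp F \<longrightarrow> (\<forall>y\<in>T. (\<Sum>j<m. F j y) = ?G F y))"
    if "z \<noteq> a" for z
  proof -
    have "dist a z > 0" using that by simp
    from d_lim[OF this] obtain m where m: "5 / 4 * d m < dist a z" by blast
    have "open {y. 5 / 4 * d m < dist a y}" by (intro open_Collect_less continuous_intros)
    then show ?thesis using m away by (intro exI[of _ m] exI[of _ "{y. 5 / 4 * d m < dist a y}"]) auto
  qed
  have Ga: "?G F a = 0" if "?supp F" for F
  proof -
    have "F j a = 0" for j using that d(1)[of j] by fastforce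
    then show ?thesis by simp
  qed
  {
    case 0
    then have supp: "?supp F" by blast
    have "isCont (?G F) z" for z
    proof (cases "z = a")
      case True
      have ev: "\<forall>\<^sub>F y in at a. norm (?G F y - 0) \<le> 2 * (dist a y)\<^sup>2"
        unfolding eventually_at using d(1)[of j0] quad[OF supp 0(3)]
        by (intro exI[of _ "3 / 4 * d j0"]) (auto simp: dist_commute)
      have "((\<lambda>y. 2 * (dist a y)\<^sup>2) \<longlongrightarrow> 2 * (dist a a)\<^sup>2) (at a)"
        by (intro tendsto_intros)
      then have "(?G F \<longlongrightarrow> 0) (at a)"
        using ev by (auto intro: Lim_transform_bound Lim_null_comparison)
      then show ?thesis using True Ga[OF supp] by (simp add: isCont_def)
    next
      case False
      from away_open[OF False] obtain m T where T': "open T" "z \<in> T"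
        "\<forall>F. ?supp F \<longrightarrow> (\<forall>y\<in>T. (\<Sum>j<m. F j y) = ?G F y)"
        by (elim exE conjE)
      note T = T'(1,2) mp[OF spec[OF T'(3)] supp]
      have "isCont (\<lambda>y. \<Sum>j<m. F j y) z"
        using 0(1) by (intro continuous_sum) (auto simp: continuous_on_eq_continuous_at)
      moreover have "\<forall>\<^sub>F y in nhds z. (\<Sum>j<m. F j y) = ?G F y"
        using T by (auto simp: eventually_nhds)
      ultimately show ?thesis by (rule iffD1[OF isCont_cong, rotated])
    qed
    then show ?case by (simp add: continuous_at_imp_continuous_on)
  next
    case (Suc n)
    then have supp: "?supp F" by blast
    let ?D = "\<lambda>j z b. frechet_derivative (F j) (at z) b"
    have suppD: "?supp (\<lambda>j z. ?D j z b)" for b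
    proof -
      have "?D j z b = 0" if "\<not> (3 / 4 * d j \<le> dist a z \<and> dist a z \<le> 5 / 4 * d j)" for j z
      proof (rule frechet_derivative_eq_0_off_closed[of "{z. 3 / 4 * d j \<le> dist a z \<and> dist a z \<le> 5 / 4 * d j}"])
        show "closed {z. 3 / 4 * d j \<le> dist a z \<and> dist a z \<le> 5 / 4 * d j}"
          by (intro closed_Collect_conj closed_Collect_le continuous_intros)
      qed (use that supp in auto)
      then show ?thesis by blast
    qed
    have der: "(?G F has_derivative (\<lambda>b. \<Sum>j. ?D j z b)) (at z)" for z
    proof (cases "z = a")
      case True
      have "(?G F has_derivative (\<lambda>_. 0)) (at a)"
      proof (rule has_derivativeI_sandwich[of "3 / 4 * d j0"])
        show "0 < 3 / 4 * d j0" using d(1) by simp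
        show "((\<lambda>y. 2 * dist a y) \<longlongrightarrow> 0) (at a)"
          by (rule tendsto_eq_intros refl | simp)+
        show "norm (?G F y - ?G F a - 0) / norm (y - a) \<le> 2 * dist a y"
          if "y \<in> UNIV" "y \<noteq> a" "dist y a < 3 / 4 * d j0" for y
          using quad[OF supp Suc.prems(3), of y] that Ga[OF supp]
          by (simp add: dist_norm norm_minus_commute power2_eq_square divide_le_eq mult.assoc)
      qed auto
      then show ?thesis using True Ga[OF suppD] by simp
    next
      case False
      from away_open[OF False] obtain m T where T: "open T" "z \<in> T"
        "\<forall>F. ?supp F \<longrightarrow> (\<forall>y\<in>T. (\<Sum>j<m. F j y) = ?G F y)"
        by (elim exE conjE)
      note TF = mp[OF spec[OF T(3)] supp]
      have "((\<lambda>y. \<Sum>j<m. F j y) has_derivative (\<lambda>b. \<Sum>j<m. ?D j z b)) (at z)"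
        by (intro has_derivative_sum Cn_on_open_SucD(1)[OF Suc.prems(1)]) auto
      moreover have "(\<Sum>j<m. ?D j z b) = (\<Sum>j. ?D j z b)" for b
        by (rule bspec[OF mp[OF spec[OF T(3)] suppD] T(2)])
      ultimately have "((\<lambda>y. \<Sum>j<m. F j y) has_derivative (\<lambda>b. \<Sum>j. ?D j z b)) (at z)" by simp
      then show ?thesis
        by (rule has_derivative_transform_within_open[OF _ T(1,2)]) (use TF in blast)
    qed
    show ?case
    proof (rule Cn_on_open_Suc_Basis)
      show "?G F differentiable at z" for z using der by (auto simp: differentiable_def)
      have D: "frechet_derivative (?G F) (at z) b = (\<Sum>j. ?D j z b)" for z b
        by (rule fun_cong[OF frechet_derivative_at[OF der, symmetric]])
      show "Cn_on_open n UNIV (\<lambda>z. frechet_derivative (?G F) (at z) b)" if "b \<in> Basis" for b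
        unfolding D
      proof (rule Suc.IH)
        show "Cn_on_open n UNIV (\<lambda>z. ?D j z b)" for j
          by (rule Cn_on_open_SucD(2)[OF Suc.prems(1)])
        show "deriv_le n ((d j)\<^sup>2) (\<lambda>z. ?D j z b)" if "j \<ge> j0" for j
          using Suc.prems(3)[OF that] \<open>b \<in> Basis\<close> by simp
      qed (use suppD in blast)
    qed simp
  }
qed

lemma Cn_on_open_Un:
  assumes "open A" "open B" "Cn_on_open n A f" "Cn_on_open n B f"
  shows "Cn_on_open n (A \<union> B) f"
  using assms(3,4)
proof (induction n arbitrary: f)
  case 0
  then show ?case using assms(1,2) by (simp add: continuous_on_open_Un)
qed auto

text \<open>Off \<open>K\<close> the product is 0 whatever \<open>g\<close> does, and the open sets
  \<open>T\<close> and \<open>- K\<close> cover the space.\<close>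

lemma Cn_on_open_cutoff:
  fixes \<beta> g :: "'a::euclidean_space \<Rightarrow> real"
  assumes "open T" "closed K" "K \<subseteq> T" "Cn_on_open n UNIV \<beta>" "Cn_on_open n T g"
    and "\<And>z. z \<notin> K \<Longrightarrow> \<beta> z = 0"
  shows "Cn_on_open n UNIV (\<lambda>z. \<beta> z * g z)"
proof -
  have "Cn_on_open n T (\<lambda>z. \<beta> z * g z)"
    by (intro Cn_on_open_mult assms Cn_on_open_subset[OF assms(4)] subset_UNIV)
  moreover have "Cn_on_open n (- K) (\<lambda>z. \<beta> z * g z)"
    by (rule Cn_on_open_cong[OF _ _ Cn_on_open_const[of _ _ 0]]) (use assms in auto)
  ultimately have "Cn_on_open n (T \<union> - K) (\<lambda>z. \<beta> z * g z)"
    by (intro Cn_on_open_Un) (use assms in auto)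
  moreover have "T \<union> - K = UNIV" using assms by auto
  ultimately show ?thesis by simp
qed

section \<open>$C^k$ functions on manifolds\<close>

text \<open>The condition of \<open>Ck_on\<close> at one point, read off along the chart instead of
  through \<open>inv_into\<close>. Regularity at a single point makes local operations such as
  inverse and logarithm available where \<open>x\<close> has the right sign.\<close>

definition ck_in_chart :: "enat \<Rightarrow> ('p, 'a::euclidean_space) chart \<Rightarrow> ('p \<Rightarrow> real) \<Rightarrow> 'p \<Rightarrow> bool" where
  "ck_in_chart k c x p \<longleftrightarrow>
     (\<exists>T g. open T \<and> snd c p \<in> T \<and> Ck_open k T g \<and> (\<forall>q\<in>fst c. snd c q \<in> T \<longrightarrow> g (snd c q) = x q))"

definition ck_at :: "enat \<Rightarrow> ('p, 'a::euclidean_space) chart set \<Rightarrow> ('p \<Rightarrow> real) \<Rightarrow> 'p \<Rightarrow> bool" where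
  "ck_at k \<A> x p \<longleftrightarrow> (\<forall>c\<in>\<A>. p \<in> fst c \<longrightarrow> ck_in_chart k c x p)"

lemma ck_in_chart_compose:
  assumes "ck_in_chart k c x p" "open S" "Ck_open k S F" "x p \<in> S" "p \<in> fst c"
  shows "ck_in_chart k c (\<lambda>q. F (x q)) p"
proof -
  obtain U h where c: "c = (U, h)" by fastforce
  obtain T g where T: "open T" "h p \<in> T" "Ck_open k T g" "\<And>q. q \<in> U \<Longrightarrow> h q \<in> T \<Longrightarrow> g (h q) = x q"
    using assms(1) unfolding ck_in_chart_def c by auto
  let ?T = "T \<inter> g -` S"
  have T': "open ?T"
    using continuous_open_preimage[OF Ck_open_imp_continuous_on[OF T(3)] T(1) assms(2)] .
  have "Ck_open k ?T (\<lambda>z. F (g z))"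
    by (rule Ck_open_compose[OF T' assms(2) _ Ck_open_subset[OF T(3)] assms(3)]) auto
  moreover have "h p \<in> ?T" using T(2) T(4)[of p] assms(4,5) c by auto
  ultimately show ?thesis
    using T' T(4) unfolding ck_in_chart_def c by (intro exI[of _ ?T] exI[of _ "\<lambda>z. F (g z)"]) auto
qed

lemma ck_in_chart_mult:
  assumes "ck_in_chart k c x p" "ck_in_chart k c y p"
  shows "ck_in_chart k c (\<lambda>q. x q * y q) p"
proof -
  obtain U h where c: "c = (U, h)" by fastforce
  obtain T g where T: "open T" "h p \<in> T" "Ck_open k T g" "\<And>q. q \<in> U \<Longrightarrow> h q \<in> T \<Longrightarrow> g (h q) = x q"
    using assms(1) unfolding ck_in_chart_def c by auto
  obtain T' g' where T': "open T'" "h p \<in> T'" "Ck_open k T' g'"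
    "\<And>q. q \<in> U \<Longrightarrow> h q \<in> T' \<Longrightarrow> g' (h q) = y q"
    using assms(2) unfolding ck_in_chart_def c by auto
  have "Ck_open k (T \<inter> T') (\<lambda>z. g z * g' z)"
    by (intro Ck_open_mult open_Int T T' Ck_open_subset[OF T(3)] Ck_open_subset[OF T'(3)]) auto
  then show ?thesis
    using T T' unfolding ck_in_chart_def c
    by (intro exI[of _ "T \<inter> T'"] exI[of _ "\<lambda>z. g z * g' z"]) auto
qed

lemma Ck_open_const: "open U \<Longrightarrow> Ck_open k U (\<lambda>_. c)"
  by (simp add: Ck_open_def Cn_on_open_const)

lemma ck_at_compose:
  assumes "ck_at k \<A> x p" "open S" "Ck_open k S F" "x p \<in> S"
  shows "ck_at k \<A> (\<lambda>q. F (x q)) p"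
  unfolding ck_at_def
proof (intro ballI impI)
  fix c assume "c \<in> \<A>" "p \<in> fst c"
  then show "ck_in_chart k c (\<lambda>q. F (x q)) p"
    using ck_in_chart_compose[of k c x p S F] assms by (auto simp: ck_at_def)
qed

lemma ck_at_mult: "ck_at k \<A> x p \<Longrightarrow> ck_at k \<A> y p \<Longrightarrow> ck_at k \<A> (\<lambda>q. x q * y q) p"
  unfolding ck_at_def by (simp add: ck_in_chart_mult)

lemma ck_at_const: "ck_at k \<A> (\<lambda>_. c) p"
  unfolding ck_at_def ck_in_chart_def
  by (intro ballI impI exI[of _ UNIV] exI[of _ "\<lambda>_. c"]) (simp add: Ck_open_const)

lemma ck_at_add_const: "ck_at k \<A> x p \<Longrightarrow> ck_at k \<A> (\<lambda>q. x q + c) p"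
  by (rule ck_at_compose[where x = x and S = UNIV and F = "\<lambda>t. t + c"])
    (auto simp: Ck_open_def intro!: Cn_on_open_add Cn_on_open_id Cn_on_open_const)

lemma ck_at_inverse: "ck_at k \<A> x p \<Longrightarrow> x p \<noteq> 0 \<Longrightarrow> ck_at k \<A> (\<lambda>q. inverse (x q)) p"
  by (rule ck_at_compose[where x = x and S = "- {0}" and F = inverse]) (auto simp: Ck_open_def Cn_on_open_inverse)

lemma ck_at_ln: "ck_at k \<A> x p \<Longrightarrow> x p > 0 \<Longrightarrow> ck_at k \<A> (\<lambda>q. ln (x q)) p"
  by (rule ck_at_compose[where x = x and S = "{0<..}" and F = ln]) (auto simp: Ck_open_def Cn_on_open_ln)

lemma ck_at_exp: "ck_at k \<A> x p \<Longrightarrow> ck_at k \<A> (\<lambda>q. exp (x q)) p"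
  by (rule ck_at_compose[where x = x and S = UNIV and F = exp]) (auto simp: Ck_open_def Cn_on_open_exp)

section \<open>Charts and independence of the chart\<close>

locale smooth_mfd =
  fixes X :: "'p topology" and \<A> :: "('p, 'a::euclidean_space) chart set"
  assumes smooth_manifold: "smooth_manifold X \<A>"
begin

lemma Hausdorff: "Hausdorff_space X"
  using smooth_manifold by (simp add: smooth_manifold_def)

lemma chart_cover: "p \<in> topspace X \<Longrightarrow> \<exists>U h. (U, h) \<in> \<A> \<and> p \<in> U"
  using smooth_manifold unfolding smooth_manifold_def smooth_atlas_def by blast

lemma chart:
  assumes "(U, h) \<in> \<A>"
  shows chart_open: "openin X U"
    and chart_image: "\<exists>S u. subspace S \<and> S \<noteq> {0} \<and> openin (top_of_set {x \<in> S. 0 \<le> u \<bullet> x}) (h ` U)"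
    and chart_homeo: "homeomorphic_map (subtopology X U) (top_of_set (h ` U)) h"
  using assms smooth_manifold
  by (auto simp: smooth_manifold_def smooth_atlas_def is_chart_def dest!: bspec)

lemma chart_inv:
  assumes "(U, h) \<in> \<A>" "p \<in> U"
  shows "inv_into U h (h p) = p"
proof -
  have "topspace (subtopology X U) = U"
    using openin_subset[OF chart_open[OF assms(1)]] by auto
  then have "inj_on h U"
    using homeomorphic_imp_injective_map[OF chart_homeo[OF assms(1)]] by simp
  then show ?thesis using assms(2) by (rule inv_into_f_f)
qed

lemma chart_subset: "(U, h) \<in> \<A> \<Longrightarrow> p \<in> U \<Longrightarrow> p \<in> topspace X"
  using openin_subset chart_open by blast

lemma chart_preimage_open:
  assumes "(U, h) \<in> \<A>" "open T"
  shows "openin X {q \<in> U. h q \<in> T}"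
proof -
  have "continuous_map (subtopology X U) (top_of_set (h ` U)) h"
    by (rule homeomorphic_imp_continuous_map[OF chart_homeo[OF assms(1)]])
  then have "continuous_map (subtopology X U) euclidean h"
    by (simp add: continuous_map_in_subtopology)
  then have "openin (subtopology X U) {q \<in> topspace (subtopology X U). h q \<in> T}"
    using assms(2) by (intro openin_continuous_map_preimage) auto
  moreover have "topspace (subtopology X U) = U"
    using openin_subset[OF chart_open[OF assms(1)]] by auto
  ultimately have "openin (subtopology X U) {q \<in> U. h q \<in> T}" by (simp only:)
  then show ?thesis by (rule openin_trans_full[OF _ chart_open[OF assms(1)]])
qed

lemma chart_image_open:
  assumes "(U, h) \<in> \<A>" "openin X N" "p \<in> N" "p \<in> U"
  obtains T where "open T" "h p \<in> T" "\<And>q. q \<in> U \<Longrightarrow> h q \<in> T \<Longrightarrow> q \<in> N"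
proof -
  have "openin (subtopology X U) (U \<inter> N)"
    by (rule openin_subtopology_Int2[OF assms(2)])
  then have "openin (top_of_set (h ` U)) (h ` (U \<inter> N))"
    using homeomorphic_imp_open_map[OF chart_homeo[OF assms(1)]] by (simp add: open_map_def)
  then obtain T where T: "open T" "h ` (U \<inter> N) = h ` U \<inter> T"
    unfolding openin_open by auto
  have "q \<in> N" if "q \<in> U" "h q \<in> T" for q
  proof -
    have "h q \<in> h ` (U \<inter> N)" using that T(2) by blast
    then obtain q' where "q' \<in> U" "q' \<in> N" "h q' = h q" by auto
    then show ?thesis using chart_inv[OF assms(1)] that(1) by metis
  qed
  moreover have "h p \<in> T" using T(2) assms(3,4) by blast
  ultimately show ?thesis using that T(1) by blast
qed

text \<open>Compose the local extension of \<open>x\<close> with a local extension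
  \<open>\<tau>\<close> of the chart change. Since \<open>\<tau>\<close> agrees with the chart
  change only on the overlap, \<open>T3\<close> is intersected in to force \<open>q\<close> into
  \<open>U\<close>.\<close>

lemma ck_in_chart_transfer:
  assumes c: "(U, h) \<in> \<A>" "(U', h') \<in> \<A>" "p \<in> U" "p \<in> U'" and x: "ck_in_chart k (U, h) x p"
  shows "ck_in_chart k (U', h') x p"
proof -
  obtain T g where T: "open T" "h p \<in> T" "Ck_open k T g" "\<And>q. q \<in> U \<Longrightarrow> h q \<in> T \<Longrightarrow> g (h q) = x q"
    using x unfolding ck_in_chart_def by auto
  have "Ck_on \<infinity> (h' ` (U' \<inter> U)) (h \<circ> inv_into U' h')"
    using smooth_manifold c(1,2) unfolding smooth_manifold_def smooth_atlas_def by fast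
  then obtain T1 \<tau> where T1: "open T1" "h' p \<in> T1" "Ck_open \<infinity> T1 \<tau>"
    "\<And>z. z \<in> h' ` (U' \<inter> U) \<inter> T1 \<Longrightarrow> \<tau> z = (h \<circ> inv_into U' h') z"
    unfolding Ck_on_iff using c(3,4) by (metis IntI imageI)
  obtain T3 where T3: "open T3" "h' p \<in> T3" "\<And>q. q \<in> U' \<Longrightarrow> h' q \<in> T3 \<Longrightarrow> q \<in> U"
    using chart_image_open[OF c(2) chart_open[OF c(1)] c(3,4)] by blast
  have \<tau>: "\<tau> (h' q) = h q" if "q \<in> U'" "q \<in> U" "h' q \<in> T1" for q
    using T1(4)[of "h' q"] that chart_inv[OF c(2) that(1)] by auto
  let ?T = "(T1 \<inter> \<tau> -` T) \<inter> T3"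
  have oT: "open ?T"
    using continuous_open_preimage[OF Ck_open_imp_continuous_on[OF T1(3)] T1(1) T(1)] T3(1) by blast
  have "Ck_open k T1 \<tau>" using T1(3) by (simp add: Ck_open_def)
  then have "Ck_open k ?T (\<lambda>z. g (\<tau> z))"
    by (intro Ck_open_compose[OF oT T(1) _ _ T(3)]) (auto elim: Ck_open_subset)
  moreover have "h' p \<in> ?T" using T1(2) T3(2) \<tau>[OF c(4,3) T1(2)] T(2) by simp
  moreover have "g (\<tau> (h' q)) = x q" if "q \<in> U'" "h' q \<in> ?T" for q
    using that T3(3)[of q] \<tau>[of q] T(4)[of q] by auto
  ultimately show ?thesis
    using oT unfolding ck_in_chart_def by (intro exI[of _ ?T] exI[of _ "\<lambda>z. g (\<tau> z)"]) simp
qed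

lemma ck_atI:
  assumes "(U, h) \<in> \<A>" "p \<in> U" "ck_in_chart k (U, h) x p"
  shows "ck_at k \<A> x p"
  unfolding ck_at_def
proof (intro ballI impI)
  fix c assume "c \<in> \<A>" "p \<in> fst c"
  then show "ck_in_chart k c x p"
    using ck_in_chart_transfer[of U h "fst c" "snd c" p k x] assms by simp
qed

lemma ck_at_chartI:
  assumes "(U, h) \<in> \<A>" "p \<in> U" "open T" "h p \<in> T" "Ck_open k T g"
    and "\<And>q. q \<in> U \<Longrightarrow> h q \<in> T \<Longrightarrow> x q = g (h q)"
  shows "ck_at k \<A> x p"
proof (rule ck_atI[OF assms(1,2)])
  show "ck_in_chart k (U, h) x p"
    unfolding ck_in_chart_def fst_conv snd_conv
    by (intro exI[of _ T] exI[of _ g]) (simp add: assms)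
qed

lemma ck_at_chartE:
  assumes "ck_at k \<A> x p" "(U, h) \<in> \<A>" "p \<in> U"
  obtains T g where "open T" "h p \<in> T" "Ck_open k T g" "\<And>q. q \<in> U \<Longrightarrow> h q \<in> T \<Longrightarrow> g (h q) = x q"
proof -
  have "ck_in_chart k (U, h) x p"
    using bspec[OF assms(1)[unfolded ck_at_def] assms(2)] assms(3) by simp
  then obtain T g where H: "open T" "h p \<in> T" "Ck_open k T g" "\<forall>q\<in>U. h q \<in> T \<longrightarrow> g (h q) = x q"
    unfolding ck_in_chart_def fst_conv snd_conv by (elim exE conjE)
  show thesis by (rule that[OF H(1-3)]) (use H(4) in blast)
qed

lemma ck_at_cong:
  assumes "openin X N" "p \<in> N" "\<And>q. q \<in> N \<Longrightarrow> x q = y q" "ck_at k \<A> x p"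
  shows "ck_at k \<A> y p"
proof -
  obtain U h where c: "(U, h) \<in> \<A>" "p \<in> U"
    using chart_cover openin_subset[OF assms(1)] assms(2) by blast
  obtain T g where T: "open T" "h p \<in> T" "Ck_open k T g" "\<And>q. q \<in> U \<Longrightarrow> h q \<in> T \<Longrightarrow> g (h q) = x q"
    using ck_at_chartE[OF assms(4) c] by blast
  obtain T' where T': "open T'" "h p \<in> T'" "\<And>q. q \<in> U \<Longrightarrow> h q \<in> T' \<Longrightarrow> q \<in> N"
    using chart_image_open[OF c(1) assms(1,2) c(2)] by blast
  show ?thesis
    by (rule ck_at_chartI[OF c, of "T \<inter> T'" k g])
      (use T T' assms(3) in \<open>auto intro: Ck_open_subset\<close>)
qed

abbreviation "Ck k \<equiv> carrier (Ck_semigroup k X \<A>)"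

lemma mem_Ck_iff: "x \<in> Ck k \<longleftrightarrow> x \<in> extensional (topspace X) \<and> (\<forall>p\<in>topspace X. ck_at k \<A> x p)"
proof -
  have "Ck_on k (h ` U) (x \<circ> inv_into U h) \<longleftrightarrow> (\<forall>p\<in>U. ck_in_chart k (U, h) x p)"
    if "(U, h) \<in> \<A>" for U h
  proof -
    have "(\<forall>z\<in>h ` U \<inter> T. g z = (x \<circ> inv_into U h) z) \<longleftrightarrow> (\<forall>q\<in>U. h q \<in> T \<longrightarrow> g (h q) = x q)" for T g
      using chart_inv[OF that] by auto
    then show ?thesis
      unfolding Ck_on_iff ck_in_chart_def fst_conv snd_conv by (simp only: ball_simps(9))
  qed
  then have "(\<forall>(U, h)\<in>\<A>. Ck_on k (h ` U) (x \<circ> inv_into U h)) \<longleftrightarrow>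
      (\<forall>c\<in>\<A>. \<forall>p\<in>fst c. ck_in_chart k c x p)" by (auto simp: case_prod_beta)
  also have "\<dots> \<longleftrightarrow> (\<forall>p\<in>topspace X. ck_at k \<A> x p)"
    unfolding ck_at_def using chart_subset[of "fst c" "snd c" for c] by (metis prod.collapse)
  finally show ?thesis by (simp add: Ck_semigroup_def)
qed

lemma restrict_mem_Ck: "(\<And>p. p \<in> topspace X \<Longrightarrow> ck_at k \<A> x p) \<Longrightarrow> restrict x (topspace X) \<in> Ck k"
  unfolding mem_Ck_iff by (auto intro: ck_at_cong[OF openin_topspace])

lemma ck_at_continuous_map:
  assumes "\<And>p. p \<in> topspace X \<Longrightarrow> ck_at k \<A> x p"
  shows "continuous_map X euclideanreal x"
  unfolding continuous_map_def
proof (intro conjI allI impI)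
  fix S :: "real set" assume "openin euclideanreal S"
  then have S: "open S" by simp
  show "openin X {q \<in> topspace X. x q \<in> S}"
  proof (subst openin_subopen, intro ballI)
    fix p assume p: "p \<in> {q \<in> topspace X. x q \<in> S}"
    obtain U h where c: "(U, h) \<in> \<A>" "p \<in> U" using chart_cover p by blast
    obtain T g where T: "open T" "h p \<in> T" "Ck_open k T g" "\<And>q. q \<in> U \<Longrightarrow> h q \<in> T \<Longrightarrow> g (h q) = x q"
      using ck_at_chartE[OF assms c] p by auto
    have "open (T \<inter> g -` S)"
      using continuous_open_preimage[OF Ck_open_imp_continuous_on[OF T(3)] T(1) S] .
    from chart_preimage_open[OF c(1) this]
    show "\<exists>N. openin X N \<and> p \<in> N \<and> N \<subseteq> {q \<in> topspace X. x q \<in> S}"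
      using T(2,4) c p chart_subset[OF c(1)]
      by (intro exI[of _ "{q \<in> U. h q \<in> T \<inter> g -` S}"]) auto
  qed
qed auto

lemma continuous_map_Ck: "x \<in> Ck k \<Longrightarrow> continuous_map X euclideanreal x"
  using ck_at_continuous_map mem_Ck_iff by blast

text \<open>Closedness holds in \<open>X\<close>, not merely in \<open>U\<close>, and this is what
  makes extension by zero possible. The chart image is open in a closed half-space, so a small
  closed ball meets it in a compact set; its preimage is compact, hence closed by the Hausdorff
  property.\<close>

lemma chart_closed_ball:
  assumes "(U, h) \<in> \<A>" "p \<in> U"
  obtains r where "r > 0" "\<And>s. s \<le> r \<Longrightarrow> closedin X {q \<in> U. h q \<in> cball (h p) s}"
proof -
  obtain S u where S: "subspace S" "openin (top_of_set {x \<in> S. 0 \<le> u \<bullet> x}) (h ` U)"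
    using chart_image[OF assms(1)] by blast
  let ?C = "{x \<in> S. 0 \<le> u \<bullet> x}"
  have C: "closed ?C"
  proof -
    have "closed {x. 0 \<le> u \<bullet> x}" by (intro closed_Collect_le continuous_intros)
    then have "closed (S \<inter> {x. 0 \<le> u \<bullet> x})" using closed_subspace[OF S(1)] by blast
    moreover have "S \<inter> {x. 0 \<le> u \<bullet> x} = ?C" by blast
    ultimately show ?thesis by simp
  qed
  from S(2) obtain T where T: "open T" "h ` U = ?C \<inter> T" unfolding openin_open by auto
  then have "h p \<in> T" using assms(2) by blast
  then obtain r where r: "r > 0" "cball (h p) r \<subseteq> T" using T(1) open_contains_cball by blast
  obtain i where i: "homeomorphic_maps (subtopology X U) (top_of_set (h ` U)) h i"
    using chart_homeo[OF assms(1)] homeomorphic_map_maps by blast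
  have "closedin X {q \<in> U. h q \<in> cball (h p) s}" if "s \<le> r" for s
  proof -
    let ?K = "cball (h p) s \<inter> ?C"
    have sub: "?K \<subseteq> h ` U" using r(2) T(2) that by (auto simp: subset_iff)
    have "compact ?K" using C by (simp add: compact_Int_closed)
    then have "compactin (top_of_set (h ` U)) ?K"
      using sub by (simp add: compactin_subtopology)
    then have "compactin (subtopology X U) (i ` ?K)"
      using i image_compactin unfolding homeomorphic_maps_def by blast
    then have "compactin X (i ` ?K)" by (simp add: compactin_subtopology)
    then have "closedin X (i ` ?K)" using compactin_imp_closedin Hausdorff by blast
    moreover have "i ` ?K = {q \<in> U. h q \<in> cball (h p) s}"
    proof -
      have top: "topspace (subtopology X U) = U"
        using openin_subset[OF chart_open[OF assms(1)]] by auto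
      have "i (h q) = q" if "q \<in> U" for q
        using i that unfolding homeomorphic_maps_def top by blast
      note ih = this
      show ?thesis
      proof (intro equalityI subsetI)
        fix q assume "q \<in> i ` ?K"
        then obtain z where z: "z \<in> ?K" "q = i z" by blast
        then obtain q' where "q' \<in> U" "z = h q'" using sub by blast
        then show "q \<in> {q \<in> U. h q \<in> cball (h p) s}" using ih z by simp
      next
        fix q assume q: "q \<in> {q \<in> U. h q \<in> cball (h p) s}"
        then have "h q \<in> ?C" using T(2) by blast
        then have "h q \<in> ?K" using q by blast
        then show "q \<in> i ` ?K" using ih[of q] q by force
      qed
    qed
    ultimately show ?thesis by simp
  qed
  then show ?thesis using that r(1) by blast
qed

definition extend_chart :: "'p set \<Rightarrow> ('p \<Rightarrow> 'a) \<Rightarrow> ('a \<Rightarrow> real) \<Rightarrow> 'p \<Rightarrow> real" where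
  "extend_chart U h G = restrict (\<lambda>q. if q \<in> U then G (h q) else 0) (topspace X)"

lemma extend_chart_mem_Ck:
  assumes c: "(U, h) \<in> \<A>" and K: "closedin X {q \<in> U. h q \<in> cball z r}"
    and G: "Ck_open k UNIV G" "\<And>y. G y \<noteq> 0 \<Longrightarrow> y \<in> cball z r"
  shows "extend_chart U h G \<in> Ck k"
  unfolding extend_chart_def
proof (rule restrict_mem_Ck)
  let ?x = "\<lambda>q. if q \<in> U then G (h q) else 0"
  fix p assume p: "p \<in> topspace X"
  show "ck_at k \<A> ?x p"
  proof (cases "p \<in> U")
    case True
    show ?thesis
      by (rule ck_at_chartI[OF c True open_UNIV _ G(1)]) auto
  next
    case False
    let ?N = "topspace X - {q \<in> U. h q \<in> cball z r}"
    have "openin X ?N" using K by blast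
    then show ?thesis
      by (rule ck_at_cong[where x = "\<lambda>_. 0"]) (use p False G(2) in \<open>auto simp: ck_at_const\<close>)
  qed
qed

lemma CkD: "x \<in> Ck k \<Longrightarrow> p \<in> topspace X \<Longrightarrow> ck_at k \<A> x p"
  by (simp add: mem_Ck_iff)

lemma const_mem_Ck: "restrict (\<lambda>_. c) (topspace X) \<in> Ck k"
  by (rule restrict_mem_Ck) (rule ck_at_const)

lemma mult_mem_Ck: "x \<in> Ck k \<Longrightarrow> y \<in> Ck k \<Longrightarrow> restrict (\<lambda>q. x q * y q) (topspace X) \<in> Ck k"
  by (rule restrict_mem_Ck) (intro ck_at_mult CkD)

lemma add_const_mem_Ck: "x \<in> Ck k \<Longrightarrow> restrict (\<lambda>q. x q + c) (topspace X) \<in> Ck k"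
  by (rule restrict_mem_Ck) (intro ck_at_add_const CkD)

text \<open>A zero of \<open>x\<close> lies outside \<open>K\<close>, so \<open>y\<close> vanishes
  on a whole neighbourhood of it and the quotient is locally 0.\<close>

lemma divide_mem_Ck:
  assumes "x \<in> Ck k" "y \<in> Ck k" "closedin X K" "\<And>q. q \<in> topspace X - K \<Longrightarrow> y q = 0"
    "\<And>q. q \<in> K \<Longrightarrow> x q \<noteq> 0"
  shows "restrict (\<lambda>q. y q * inverse (x q)) (topspace X) \<in> Ck k"
proof (rule restrict_mem_Ck)
  fix p assume p: "p \<in> topspace X"
  show "ck_at k \<A> (\<lambda>q. y q * inverse (x q)) p"
  proof (cases "x p = 0")
    case False
    then show ?thesis by (intro ck_at_mult ck_at_inverse CkD assms(1,2) p)
  next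
    case True
    have "openin X (topspace X - K)" using assms(3) by blast
    then show ?thesis
      by (rule ck_at_cong[where x = "\<lambda>_. 0"]) (use p True assms(4,5) in \<open>auto simp: ck_at_const\<close>)
  qed
qed

lemma bump:
  assumes "openin X N" "p \<in> N"
  obtains y N' K where "y \<in> Ck k" "openin X N'" "p \<in> N'" "\<And>q. q \<in> N' \<Longrightarrow> y q = 1"
    "closedin X K" "K \<subseteq> N" "\<And>q. q \<in> topspace X - K \<Longrightarrow> y q = 0"
proof -
  obtain U h where c: "(U, h) \<in> \<A>" "p \<in> U"
    using chart_cover openin_subset[OF assms(1)] assms(2) by blast
  obtain T where T: "open T" "h p \<in> T" "\<And>q. q \<in> U \<Longrightarrow> h q \<in> T \<Longrightarrow> q \<in> N"
    using chart_image_open[OF c(1) assms c(2)] by blast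
  obtain r0 where r0: "r0 > 0" "cball (h p) r0 \<subseteq> T" using T(1,2) open_contains_cball by blast
  obtain r1 where r1: "r1 > 0" "\<And>s. s \<le> r1 \<Longrightarrow> closedin X {q \<in> U. h q \<in> cball (h p) s}"
    using chart_closed_ball[OF c] by blast
  define r where "r = min r0 r1"
  have r: "r > 0" "cball (h p) r \<subseteq> T" "closedin X {q \<in> U. h q \<in> cball (h p) r}"
    using r0 r1(1) r1(2)[of r] unfolding r_def by auto
  obtain \<beta> :: "'a \<Rightarrow> real" where \<beta>: "\<And>n. Cn_on_open n UNIV \<beta>" "\<And>z. z \<in> ball (h p) (r / 2) \<Longrightarrow> \<beta> z = 1"
    "\<And>z. \<beta> z \<noteq> 0 \<Longrightarrow> z \<in> ball (h p) r"
    using smooth_bump[OF r(1), of "h p"] by blast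
  show thesis
  proof (rule that)
    show "extend_chart U h \<beta> \<in> Ck k"
      using \<beta>(3) by (intro extend_chart_mem_Ck[OF c(1) r(3)])
        (auto simp: Ck_open_def \<beta>(1) intro: less_imp_le)
    show "openin X {q \<in> U. h q \<in> ball (h p) (r / 2)}"
      by (intro chart_preimage_open[OF c(1)] open_ball)
    show "p \<in> {q \<in> U. h q \<in> ball (h p) (r / 2)}" using c(2) r(1) by simp
    show "extend_chart U h \<beta> q = 1" if "q \<in> {q \<in> U. h q \<in> ball (h p) (r / 2)}" for q
      using that \<beta>(2)[of "h q"] chart_subset[OF c(1)] by (simp add: extend_chart_def)
    show "{q \<in> U. h q \<in> cball (h p) r} \<subseteq> N" using T(3) r(2) by blast
    show "extend_chart U h \<beta> q = 0" if "q \<in> topspace X - {q \<in> U. h q \<in> cball (h p) r}" for q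
      using that \<beta>(3)[of "h q"] by (cases "\<beta> (h q) = 0") (auto simp: extend_chart_def)
  qed (rule r(3))
qed

text \<open>The isomorphism acts on global functions only; this supplies one with a prescribed germ,
  such as a local square root, reciprocal or coordinate function.\<close>

lemma local_extension:
  assumes "openin X N" "p \<in> N" "\<And>q. q \<in> N \<Longrightarrow> ck_at k \<A> x q"
  obtains y N' where "y \<in> Ck k" "openin X N'" "p \<in> N'" "N' \<subseteq> N" "\<And>q. q \<in> N' \<Longrightarrow> y q = x q"
proof -
  obtain b N' K where b: "b \<in> Ck k" "openin X N'" "p \<in> N'" "\<And>q. q \<in> N' \<Longrightarrow> b q = 1"
    "closedin X K" "K \<subseteq> N" "\<And>q. q \<in> topspace X - K \<Longrightarrow> b q = 0"
    using bump[OF assms(1,2)] by metis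
  show thesis
  proof (rule that)
    show "restrict (\<lambda>q. b q * x q) (topspace X) \<in> Ck k"
    proof (rule restrict_mem_Ck)
      fix q assume q: "q \<in> topspace X"
      show "ck_at k \<A> (\<lambda>q. b q * x q) q"
      proof (cases "q \<in> K")
        case True
        then show ?thesis using b(6) by (intro ck_at_mult CkD[OF b(1) q] assms(3)) auto
      next
        case False
        have "openin X (topspace X - K)" using b(5) by blast
        then show ?thesis
          by (rule ck_at_cong[where x = "\<lambda>_. 0"]) (use q False b(7) in \<open>auto simp: ck_at_const\<close>)
      qed
    qed
    show "openin X (N' \<inter> N)" using b(2) assms(1) by blast
    show "restrict (\<lambda>q. b q * x q) (topspace X) q = x q" if "q \<in> N' \<inter> N" for q
      using that b(4)[of q] openin_subset[OF assms(1)] by auto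
  qed (use b(3) assms(2) in auto)
qed

lemma peak:
  assumes "p \<in> topspace X"
  obtains z where "z \<in> Ck k" "\<And>q. q \<in> topspace X \<Longrightarrow> z q = 0 \<longleftrightarrow> q = p"
proof -
  obtain U h where c: "(U, h) \<in> \<A>" "p \<in> U" using chart_cover assms by blast
  obtain r where r: "r > 0" "\<And>s. s \<le> r \<Longrightarrow> closedin X {q \<in> U. h q \<in> cball (h p) s}"
    using chart_closed_ball[OF c] by blast
  obtain \<beta> :: "'a \<Rightarrow> real" where \<beta>: "\<And>n. Cn_on_open n UNIV \<beta>" "\<And>z. 0 \<le> \<beta> z" "\<And>z. \<beta> z \<le> 1"
    "\<And>z. z \<in> ball (h p) (r / 2) \<Longrightarrow> \<beta> z = 1" "\<And>z. \<beta> z \<noteq> 0 \<Longrightarrow> z \<in> ball (h p) r"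
    using smooth_bump[OF r(1), of "h p"] by blast
  \<comment> \<open>The factor 1 - |z - h p|^2 is below 1 except at the centre and
    \<open>\<beta>\<close> lies between 0 and 1, so \<open>G\<close> takes the value 1 only at
    \<open>h p\<close>. Then 1 - \<open>G\<close>, extended by 1 outside the chart, has a single
    zero.\<close>
  define G where "G = (\<lambda>z. \<beta> z * (1 + - 1 * (\<Sum>b\<in>Basis. ((z - h p) \<bullet> b) * ((z - h p) \<bullet> b))))"
  have coord: "Cn_on_open n UNIV (\<lambda>z. (z - h p) \<bullet> b)" for n b
    unfolding inner_diff_left diff_conv_add_uminus
    by (intro Cn_on_open_add Cn_on_open_bounded_linear_compose[OF _ bounded_linear_inner_left]
        Cn_on_open_id Cn_on_open_const open_UNIV)
  have "Cn_on_open n UNIV G" for n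
    unfolding G_def
    by (intro Cn_on_open_add Cn_on_open_mult Cn_on_open_const Cn_on_open_sum coord \<beta>(1) open_UNIV)
  then have x: "extend_chart U h G \<in> Ck k"
    using \<beta>(5) by (intro extend_chart_mem_Ck[OF c(1) r(2)[OF order_refl]])
      (auto simp: Ck_open_def G_def intro: less_imp_le)
  have G: "G z = \<beta> z * (1 - (norm (z - h p))\<^sup>2)" for z
    unfolding G_def euclidean_inner[symmetric] by (simp add: power2_norm_eq_inner)
  have G1: "G z = 1 \<longleftrightarrow> z = h p" for z
  proof
    assume "G z = 1"
    moreover have "G z \<le> 1 - (norm (z - h p))\<^sup>2" if "1 - (norm (z - h p))\<^sup>2 \<ge> 0"
      unfolding G using \<beta>(3)[of z] that by (simp add: mult_left_le_one_le \<beta>(2))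
    moreover have "G z \<le> 0" if "1 - (norm (z - h p))\<^sup>2 \<le> 0"
      unfolding G using \<beta>(2)[of z] that by (simp add: mult_nonneg_nonpos)
    ultimately have "(norm (z - h p))\<^sup>2 \<le> 0" by linarith
    then show "z = h p" by simp
  qed (use \<beta>(4)[of "h p"] r(1) in \<open>simp add: G\<close>)
  define z where "z = restrict (\<lambda>q. 1 + - 1 * extend_chart U h G q) (topspace X)"
  show thesis
  proof (rule that)
    have "ck_at k \<A> (\<lambda>q. - 1 * extend_chart U h G q + 1) q" if "q \<in> topspace X" for q
      by (intro ck_at_add_const ck_at_mult ck_at_const CkD[OF x that])
    then show "z \<in> Ck k" unfolding z_def by (intro restrict_mem_Ck) (simp add: add.commute)
    show "z q = 0 \<longleftrightarrow> q = p" if "q \<in> topspace X" for q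
    proof (cases "q \<in> U")
      case True
      have "h q = h p \<longleftrightarrow> q = p" using chart_inv[OF c(1)] True c(2) by metis
      then show ?thesis using True that G1[of "h q"] by (auto simp: z_def extend_chart_def)
    qed (use c(2) that in \<open>auto simp: z_def extend_chart_def\<close>)
  qed
qed

text \<open>Of \<open>d\<close> and \<open>- d\<close> one points into the half-space, so a
  one-sided segment exists even at a boundary point. A nonzero \<open>d\<close> comes from
  \<open>S \<noteq> {0}\<close>, that is, from positive dimension.\<close>

lemma chart_direction:
  assumes "(U, h) \<in> \<A>" "p \<in> U"
  obtains v e where "v \<noteq> 0" "e > 0" "\<And>t. 0 \<le> t \<Longrightarrow> t < e \<Longrightarrow> h p + t *\<^sub>R v \<in> h ` U"
proof -
  obtain S u where S: "subspace S" "S \<noteq> {0}" "openin (top_of_set {x \<in> S. 0 \<le> u \<bullet> x}) (h ` U)"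
    using chart_image[OF assms(1)] by blast
  from S(3) obtain T where T: "open T" "h ` U = {x \<in> S. 0 \<le> u \<bullet> x} \<inter> T" unfolding openin_open by auto
  have hp: "h p \<in> S" "0 \<le> u \<bullet> h p" "h p \<in> T" using T(2) assms(2) by blast+
  obtain \<epsilon> where \<epsilon>: "\<epsilon> > 0" "ball (h p) \<epsilon> \<subseteq> T" using hp(3) T(1) open_contains_ball by blast
  obtain d where d: "d \<in> S" "d \<noteq> 0" using S(1,2) subspace_0 by blast
  define v where "v = (if 0 \<le> u \<bullet> d then d else - d)"
  have v: "v \<in> S" "v \<noteq> 0" "0 \<le> u \<bullet> v"
    using d subspace_neg[OF S(1)] by (auto simp: v_def)
  show thesis
  proof (rule that[OF v(2)])
    show "0 < \<epsilon> / norm v" using \<epsilon>(1) v(2) by simp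
    fix t assume t: "0 \<le> t" "t < \<epsilon> / norm v"
    then have "h p + t *\<^sub>R v \<in> ball (h p) \<epsilon>" using v(2) by (simp add: dist_norm field_simps)
    moreover have "h p + t *\<^sub>R v \<in> S" using subspace_add subspace_scale S(1) hp(1) v(1) by metis
    moreover have "0 \<le> u \<bullet> (h p + t *\<^sub>R v)" using hp(2) v(3) t(1) by (simp add: inner_add_right)
    ultimately show "h p + t *\<^sub>R v \<in> h ` U" using \<epsilon>(2) T(2) by blast
  qed
qed

lemma not_isolated:
  assumes "openin X N" "p \<in> N"
  shows "\<exists>q\<in>N. q \<noteq> p"
proof -
  obtain U h where c: "(U, h) \<in> \<A>" "p \<in> U"
    using chart_cover openin_subset[OF assms(1)] assms(2) by blast
  obtain T where T: "open T" "h p \<in> T" "\<And>q. q \<in> U \<Longrightarrow> h q \<in> T \<Longrightarrow> q \<in> N"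
    using chart_image_open[OF c(1) assms c(2)] by blast
  obtain \<epsilon> where \<epsilon>: "\<epsilon> > 0" "cball (h p) \<epsilon> \<subseteq> T" using T(1,2) open_contains_cball by blast
  obtain v e where v: "v \<noteq> 0" "e > 0" "\<And>t. 0 \<le> t \<Longrightarrow> t < e \<Longrightarrow> h p + t *\<^sub>R v \<in> h ` U"
    using chart_direction[OF c] by blast
  define t where "t = min (e / 2) (\<epsilon> / norm v)"
  have t: "0 < t" "t < e" "t \<le> \<epsilon> / norm v" using v(1,2) \<epsilon>(1) by (auto simp: t_def)
  then have "h p + t *\<^sub>R v \<in> h ` U" using v(3)[of t] by simp
  then obtain q where q: "q \<in> U" "h q = h p + t *\<^sub>R v" by auto
  moreover have "h p + t *\<^sub>R v \<in> cball (h p) \<epsilon>"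
    using t v(1) by (simp add: dist_norm field_simps)
  ultimately have "q \<in> N" using T(3) \<epsilon>(2) by auto
  moreover have "q \<noteq> p" using q(2) t(1) v(1) by auto
  ultimately show ?thesis by blast
qed

text \<open>One hump of the gliding hump argument: a high power of a cut-off of \<open>u\<close>,
  small in all derivatives up to order \<open>j\<close> and still an exact power of \<open>u\<close>
  near \<open>q\<close>.\<close>

lemma glue_powers_at:
  assumes c: "(U, h) \<in> \<A>" "q \<in> U" and u: "u \<in> Ck k" "\<bar>u q\<bar> < 1" and "d > 0" "e > 0"
  shows "\<exists>F s N'. N' \<ge> n \<and> 0 < s \<and> (\<forall>m. enat m \<le> k \<longrightarrow> Cn_on_open m UNIV F) \<and>
    (\<forall>z. F z \<noteq> 0 \<longrightarrow> dist (h q) z \<le> d) \<and>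
    (\<forall>m\<le>j. enat m \<le> k \<longrightarrow> deriv_le m e F) \<and> s \<le> d \<and>
    (\<forall>q'\<in>U. h q' \<in> ball (h q) s \<longrightarrow> F (h q') = u q' ^ N')"
proof -
  obtain T g where T: "open T" "h q \<in> T" "Ck_open k T g" "\<And>q. q \<in> U \<Longrightarrow> h q \<in> T \<Longrightarrow> g (h q) = u q"
    using ck_at_chartE[OF CkD[OF u(1)] c] chart_subset[OF c] by metis
  define \<rho> where "\<rho> = (\<bar>u q\<bar> + 1) / 2"
  have \<rho>: "\<bar>u q\<bar> < \<rho>" "\<rho> < 1" "\<rho> \<ge> 0" using u(2) by (auto simp: \<rho>_def)
  have "open (T \<inter> g -` {- \<rho> <..< \<rho>})"
    by (rule continuous_open_preimage[OF Ck_open_imp_continuous_on[OF T(3)] T(1) open_greaterThanLessThan])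
  moreover have "h q \<in> T \<inter> g -` {- \<rho> <..< \<rho>}" using T(2) T(4)[OF c(2)] \<rho>(1) by auto
  ultimately obtain r0 where r0: "r0 > 0" "cball (h q) r0 \<subseteq> T \<inter> g -` {- \<rho> <..< \<rho>}"
    using open_contains_cball by blast
  define r where "r = min r0 d"
  have r: "r > 0" "r \<le> d" "cball (h q) r \<subseteq> T" "\<And>z. z \<in> cball (h q) r \<Longrightarrow> \<bar>g z\<bar> \<le> \<rho>"
    using r0 \<open>d > 0\<close> by (auto simp: r_def subset_iff abs_le_iff less_imp_le)
  obtain \<beta> :: "'a \<Rightarrow> real" where \<beta>: "\<And>n. Cn_on_open n UNIV \<beta>" "\<And>z. 0 \<le> \<beta> z" "\<And>z. \<beta> z \<le> 1"
    "\<And>z. z \<in> ball (h q) (r / 2) \<Longrightarrow> \<beta> z = 1" "\<And>z. \<beta> z \<noteq> 0 \<Longrightarrow> z \<in> ball (h q) r"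
    using smooth_bump[OF r(1), of "h q"] by blast
  define V where "V = (\<lambda>z. \<beta> z * g z)"
  have \<beta>0: "\<beta> z = 0" if "z \<notin> cball (h q) r" for z using \<beta>(5)[of z] that by force
  have V: "Cn_on_open m UNIV V" if "enat m \<le> k" for m
    unfolding V_def
    by (rule Cn_on_open_cutoff[OF T(1) closed_cball r(3) \<beta>(1)]) (use T(3) that \<beta>0 in \<open>auto simp: Ck_open_def\<close>)
  have V0: "V z = 0" if "z \<notin> cball (h q) r" for z using \<beta>0[OF that] by (simp add: V_def)
  have V\<rho>: "\<bar>V z\<bar> \<le> \<rho>" for z
  proof (cases "z \<in> cball (h q) r")
    case True
    have "\<bar>V z\<bar> \<le> 1 * \<rho>"
      unfolding V_def abs_mult using \<beta>(2,3)[of z] r(4)[OF True] \<rho>(3) by (intro mult_mono) auto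
    then show ?thesis by simp
  qed (use V0 \<rho>(3) in auto)
  \<comment> \<open>For fixed \<open>j\<close> finitely many orders occur, even when
    \<open>k = \<infinity>\<close>, so one exponent serves them all.\<close>
  have ev: "\<forall>\<^sub>F N in sequentially. \<forall>m\<in>{m. m \<le> j \<and> enat m \<le> k}. deriv_le m e (\<lambda>z. V z ^ N)"
    by (intro eventually_ball_finite ballI eventually_deriv_le_power[OF \<rho>(2) V\<rho> compact_cball V V0 \<open>e > 0\<close>]) auto
  \<comment> \<open>The exponent is at least 1 so that the power still vanishes where
    \<open>V\<close> does.\<close>
  from eventually_happens'[OF sequentially_bot eventually_conj[OF ev eventually_ge_at_top[of "max 1 n"]]]
  obtain N' where N': "N' \<ge> max 1 n"
    "\<And>m. m \<le> j \<Longrightarrow> enat m \<le> k \<Longrightarrow> deriv_le m e (\<lambda>z. V z ^ N')"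
    by auto
  show ?thesis
  proof (intro exI conjI allI impI ballI)
    show "Cn_on_open m UNIV (\<lambda>z. V z ^ N')" if "enat m \<le> k" for m
      by (intro Cn_on_open_power open_UNIV V that)
    show "dist (h q) z \<le> d" if "V z ^ N' \<noteq> 0" for z
    proof -
      have "V z \<noteq> 0" using that N'(1) by (auto simp: power_0_left)
      then show ?thesis using V0[of z] r(2) by force
    qed
    show "V (h q') ^ N' = u q' ^ N'" if "q' \<in> U" "h q' \<in> ball (h q) (r / 2)" for q'
    proof -
      have "h q' \<in> T" using that(2) r(1,3) by (auto simp: subset_iff)
      then show ?thesis using \<beta>(4)[OF that(2)] T(4)[OF that(1)] by (simp add: V_def)
    qed
  qed (use N' r in auto)
qed

text \<open>The threshold \<open>n\<close> depends on the point and on the stage, because the excess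
  above 1 varies from point to point and the \<open>j\<close>-th power has to beat
  \<open>j\<close>.\<close>

lemma glue_powers:
  fixes u :: "'p \<Rightarrow> 'p \<Rightarrow> real" and n :: "'p \<Rightarrow> nat \<Rightarrow> nat"
  assumes p: "p \<in> topspace X"
    and P: "\<And>N. openin X N \<Longrightarrow> p \<in> N \<Longrightarrow> \<exists>q\<in>P \<inter> N. q \<noteq> p"
    and u: "\<And>q. q \<in> P \<Longrightarrow> u q \<in> Ck k \<and> \<bar>u q q\<bar> < 1"
  obtains y qs where "y \<in> Ck k" "limitin X qs p sequentially"
    "\<And>j. qs j \<in> P \<and> (\<exists>m\<ge>n (qs j) j. \<exists>N. openin X N \<and> qs j \<in> N \<and> (\<forall>q\<in>N. y q = u (qs j) q ^ m))"
proof -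
  obtain U h where c: "(U, h) \<in> \<A>" "p \<in> U" using chart_cover p by blast
  obtain r where r: "r > 0" "\<And>s. s \<le> r \<Longrightarrow> closedin X {q \<in> U. h q \<in> cball (h p) s}"
    using chart_closed_ball[OF c] by blast
  have near: "\<exists>q. q \<in> P \<inter> U \<and> q \<noteq> p \<and> dist (h p) (h q) \<le> e" if "e > 0" for e
    using P[OF chart_preimage_open[OF c(1) open_ball[of "h p" e]]] c(2) that
    by (auto intro: less_imp_le)
  \<comment> \<open>The bound 4/5 * r keeps the outer radius 5/4 * d j of every annulus within
    \<open>r\<close>, where the closed ball of the chart is closed in \<open>X\<close>. A hump of
    radius d j / 4 about \<open>qs j\<close> lies in its annulus.\<close>
  have "\<exists>qs. \<forall>j. (qs j \<in> P \<inter> U \<and> qs j \<noteq> p \<and> dist (h p) (h (qs j)) \<le> 4 / 5 * r) \<and>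
      dist (h p) (h (qs (Suc j))) \<le> dist (h p) (h (qs j)) / 2"
  proof (rule dependent_nat_choice)
    show "\<exists>q. q \<in> P \<inter> U \<and> q \<noteq> p \<and> dist (h p) (h q) \<le> 4 / 5 * r"
      by (rule near) (use r(1) in simp)
    fix q and j :: nat assume q: "q \<in> P \<inter> U \<and> q \<noteq> p \<and> dist (h p) (h q) \<le> 4 / 5 * r"
    then have "h q \<noteq> h p" using chart_inv[OF c(1)] c(2) by (metis IntD2)
    then have "0 < dist (h p) (h q)" by simp
    then have "dist (h p) (h q) / 2 > 0" by simp
    from near[OF this] obtain q' where "q' \<in> P \<inter> U \<and> q' \<noteq> p \<and> dist (h p) (h q') \<le> dist (h p) (h q) / 2"
      by blast
    moreover from this q have "dist (h p) (h q') \<le> 4 / 5 * r"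
      using zero_le_dist[of "h p" "h q"] by linarith
    ultimately show "\<exists>q'. (q' \<in> P \<inter> U \<and> q' \<noteq> p \<and> dist (h p) (h q') \<le> 4 / 5 * r) \<and>
        dist (h p) (h q') \<le> dist (h p) (h q) / 2" by blast
  qed
  then obtain qs where qs: "\<And>j. qs j \<in> P" "\<And>j. qs j \<in> U" "\<And>j. qs j \<noteq> p"
    "\<And>j. dist (h p) (h (qs j)) \<le> 4 / 5 * r"
    "\<And>j. dist (h p) (h (qs (Suc j))) \<le> dist (h p) (h (qs j)) / 2" by blast
  define d where "d = (\<lambda>j. dist (h p) (h (qs j)))"
  have d: "\<And>j. 0 < d j" "\<And>j. d (Suc j) \<le> d j / 2"
  proof -
    show "0 < d j" for j
      using chart_inv[OF c] chart_inv[OF c(1) qs(2)[of j]] qs(3)[of j] by (auto simp: d_def)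
    show "d (Suc j) \<le> d j / 2" for j unfolding d_def by (rule qs(5))
  qed
  define Q where "Q = (\<lambda>j F s N'. N' \<ge> n (qs j) j \<and> 0 < s \<and> (\<forall>m. enat m \<le> k \<longrightarrow> Cn_on_open m UNIV F) \<and>
    (\<forall>z. F z \<noteq> 0 \<longrightarrow> dist (h (qs j)) z \<le> d j / 4) \<and>
    (\<forall>m\<le>j. enat m \<le> k \<longrightarrow> deriv_le m ((d j)\<^sup>2) F) \<and> s \<le> d j / 4 \<and>
    (\<forall>q'\<in>U. h q' \<in> ball (h (qs j)) s \<longrightarrow> F (h q') = u (qs j) q' ^ N'))"
  have "\<exists>F s N'. Q j F s N'" for j
    unfolding Q_def
    by (rule glue_powers_at[OF c(1) qs(2)]) (use u[OF qs(1)] d(1)[of j] in auto)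
  then obtain F s N' where "\<And>j. Q j (F j) (s j) (N' j)" by metis
  then have F: "\<And>j. N' j \<ge> n (qs j) j" "\<And>j. 0 < s j"
    "\<And>j m. enat m \<le> k \<Longrightarrow> Cn_on_open m UNIV (F j)"
    "\<And>j z. F j z \<noteq> 0 \<Longrightarrow> dist (h (qs j)) z \<le> d j / 4"
    "\<And>j m. m \<le> j \<Longrightarrow> enat m \<le> k \<Longrightarrow> deriv_le m ((d j)\<^sup>2) (F j)" "\<And>j. s j \<le> d j / 4"
    "\<And>j q'. q' \<in> U \<Longrightarrow> h q' \<in> ball (h (qs j)) (s j) \<Longrightarrow> F j (h q') = u (qs j) q' ^ N' j"
    unfolding Q_def by blast+
  have annulus: "3 / 4 * d j \<le> dist (h p) z \<and> dist (h p) z \<le> 5 / 4 * d j"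
    if "dist (h (qs j)) z \<le> d j / 4" for j z
    using that dist_triangle[of "h p" z "h (qs j)"] dist_triangle2[of "h p" "h (qs j)" z]
    unfolding d_def by (auto simp: dist_commute)
  let ?G = "\<lambda>z. \<Sum>j. F j z"
  have G: "Ck_open k UNIV ?G"
    unfolding Ck_open_def
  proof (intro allI impI)
    fix m assume m: "enat m \<le> k"
    show "Cn_on_open m UNIV ?G"
      by (rule Cn_on_open_glue[where d = d and a = "h p" and ?j0.0 = m, OF d F(3)[OF m]])
        (use F(4,5) annulus m in blast)+
  qed
  have G0: "z \<in> cball (h p) r" if "?G z \<noteq> 0" for z
  proof -
    have "\<exists>j. F j z \<noteq> 0"
    proof (rule ccontr)
      assume "\<not> (\<exists>j. F j z \<noteq> 0)"
      then have "?G z = 0" by simp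
      with that show False by contradiction
    qed
    then obtain j where "F j z \<noteq> 0" ..
    then have "dist (h p) z \<le> 5 / 4 * d j" using F(4) annulus by blast
    also have "\<dots> \<le> r" using qs(4)[of j] by (simp add: d_def)
    finally show ?thesis by simp
  qed
  show thesis
  proof (rule that)
    show "extend_chart U h ?G \<in> Ck k"
      by (rule extend_chart_mem_Ck[OF c(1) r(2)[OF order_refl] G G0])
    show "limitin X qs p sequentially"
      unfolding limitin_def
    proof (intro conjI p allI impI)
      fix N assume "openin X N \<and> p \<in> N"
      then obtain T where T: "open T" "h p \<in> T" "\<And>q. q \<in> U \<Longrightarrow> h q \<in> T \<Longrightarrow> q \<in> N"
        using chart_image_open[OF c(1) _ _ c(2)] by blast
      obtain e where e: "e > 0" "ball (h p) e \<subseteq> T" using T(1,2) open_contains_ball by blast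
      have "\<forall>\<^sub>F j in sequentially. d j < e"
        by (rule order_tendstoD(2)[OF halving_tendsto_0[of d, OF d] e(1)])
      then show "\<forall>\<^sub>F j in sequentially. qs j \<in> N"
        by eventually_elim (use T(3) e(2) qs(2) in \<open>auto simp: d_def subset_iff\<close>)
    qed
    fix j
    let ?N = "{q \<in> U. h q \<in> ball (h (qs j)) (s j)}"
    have "extend_chart U h ?G q = u (qs j) q ^ N' j" if q: "q \<in> ?N" for q
    proof -
      have "dist (h (qs j)) (h q) \<le> d j / 4" using q F(6)[of j] by simp
      note an = annulus[OF this]
      have "?G (h q) = F j (h q)"
        by (rule suminf_annuli[of d F "h p", OF d]) (use F(4) annulus an in blast)+
      then show ?thesis
        using q F(7)[of q j] chart_subset[OF c(1)] by (simp add: extend_chart_def)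
    qed
    moreover have "openin X ?N" by (intro chart_preimage_open[OF c(1)] open_ball)
    moreover have "qs j \<in> ?N" using qs(2) F(2) by simp
    ultimately show "qs j \<in> P \<and> (\<exists>m\<ge>n (qs j) j. \<exists>N. openin X N \<and> qs j \<in> N \<and>
        (\<forall>q\<in>N. extend_chart U h ?G q = u (qs j) q ^ m))"
      using qs(1) F(1) by blast
  qed
qed

end

section \<open>The point map of a multiplicative isomorphism\<close>

context smooth_mfd
begin

lemma Ck_eqI: "x \<in> Ck k \<Longrightarrow> y \<in> Ck k \<Longrightarrow> (\<And>q. q \<in> topspace X \<Longrightarrow> x q = y q) \<Longrightarrow> x = y"
  using mem_Ck_iff extensionalityI by metis

lemma open_Ck_preimage:
  assumes "x \<in> Ck k" "open S"
  shows "openin X {q \<in> topspace X. x q \<in> S}"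
  using openin_continuous_map_preimage[OF continuous_map_Ck[OF assms(1)], of S] assms(2) by simp

section \<open>Vanishing germs in multiplicative terms\<close>

definition vanishes_near :: "('p \<Rightarrow> real) \<Rightarrow> 'p \<Rightarrow> bool" where
  "vanishes_near t p \<longleftrightarrow> (\<exists>N. openin X N \<and> p \<in> N \<and> (\<forall>q\<in>N. t q = 0))"

text \<open>Here \<open>u\<close> inverts \<open>x\<close> wherever \<open>t\<close> is nonzero, so
  by continuity \<open>x\<close> has no zero on the closed support of \<open>t\<close>. Only
  multiplication is involved, so an isomorphism preserves the relation.\<close>

definition unit_on_support :: "enat \<Rightarrow> ('p \<Rightarrow> real) \<Rightarrow> ('p \<Rightarrow> real) \<Rightarrow> bool" where
  "unit_on_support k x t \<longleftrightarrow> (\<exists>u\<in>Ck k. \<forall>q\<in>topspace X. x q * u q * t q = t q)"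

lemma unit_on_support_vanishes_near:
  assumes "x \<in> Ck k" "unit_on_support k x t" "p \<in> topspace X" "x p = 0"
  shows "vanishes_near t p"
proof -
  obtain u where u: "u \<in> Ck k" "\<And>q. q \<in> topspace X \<Longrightarrow> x q * u q * t q = t q"
    using assms(2) unfolding unit_on_support_def by blast
  let ?xu = "restrict (\<lambda>q. x q * u q) (topspace X)"
  let ?N = "{q \<in> topspace X. ?xu q \<in> {..<1}}"
  have "openin X ?N" by (rule open_Ck_preimage[OF mult_mem_Ck[OF assms(1) u(1)] open_lessThan])
  moreover have "p \<in> ?N" using assms(3,4) by simp
  moreover have "t q = 0" if "q \<in> ?N" for q
    using that u(2)[of q] by (cases "t q = 0") auto
  ultimately show ?thesis unfolding vanishes_near_def by blast
qed

lemma unit_on_support_peak: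
  assumes "x \<in> Ck k" "\<And>q. q \<in> topspace X \<Longrightarrow> x q = 0 \<longleftrightarrow> q = p" "p \<in> topspace X" "t \<in> Ck k"
  shows "unit_on_support k x t \<longleftrightarrow> vanishes_near t p"
proof
  show "vanishes_near t p" if "unit_on_support k x t"
    using unit_on_support_vanishes_near[OF assms(1) that assms(3)] assms(2,3) by blast
next
  assume "vanishes_near t p"
  then obtain N where N: "openin X N" "p \<in> N" "\<And>q. q \<in> N \<Longrightarrow> t q = 0"
    unfolding vanishes_near_def by blast
  obtain b N' K where b: "b \<in> Ck k" "openin X N'" "p \<in> N'" "\<And>q. q \<in> N' \<Longrightarrow> b q = 1"
    "closedin X K" "K \<subseteq> N" "\<And>q. q \<in> topspace X - K \<Longrightarrow> b q = 0"
    by (rule bump[OF N(1,2)]) (rule that; assumption)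
  \<comment> \<open>This is 1 - \<open>b\<close>, assembled from operations known to stay in
    \<open>Ck k\<close>. It vanishes near \<open>p\<close>, so it can be divided by
    \<open>x\<close>, and it equals 1 wherever \<open>t\<close> is nonzero.\<close>
  define c where "c = restrict (\<lambda>q. restrict (\<lambda>q. restrict (\<lambda>_. - 1) (topspace X) q * b q) (topspace X) q + 1) (topspace X)"
  have c: "c \<in> Ck k" unfolding c_def by (intro add_const_mem_Ck mult_mem_Ck const_mem_Ck b(1))
  have cq: "c q = 1 - b q" if "q \<in> topspace X" for q using that by (simp add: c_def)
  have u: "restrict (\<lambda>q. c q * inverse (x q)) (topspace X) \<in> Ck k"
  proof (rule divide_mem_Ck[OF assms(1) c])
    show "closedin X (topspace X - N')" using b(2) by blast
  qed (use b(3,4) cq assms(2) in auto)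
  show "unit_on_support k x t"
    unfolding unit_on_support_def
  proof (intro bexI[OF _ u] ballI)
    fix q assume q: "q \<in> topspace X"
    have "t q * b q = 0" using N(3) b(6,7) q by (cases "q \<in> K") auto
    moreover have "x q \<noteq> 0 \<or> t q = 0" using assms(2)[OF q] N(2,3) by blast
    ultimately show "x q * restrict (\<lambda>q. c q * inverse (x q)) (topspace X) q * t q = t q"
      using q by (auto simp: cq algebra_simps)
  qed
qed

text \<open>Two nested bumps: \<open>b\<close> is supported where \<open>x\<close> is nonzero and
  equals 1 on the support of \<open>t\<close>, so \<open>b\<close> divided by \<open>x\<close>
  inverts \<open>x\<close> there. Combined with the transfer of vanishing germs this characterises
  zeros.\<close>

lemma nonzero_iff_unit_on_support:
  assumes "x \<in> Ck k" "p \<in> topspace X"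
  shows "x p \<noteq> 0 \<longleftrightarrow> (\<exists>t\<in>Ck k. unit_on_support k x t \<and> \<not> vanishes_near t p)"
proof
  assume xp: "x p \<noteq> 0"
  let ?N = "{q \<in> topspace X. x q \<in> - {0}}"
  have N: "openin X ?N" by (rule open_Ck_preimage[OF assms(1)]) auto
  have pN: "p \<in> ?N" using assms(2) xp by simp
  obtain b N' K where b: "b \<in> Ck k" "openin X N'" "p \<in> N'" "\<And>q. q \<in> N' \<Longrightarrow> b q = 1"
    "closedin X K" "K \<subseteq> ?N" "\<And>q. q \<in> topspace X - K \<Longrightarrow> b q = 0"
    by (rule bump[OF N pN]) (rule that; assumption)
  obtain t N'' K' where t: "t \<in> Ck k" "openin X N''" "p \<in> N''" "\<And>q. q \<in> N'' \<Longrightarrow> t q = 1"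
    "closedin X K'" "K' \<subseteq> N'" "\<And>q. q \<in> topspace X - K' \<Longrightarrow> t q = 0"
    by (rule bump[OF b(2,3)]) (rule that; assumption)
  have u: "restrict (\<lambda>q. b q * inverse (x q)) (topspace X) \<in> Ck k"
    by (rule divide_mem_Ck[OF assms(1) b(1,5,7)]) (use b(6) in auto)
  have "unit_on_support k x t"
    unfolding unit_on_support_def
  proof (intro bexI[OF _ u] ballI)
    fix q assume q: "q \<in> topspace X"
    show "x q * restrict (\<lambda>q. b q * inverse (x q)) (topspace X) q * t q = t q"
    proof (cases "q \<in> K'")
      case True
      then have b1: "b q = 1" using b(4) t(6) by blast
      then have "q \<in> K" using b(7) q by force
      then have "x q \<noteq> 0" using b(6) by blast
      then show ?thesis using b1 q by simp
    qed (use t(7) q in simp)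
  qed
  moreover have "\<not> vanishes_near t p" using t(3,4) unfolding vanishes_near_def by fastforce
  ultimately show "\<exists>t\<in>Ck k. unit_on_support k x t \<and> \<not> vanishes_near t p" using t(1) by blast
next
  show "x p \<noteq> 0" if "\<exists>t\<in>Ck k. unit_on_support k x t \<and> \<not> vanishes_near t p"
    using that unit_on_support_vanishes_near[OF assms(1) _ assms(2)] by blast
qed

end

text \<open>Stated outside the locale with all data as arguments, so that exchanging the two
  manifolds turns \<open>\<phi>\<close> into \<open>\<psi>\<close> literally.\<close>

definition zero_point ::
  "'p topology \<Rightarrow> ('p \<Rightarrow> real) set \<Rightarrow> (('p \<Rightarrow> real) \<Rightarrow> 'q \<Rightarrow> real) \<Rightarrow> 'q \<Rightarrow> 'p" where
  "zero_point X M f w = (SOME v. v \<in> topspace X \<and> (\<forall>x\<in>M. f x w = 0 \<longleftrightarrow> x v = 0))"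

text \<open>Both maps and both multiplication laws are listed, which makes the locale symmetric:
  through \<open>swap\<close> every fact about \<open>f\<close> and \<open>\<phi>\<close> also holds
  for \<open>g\<close> and \<open>\<psi>\<close>.\<close>

locale ck_iso = V: smooth_mfd X \<A> + W: smooth_mfd Y \<B>
  for X :: "'p topology" and \<A> :: "('p, 'a::euclidean_space) chart set"
    and Y :: "'q topology" and \<B> :: "('q, 'b::euclidean_space) chart set" +
  fixes k :: enat and f :: "('p \<Rightarrow> real) \<Rightarrow> 'q \<Rightarrow> real" and g :: "('q \<Rightarrow> real) \<Rightarrow> 'p \<Rightarrow> real"
  assumes f_mem: "x \<in> V.Ck k \<Longrightarrow> f x \<in> W.Ck k"
    and g_mem: "y \<in> W.Ck k \<Longrightarrow> g y \<in> V.Ck k"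
    and gf: "x \<in> V.Ck k \<Longrightarrow> g (f x) = x"
    and fg: "y \<in> W.Ck k \<Longrightarrow> f (g y) = y"
    and f_mult: "x \<in> V.Ck k \<Longrightarrow> x' \<in> V.Ck k \<Longrightarrow> w \<in> topspace Y \<Longrightarrow>
      f (restrict (\<lambda>q. x q * x' q) (topspace X)) w = f x w * f x' w"
    and g_mult: "y \<in> W.Ck k \<Longrightarrow> y' \<in> W.Ck k \<Longrightarrow> v \<in> topspace X \<Longrightarrow>
      g (restrict (\<lambda>q. y q * y' q) (topspace Y)) v = g y v * g y' v"
begin

lemma swap: "ck_iso Y \<B> X \<A> k g f"
  by unfold_locales (fact f_mem g_mem gf fg f_mult g_mult)+

lemma f_mult_eq:
  assumes "x \<in> V.Ck k" "y \<in> V.Ck k" "z \<in> V.Ck k" "\<And>q. q \<in> topspace X \<Longrightarrow> x q * y q = z q"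
    "w \<in> topspace Y"
  shows "f x w * f y w = f z w"
proof -
  have "restrict (\<lambda>q. x q * y q) (topspace X) = z"
    by (rule V.Ck_eqI[OF V.mult_mem_Ck[OF assms(1,2)] assms(3)]) (simp add: assms(4))
  then show ?thesis using f_mult[OF assms(1,2,5)] by simp
qed

lemma f_one:
  assumes "w \<in> topspace Y"
  shows "f (restrict (\<lambda>_. 1) (topspace X)) w = 1"
proof -
  let ?one = "restrict (\<lambda>_. 1) (topspace Y)"
  have g1: "g ?one \<in> V.Ck k" by (intro g_mem W.const_mem_Ck)
  have "f (restrict (\<lambda>_. 1) (topspace X)) w * f (g ?one) w = f (g ?one) w"
    by (rule f_mult_eq[OF V.const_mem_Ck g1 g1 _ assms]) simp
  then show ?thesis using assms by (simp add: fg W.const_mem_Ck)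
qed

lemma f_zero:
  assumes "w \<in> topspace Y"
  shows "f (restrict (\<lambda>_. 0) (topspace X)) w = 0"
proof -
  let ?zero = "restrict (\<lambda>_. 0) (topspace Y)"
  have g0: "g ?zero \<in> V.Ck k" by (intro g_mem W.const_mem_Ck)
  have "f (restrict (\<lambda>_. 0) (topspace X)) w * f (g ?zero) w = f (restrict (\<lambda>_. 0) (topspace X)) w"
    by (rule f_mult_eq[OF V.const_mem_Ck g0 V.const_mem_Ck _ assms]) simp
  then show ?thesis using assms by (simp add: fg W.const_mem_Ck)
qed

lemma unit_on_support_image:
  assumes "x \<in> V.Ck k" "t \<in> V.Ck k" "V.unit_on_support k x t"
  shows "W.unit_on_support k (f x) (f t)"
proof -
  obtain u where u: "u \<in> V.Ck k" "\<And>q. q \<in> topspace X \<Longrightarrow> x q * u q * t q = t q"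
    using assms(3) unfolding V.unit_on_support_def by blast
  let ?xu = "restrict (\<lambda>q. x q * u q) (topspace X)"
  have "f x w * f u w * f t w = f t w" if "w \<in> topspace Y" for w
    using f_mult_eq[OF V.mult_mem_Ck[OF assms(1) u(1)] assms(2,2) _ that] u(2)
      f_mult[OF assms(1) u(1) that] by simp
  then show ?thesis unfolding W.unit_on_support_def using f_mem[OF u(1)] by blast
qed

lemma unit_on_support_iff:
  assumes "x \<in> V.Ck k" "t \<in> V.Ck k"
  shows "W.unit_on_support k (f x) (f t) \<longleftrightarrow> V.unit_on_support k x t"
proof -
  interpret S: ck_iso Y \<B> X \<A> k g f by (rule swap)
  show ?thesis
    using unit_on_support_image[OF assms] S.unit_on_support_image[of "f x" "f t"] assms
    by (auto simp: f_mem gf)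
qed

lemma invertible_image:
  assumes "x \<in> V.Ck k" "\<And>q. q \<in> topspace X \<Longrightarrow> x q \<noteq> 0" "w \<in> topspace Y"
  shows "f x w \<noteq> 0"
proof -
  let ?one = "restrict (\<lambda>_. 1) (topspace X)"
  let ?u = "restrict (\<lambda>q. ?one q * inverse (x q)) (topspace X)"
  have u: "?u \<in> V.Ck k"
    by (rule V.divide_mem_Ck[OF assms(1) V.const_mem_Ck closedin_topspace]) (use assms(2) in auto)
  have "f x w * f ?u w = f ?one w"
    by (rule f_mult_eq[OF assms(1) u V.const_mem_Ck _ assms(3)]) (use assms(2) in simp)
  then show ?thesis using f_one[OF assms(3)] by auto
qed

text \<open>Two zeros of \<open>g z\<close> would be separated by \<open>y1\<close>, equal to \<open>1\<close> near one of them and to \<open>0\<close> near the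
  other; then \<open>f y1\<close> would take the values \<open>1\<close> and \<open>0\<close> arbitrarily close to \<open>w\<close>.\<close>

lemma preimage_of_peak:
  assumes z: "z \<in> W.Ck k" "\<And>q. q \<in> topspace Y \<Longrightarrow> z q = 0 \<longleftrightarrow> q = w" and w: "w \<in> topspace Y"
  shows "\<exists>v\<in>topspace X. \<forall>q\<in>topspace X. g z q = 0 \<longleftrightarrow> q = v"
proof -
  note x0 = g_mem[OF z(1)]
  \<comment> \<open>Without a zero \<open>g z\<close> would be invertible, and then its image
    \<open>z\<close> could not vanish at \<open>w\<close>.\<close>
  have "\<exists>v\<in>topspace X. g z v = 0"
    using invertible_image[OF x0 _ w] z w by (auto simp: fg)
  then obtain v where v: "v \<in> topspace X" "g z v = 0" by blast
  have "v' = v" if v': "v' \<in> topspace X" "g z v' = 0" for v'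
  proof (rule ccontr)
    assume "v' \<noteq> v"
    then obtain N N2 where N: "openin X N" "openin X N2" "v \<in> N" "v' \<in> N2" "disjnt N N2"
      using V.Hausdorff v(1) v'(1) unfolding Hausdorff_space_def by metis
    obtain y1 N1 K1 where y1: "y1 \<in> V.Ck k" "openin X N1" "v \<in> N1" "\<And>q. q \<in> N1 \<Longrightarrow> y1 q = 1"
      "K1 \<subseteq> N" "\<And>q. q \<in> topspace X - K1 \<Longrightarrow> y1 q = 0"
      by (rule V.bump[OF N(1,3)]) (rule that; assumption)
    obtain y0 N0 K0 where y0: "y0 \<in> V.Ck k" "v \<in> N0" "\<And>q. q \<in> N0 \<Longrightarrow> y0 q = 1"
      "K0 \<subseteq> N1" "\<And>q. q \<in> topspace X - K0 \<Longrightarrow> y0 q = 0"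
      by (rule V.bump[OF y1(2,3)]) (rule that; assumption)
    obtain y2 N2' K2 where y2: "y2 \<in> V.Ck k" "v' \<in> N2'" "\<And>q. q \<in> N2' \<Longrightarrow> y2 q = 1"
      "K2 \<subseteq> N2" "\<And>q. q \<in> topspace X - K2 \<Longrightarrow> y2 q = 0"
      by (rule V.bump[OF N(2,4)]) (rule that; assumption)
    \<comment> \<open>At a zero \<open>p\<close> of \<open>g z\<close>, a function equal to 1 there
      cannot have \<open>g z\<close> as a unit on its support. This applies to \<open>y0\<close> at
      \<open>v\<close> and to \<open>y2\<close> at \<open>v'\<close>.\<close>
    have not_near: "\<not> W.vanishes_near (f y) w"
      if "y \<in> V.Ck k" "p \<in> topspace X" "g z p = 0" "y p = 1" for y p
    proof -
      have "\<not> V.unit_on_support k (g z) y"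
        using V.unit_on_support_vanishes_near[OF x0 _ that(2,3), of y] that(4)
        unfolding V.vanishes_near_def by fastforce
      then have "\<not> W.unit_on_support k z (f y)"
        using unit_on_support_iff[OF x0 that(1)] fg[OF z(1)] by simp
      then show ?thesis using W.unit_on_support_peak[OF z w f_mem[OF that(1)]] by blast
    qed
    have f01: "f y1 q * f y0 q = f y0 q" if "q \<in> topspace Y" for q
    proof (rule f_mult_eq[OF y1(1) y0(1) y0(1) _ that])
      show "y1 q * y0 q = y0 q" if "q \<in> topspace X" for q
        using y1(4)[of q] y0(4,5) that by (cases "q \<in> K0") auto
    qed
    have f12: "f y1 q * f y2 q = 0" if "q \<in> topspace Y" for q
    proof -
      have "f y1 q * f y2 q = f (restrict (\<lambda>_. 0) (topspace X)) q"
      proof (rule f_mult_eq[OF y1(1) y2(1) V.const_mem_Ck _ that])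
        show "y1 q * y2 q = restrict (\<lambda>_. 0) (topspace X) q" if "q \<in> topspace X" for q
        proof -
          have "q \<notin> K1 \<or> q \<notin> K2" using N(5) y1(5) y2(4) by (auto simp: disjnt_def)
          then show ?thesis using y1(6)[of q] y2(5)[of q] that by auto
        qed
      qed
      then show ?thesis using f_zero[OF that] by simp
    qed
    show False
    proof (cases "f y1 w = 1")
      case False
      let ?N = "{q \<in> topspace Y. f y1 q \<in> - {1}}"
      have "openin Y ?N" by (rule W.open_Ck_preimage[OF f_mem[OF y1(1)]]) auto
      moreover have "f y0 q = 0" if "q \<in> ?N" for q using f01[of q] that by auto
      ultimately have "W.vanishes_near (f y0) w"
        unfolding W.vanishes_near_def using w False by (intro exI[of _ ?N]) auto
      then show False using not_near[OF y0(1) v y0(3)[OF y0(2)]] by blast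
    next
      case True
      let ?N = "{q \<in> topspace Y. f y1 q \<in> - {0}}"
      have "openin Y ?N" by (rule W.open_Ck_preimage[OF f_mem[OF y1(1)]]) auto
      moreover have "f y2 q = 0" if "q \<in> ?N" for q using f12[of q] that by auto
      ultimately have "W.vanishes_near (f y2) w"
        unfolding W.vanishes_near_def using w True by (intro exI[of _ ?N]) auto
      then show False using not_near[OF y2(1) v' y2(3)[OF y2(2)]] by blast
    qed
  qed
  then have "\<forall>q\<in>topspace X. g z q = 0 \<longleftrightarrow> q = v" using v(2) by blast
  then show ?thesis using v(1) by (rule bexI)
qed

text \<open>The peak \<open>z\<close> matches vanishing near \<open>w\<close> with vanishing near
  \<open>v\<close>, and \<open>unit_on_support\<close> is transferred by \<open>f\<close>; these are
  the two ingredients of the criterion for a nonzero value.\<close>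

lemma zero_point_exists:
  assumes w: "w \<in> topspace Y"
  shows "\<exists>v. v \<in> topspace X \<and> (\<forall>x\<in>V.Ck k. f x w = 0 \<longleftrightarrow> x v = 0)"
proof -
  obtain z where z: "z \<in> W.Ck k" "\<And>q. q \<in> topspace Y \<Longrightarrow> z q = 0 \<longleftrightarrow> q = w"
    by (rule W.peak[OF w]) (rule that; assumption)
  obtain v where v: "v \<in> topspace X" "\<And>q. q \<in> topspace X \<Longrightarrow> g z q = 0 \<longleftrightarrow> q = v"
    using preimage_of_peak[OF z w] by blast
  have near: "W.vanishes_near (f t) w \<longleftrightarrow> V.vanishes_near t v" if "t \<in> V.Ck k" for t
  proof -
    have "W.vanishes_near (f t) w \<longleftrightarrow> W.unit_on_support k z (f t)"
      using W.unit_on_support_peak[OF z w f_mem[OF that]] by blast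
    also have "\<dots> \<longleftrightarrow> V.unit_on_support k (g z) t"
      using unit_on_support_iff[OF g_mem[OF z(1)] that] fg[OF z(1)] by simp
    also have "\<dots> \<longleftrightarrow> V.vanishes_near t v"
      using V.unit_on_support_peak[OF g_mem[OF z(1)] v(2,1) that] by blast
    finally show ?thesis .
  qed
  have "f x w = 0 \<longleftrightarrow> x v = 0" if x: "x \<in> V.Ck k" for x
  proof -
    have "f x w \<noteq> 0 \<longleftrightarrow> (\<exists>s\<in>W.Ck k. W.unit_on_support k (f x) s \<and> \<not> W.vanishes_near s w)"
      by (rule W.nonzero_iff_unit_on_support[OF f_mem[OF x] w])
    also have "\<dots> \<longleftrightarrow> (\<exists>t\<in>V.Ck k. W.unit_on_support k (f x) (f t) \<and> \<not> W.vanishes_near (f t) w)"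
      by (metis f_mem fg g_mem)
    also have "\<dots> \<longleftrightarrow> (\<exists>t\<in>V.Ck k. V.unit_on_support k x t \<and> \<not> V.vanishes_near t v)"
      using unit_on_support_iff[OF x] near by blast
    also have "\<dots> \<longleftrightarrow> x v \<noteq> 0"
      using V.nonzero_iff_unit_on_support[OF x v(1)] by blast
    finally show ?thesis by blast
  qed
  then show ?thesis using v(1) by blast
qed

abbreviation "\<phi> \<equiv> zero_point X (V.Ck k) f"
abbreviation "\<psi> \<equiv> zero_point Y (W.Ck k) g"

lemma phi:
  assumes "w \<in> topspace Y"
  shows phi_mem: "\<phi> w \<in> topspace X"
    and f_eq_0_iff: "x \<in> V.Ck k \<Longrightarrow> f x w = 0 \<longleftrightarrow> x (\<phi> w) = 0"
  using someI_ex[OF zero_point_exists[OF assms]] unfolding zero_point_def by blast+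

lemma psi_phi:
  assumes w: "w \<in> topspace Y"
  shows "\<psi> (\<phi> w) = w"
proof -
  interpret S: ck_iso Y \<B> X \<A> k g f by (rule swap)
  obtain z where z: "z \<in> W.Ck k" "\<And>q. q \<in> topspace Y \<Longrightarrow> z q = 0 \<longleftrightarrow> q = w"
    by (rule W.peak[OF w]) (rule that; assumption)
  have "g z (\<phi> w) = 0" using f_eq_0_iff[OF w g_mem[OF z(1)]] fg[OF z(1)] z(2) w by simp
  then have "z (\<psi> (\<phi> w)) = 0" using S.f_eq_0_iff[OF phi_mem[OF w] z(1)] by simp
  then show ?thesis using z(2) S.phi_mem[OF phi_mem[OF w]] by blast
qed

text \<open>Sets on which some C^k function is nonzero form a base of the topology, and
  \<open>\<phi>\<close> pulls such a set for \<open>y\<close> back to the one for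
  \<open>f y\<close>.\<close>

lemma continuous_phi: "continuous_map Y X \<phi>"
  unfolding continuous_map_def
proof (intro conjI allI impI)
  show "\<phi> \<in> topspace Y \<rightarrow> topspace X" using phi_mem by blast
  fix N assume N: "openin X N"
  show "openin Y {w \<in> topspace Y. \<phi> w \<in> N}"
  proof (subst openin_subopen, intro ballI)
    fix w assume w: "w \<in> {w \<in> topspace Y. \<phi> w \<in> N}"
    then have "\<phi> w \<in> N" by simp
    obtain y N' K where y: "y \<in> V.Ck k" "\<phi> w \<in> N'" "\<And>q. q \<in> N' \<Longrightarrow> y q = 1"
      "K \<subseteq> N" "\<And>q. q \<in> topspace X - K \<Longrightarrow> y q = 0"
      by (rule V.bump[OF N \<open>\<phi> w \<in> N\<close>]) (rule that; assumption)
    let ?N = "{w \<in> topspace Y. f y w \<in> - {0}}"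
    have "openin Y ?N" by (rule W.open_Ck_preimage[OF f_mem[OF y(1)]]) auto
    moreover have "w \<in> ?N" using w y(2,3) f_eq_0_iff[OF _ y(1), of w] by auto
    moreover have "?N \<subseteq> {w \<in> topspace Y. \<phi> w \<in> N}"
      using f_eq_0_iff[OF _ y(1)] y(4,5) phi_mem by blast
    ultimately show "\<exists>T. openin Y T \<and> w \<in> T \<and> T \<subseteq> {w \<in> topspace Y. \<phi> w \<in> N}" by blast
  qed
qed

lemma homeomorphic_maps_phi_psi: "homeomorphic_maps Y X \<phi> \<psi>"
proof -
  interpret S: ck_iso Y \<B> X \<A> k g f by (rule swap)
  show ?thesis
    unfolding homeomorphic_maps_def using continuous_phi S.continuous_phi psi_phi S.psi_phi by blast
qed

section \<open>Locality and preservation of signs\<close>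

lemma f_local:
  assumes "x \<in> V.Ck k" "y \<in> V.Ck k" "w \<in> topspace Y" "openin X N" "\<phi> w \<in> N"
    "\<And>q. q \<in> N \<Longrightarrow> x q = y q"
  shows "f x w = f y w"
proof -
  obtain t N' K where t: "t \<in> V.Ck k" "\<phi> w \<in> N'" "\<And>q. q \<in> N' \<Longrightarrow> t q = 1"
    "K \<subseteq> N" "\<And>q. q \<in> topspace X - K \<Longrightarrow> t q = 0"
    by (rule V.bump[OF assms(4,5)]) (rule that; assumption)
  have "f x w * f t w = f (restrict (\<lambda>q. y q * t q) (topspace X)) w"
  proof (rule f_mult_eq[OF assms(1) t(1) V.mult_mem_Ck[OF assms(2) t(1)] _ assms(3)])
    show "x q * t q = restrict (\<lambda>q. y q * t q) (topspace X) q" if "q \<in> topspace X" for q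
      using that assms(6)[of q] t(4,5) by (cases "q \<in> K") auto
  qed
  also have "\<dots> = f y w * f t w" by (rule f_mult[OF assms(2) t(1) assms(3)])
  finally show ?thesis
    using f_eq_0_iff[OF assms(3) t(1)] t(2,3) by auto
qed

lemma power_mem_Ck: "x \<in> V.Ck k \<Longrightarrow> restrict (\<lambda>q. x q ^ n) (topspace X) \<in> V.Ck k"
proof (induction n)
  case 0
  show ?case unfolding power_0 by (rule V.const_mem_Ck)
next
  case (Suc n)
  have "restrict (\<lambda>q. x q ^ Suc n) (topspace X) =
      restrict (\<lambda>q. x q * restrict (\<lambda>q. x q ^ n) (topspace X) q) (topspace X)" by auto
  then show ?case using V.mult_mem_Ck[OF Suc.prems Suc.IH[OF Suc.prems]] by (simp only:)
qed

lemma f_power: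
  assumes x: "x \<in> V.Ck k" and w: "w \<in> topspace Y"
  shows "f (restrict (\<lambda>q. x q ^ n) (topspace X)) w = f x w ^ n"
proof (induction n)
  case 0
  show ?case unfolding power_0 by (rule f_one[OF w])
next
  case (Suc n)
  have "f x w * f (restrict (\<lambda>q. x q ^ n) (topspace X)) w = f (restrict (\<lambda>q. x q ^ Suc n) (topspace X)) w"
    by (rule f_mult_eq[OF x power_mem_Ck[OF x] power_mem_Ck[OF x] _ w]) simp
  then show ?case unfolding Suc power_Suc by (rule sym)
qed

text \<open>Near \<open>\<phi> w\<close> a positive \<open>x\<close> is the square of a C^k
  function, so by locality \<open>f x w\<close> is a square; it is nonzero because
  \<open>x (\<phi> w)\<close> is.\<close>

lemma f_pos:
  assumes x: "x \<in> V.Ck k" and w: "w \<in> topspace Y" and pos: "x (\<phi> w) > 0"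
  shows "f x w > 0"
proof -
  let ?N = "{q \<in> topspace X. x q \<in> {0<..}}"
  have N: "openin X ?N" by (rule V.open_Ck_preimage[OF x]) auto
  have vN: "\<phi> w \<in> ?N" using phi_mem[OF w] pos by simp
  have ck: "ck_at k \<A> (\<lambda>q. exp (1 / 2 * ln (x q))) q" if "q \<in> ?N" for q
    by (intro ck_at_exp ck_at_mult ck_at_const ck_at_ln V.CkD[OF x]) (use that in auto)
  obtain y N' where y: "y \<in> V.Ck k" "openin X N'" "\<phi> w \<in> N'" "N' \<subseteq> ?N"
    "\<And>q. q \<in> N' \<Longrightarrow> y q = exp (1 / 2 * ln (x q))"
    by (rule V.local_extension[OF N vN ck], assumption) (rule that; assumption)
  have "f x w = f (restrict (\<lambda>q. y q ^ 2) (topspace X)) w"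
  proof (rule f_local[OF x power_mem_Ck[OF y(1)] w y(2,3)])
    fix q assume q: "q \<in> N'"
    then have "x q > 0" "q \<in> topspace X" using y(4) by auto
    then show "x q = restrict (\<lambda>q. y q ^ 2) (topspace X) q"
      using y(5)[OF q] by (simp add: exp_double[symmetric])
  qed
  also have "\<dots> = f y w ^ 2" by (rule f_power[OF y(1) w])
  finally show ?thesis
    using f_eq_0_iff[OF w x] pos zero_le_power2[of "f y w"] by simp
qed

text \<open>The image of the constant -1 takes only the values 1 and -1. If it were 1 at
  \<open>w\<close>, it would be 1 nearby by continuity, and locality of \<open>g\<close> would give
  -1 = 1 at \<open>\<phi> w\<close>.\<close>

lemma f_minus_one:
  assumes w: "w \<in> topspace Y"
  shows "f (restrict (\<lambda>_. - 1) (topspace X)) w = - 1"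
proof (rule ccontr)
  let ?m = "restrict (\<lambda>_. - 1) (topspace X)" and ?m' = "restrict (\<lambda>_. - 1) (topspace Y)"
  have m: "?m \<in> V.Ck k" "?m' \<in> W.Ck k" by (rule V.const_mem_Ck W.const_mem_Ck)+
  have sq: "f ?m q = 1 \<or> f ?m q = - 1" if "q \<in> topspace Y" for q
  proof -
    have "f ?m q * f ?m q = f (restrict (\<lambda>_. 1) (topspace X)) q"
      by (rule f_mult_eq[OF m(1,1) V.const_mem_Ck _ that]) simp
    then show ?thesis using f_one[OF that] by (simp add: square_eq_1_iff)
  qed
  assume "f ?m w \<noteq> - 1"
  then have fw: "f ?m w = 1" using sq[OF w] by blast
  let ?N = "{q \<in> topspace Y. f ?m q \<in> {0<..}}"
  have N: "openin Y ?N" by (rule W.open_Ck_preimage[OF f_mem[OF m(1)]]) auto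
  interpret S: ck_iso Y \<B> X \<A> k g f by (rule swap)
  have "g (f ?m) (\<phi> w) = g (restrict (\<lambda>_. 1) (topspace Y)) (\<phi> w)"
  proof (rule S.f_local[OF f_mem[OF m(1)] W.const_mem_Ck phi_mem[OF w] N])
    show "\<psi> (\<phi> w) \<in> ?N" using psi_phi[OF w] fw w by simp
    show "f ?m q = restrict (\<lambda>_. 1) (topspace Y) q" if "q \<in> ?N" for q
      using sq[of q] that by auto
  qed
  then show False using gf[OF m(1)] S.f_one[OF phi_mem[OF w]] phi_mem[OF w] by simp
qed

end

section \<open>The exponent\<close>

text \<open>In logarithmic coordinates this is Cauchy's functional equation; the bound on (0, 1)
  yields monotonicity, which excludes discontinuous solutions.\<close>

lemma monotone_multiplicative_eq_powr:
  fixes m :: "real \<Rightarrow> real"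
  assumes mult: "\<And>c d. c > 0 \<Longrightarrow> d > 0 \<Longrightarrow> m (c * d) = m c * m d"
    and pos: "\<And>c. c > 0 \<Longrightarrow> m c > 0" and le: "\<And>c. 0 < c \<Longrightarrow> c < 1 \<Longrightarrow> m c \<le> 1"
    and c: "c > 0"
  shows "m c = c powr ln (m (exp 1))" and "0 \<le> ln (m (exp 1))"
proof -
  define l where "l = (\<lambda>t. ln (m (exp t)))"
  have add: "l (s + t) = l s + l t" for s t
    using mult[of "exp s" "exp t"] pos[of "exp s"] pos[of "exp t"] by (simp add: l_def exp_add ln_mult)
  have l0: "l 0 = 0" using add[of 0 0] by simp
  have minus: "l (- t) = - l t" for t using add[of t "- t"] l0 by simp
  have nonneg: "l t \<ge> 0" if "t \<ge> 0" for t
  proof (cases "t = 0")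
    case False
    then have "m (exp (- t)) \<le> 1" using that by (intro le) auto
    then have "l (- t) \<le> 0" using pos[of "exp (- t)"] by (simp add: l_def)
    then show ?thesis using minus by simp
  qed (simp add: l0)
  have mono: "l s \<le> l t" if "s \<le> t" for s t
    using nonneg[of "t - s"] add[of s "t - s"] that by simp
  have scale: "l (real n * t) = real n * l t" for n t
    by (induction n) (simp_all add: l0 distrib_right add)
  have linear_nonneg: "l t = t * l 1" if "t \<ge> 0" for t
  proof (rule ccontr)
    assume "l t \<noteq> t * l 1"
    then have "\<bar>l t - t * l 1\<bar> > 0" by simp
    then obtain n :: nat where n: "l 1 < real n * \<bar>l t - t * l 1\<bar>"
      using reals_Archimedean3 by blast
    \<comment> \<open>Monotonicity puts both \<open>real n * l t\<close> and
      \<open>real n * t * l 1\<close> between \<open>p * l 1\<close> and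
      \<open>(p + 1) * l 1\<close>; their distance is at most \<open>l 1\<close>, against the choice
      of \<open>n\<close>.\<close>
    define p where "p = nat \<lfloor>real n * t\<rfloor>"
    have p: "real p \<le> real n * t" "real n * t \<le> real (Suc p)"
      using that by (simp_all add: p_def) linarith
    have "real p * l 1 \<le> real n * l t" "real n * l t \<le> real (Suc p) * l 1"
      using mono[OF p(1)] mono[OF p(2)] scale[of p 1] scale[of "Suc p" 1] scale[of n t]
      by simp_all
    moreover have "real p * l 1 \<le> real n * t * l 1" "real n * t * l 1 \<le> real (Suc p) * l 1"
      using p nonneg[of 1] by (intro mult_right_mono; simp)+
    ultimately have "\<bar>real n * l t - real n * t * l 1\<bar> \<le> l 1"
      by (simp add: distrib_right abs_le_iff)
    moreover have "real n * l t - real n * t * l 1 = real n * (l t - t * l 1)" by (simp add: algebra_simps)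
    ultimately show False using n by (simp add: abs_mult)
  qed
  have linear: "l t = t * l 1" for t
    using linear_nonneg[of t] linear_nonneg[of "- t"] minus[of t] by (cases "t \<ge> 0") auto
  have "m c = exp (l (ln c))" using c pos[of c] by (simp add: l_def)
  also have "\<dots> = c powr l 1" using linear[of "ln c"] c by (simp add: powr_def mult.commute)
  finally show "m c = c powr ln (m (exp 1))" by (simp add: l_def)
  show "0 \<le> ln (m (exp 1))" using nonneg[of 1] by (simp add: l_def)
qed

context ck_iso
begin

definition good :: "'p \<Rightarrow> bool" where
  "good v \<longleftrightarrow> (\<forall>u\<in>V.Ck k. \<bar>u v\<bar> < 1 \<longrightarrow> \<bar>f u (\<psi> v)\<bar> \<le> 1)"

text \<open>If bad points \<open>v j\<close>, with witnesses \<open>u j\<close>, accumulated at \<open>p\<close>, some \<open>y\<close> would agree near \<open>v j\<close>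
  with a power of \<open>u j\<close> so high that \<open>f y\<close> is unbounded near \<open>\<psi> p\<close>.\<close>

lemma eventually_good:
  assumes p: "p \<in> topspace X"
  shows "\<forall>\<^sub>F q in atin X p. good q"
proof (rule ccontr)
  interpret S: ck_iso Y \<B> X \<A> k g f by (rule swap)
  assume "\<not> (\<forall>\<^sub>F q in atin X p. good q)"
  then have no: "\<nexists>N. openin X N \<and> p \<in> N \<and> (\<forall>q\<in>N - {p}. good q)"
    using p by (simp add: eventually_atin)
  let ?P = "{q \<in> topspace X. \<not> good q}"
  have acc: "\<exists>q\<in>?P \<inter> N. q \<noteq> p" if "openin X N" "p \<in> N" for N
    using no that openin_subset[OF that(1)] by blast
  have "\<forall>q\<in>?P. \<exists>u. u \<in> V.Ck k \<and> \<bar>u q\<bar> < 1 \<and> \<bar>f u (\<psi> q)\<bar> > 1"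
    unfolding good_def by (auto simp: not_le)
  then obtain u where u: "\<And>q. q \<in> ?P \<Longrightarrow> u q \<in> V.Ck k \<and> \<bar>u q q\<bar> < 1 \<and> \<bar>f (u q) (\<psi> q)\<bar> > 1"
    by metis
  define n where "n = (\<lambda>q j. SOME n. real j < \<bar>f (u q) (\<psi> q)\<bar> ^ n)"
  have n: "real j < \<bar>f (u q) (\<psi> q)\<bar> ^ m" if "q \<in> ?P" "m \<ge> n q j" for q j m
  proof -
    have gt: "1 < \<bar>f (u q) (\<psi> q)\<bar>" using u[OF that(1)] by blast
    have "real j < \<bar>f (u q) (\<psi> q)\<bar> ^ n q j"
      unfolding n_def by (rule someI_ex[OF real_arch_pow[OF gt]])
    also have "\<dots> \<le> \<bar>f (u q) (\<psi> q)\<bar> ^ m"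
      by (rule power_increasing[OF that(2)]) (use gt in simp)
    finally show ?thesis .
  qed
  have u': "u q \<in> V.Ck k \<and> \<bar>u q q\<bar> < 1" if "q \<in> ?P" for q using u[OF that] by blast
  obtain y qs where y: "y \<in> V.Ck k" "limitin X qs p sequentially"
    "\<And>j. qs j \<in> ?P \<and> (\<exists>m\<ge>n (qs j) j. \<exists>N. openin X N \<and> qs j \<in> N \<and> (\<forall>q\<in>N. y q = u (qs j) q ^ m))"
    by (rule V.glue_powers[OF p acc u', where n = n], assumption+) (rule that; assumption)
  have big: "real j < \<bar>f y (\<psi> (qs j))\<bar>" for j
  proof -
    from y(3)[of j] obtain m N where m: "qs j \<in> ?P" "m \<ge> n (qs j) j" "openin X N" "qs j \<in> N"
      "\<And>q. q \<in> N \<Longrightarrow> y q = u (qs j) q ^ m" by blast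
    have q: "qs j \<in> topspace X" using m(1) by simp
    note uj = conjunct1[OF u[OF m(1)]]
    have "f y (\<psi> (qs j)) = f (restrict (\<lambda>q. u (qs j) q ^ m) (topspace X)) (\<psi> (qs j))"
      by (rule f_local[OF y(1) power_mem_Ck[OF uj] S.phi_mem[OF q] m(3)])
        (use m openin_subset[OF m(3)] S.psi_phi[OF q] in auto)
    also have "\<dots> = f (u (qs j)) (\<psi> (qs j)) ^ m" by (rule f_power[OF uj S.phi_mem[OF q]])
    finally show ?thesis using n[OF m(1,2)] by (simp add: power_abs)
  qed
  have "limitin euclideanreal (\<lambda>j. f y (\<psi> (qs j))) (f y (\<psi> p)) sequentially"
    using continuous_map_limit[OF continuous_map_compose[OF S.continuous_phi W.continuous_map_Ck[OF f_mem[OF y(1)]]] y(2)]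
    by (simp add: o_def)
  then have "(\<lambda>j. f y (\<psi> (qs j))) \<longlonglongrightarrow> f y (\<psi> p)" by simp
  then have "Bseq (\<lambda>j. f y (\<psi> (qs j)))" by (intro convergent_imp_Bseq convergentI)
  then obtain B where "\<And>j. \<bar>f y (\<psi> (qs j))\<bar> \<le> B" unfolding Bseq_def by auto
  then show False using big reals_Archimedean2[of B] by (metis less_trans not_le)
qed

text \<open>Read off from one constant function, hence defined at bad points too and automatically
  of class C^k in \<open>w\<close>.\<close>

definition exponent :: "'q \<Rightarrow> real" where
  "exponent w = ln (f (restrict (\<lambda>_. exp 1) (topspace X)) w)"

text \<open>Scaling \<open>x\<close> by a constant to have value \<open>c < 1\<close> at
  \<open>v\<close> and letting \<open>c\<close> tend to 1 gives one inequality without any knowledge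
  of the derivatives of \<open>x\<close>. The same inequality for a local reciprocal of
  \<open>x\<close> gives the other.\<close>

lemma good_representation:
  assumes v: "v \<in> topspace X" "good v"
  shows "0 \<le> exponent (\<psi> v)"
    and "x \<in> V.Ck k \<Longrightarrow> x v > 0 \<Longrightarrow> f x (\<psi> v) = x v powr exponent (\<psi> v)"
proof -
  interpret S: ck_iso Y \<B> X \<A> k g f by (rule swap)
  note w = S.phi_mem[OF v(1)]
  have pw: "\<phi> (\<psi> v) = v" by (rule S.psi_phi[OF v(1)])
  let ?c = "\<lambda>c. restrict (\<lambda>_. c) (topspace X)" and ?w = "\<psi> v"
  have cM: "?c c \<in> V.Ck k" for c :: real by (rule V.const_mem_Ck)
  have cv: "?c c v = c" for c :: real using v by simp
  define m where "m = (\<lambda>c. f (?c c) ?w)"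
  have m1: "m (c * d) = m c * m d" for c d
    unfolding m_def by (rule f_mult_eq[OF cM cM cM _ w, symmetric]) simp
  have m2: "m c > 0" if "c > 0" for c
    unfolding m_def by (rule f_pos[OF cM w]) (simp only: pw cv that)
  have m3: "m c \<le> 1" if "0 < c" "c < 1" for c
    using v(2) cM[of c] cv[of c] that unfolding good_def m_def by fastforce
  note m = monotone_multiplicative_eq_powr[of m, OF m1 m2 m3]
  have expo: "exponent ?w = ln (m (exp 1))" by (simp add: exponent_def m_def)
  show nonneg: "0 \<le> exponent ?w" unfolding expo by (rule m(2)[of 1]) auto
  have mc: "m c = c powr exponent ?w" if "c > 0" for c unfolding expo by (rule m(1)) (use that in auto)
  have upper: "f x ?w \<le> x v powr exponent ?w" if x: "x \<in> V.Ck k" "x v > 0" for x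
  proof -
    have bound: "c powr exponent ?w * (f x ?w / x v powr exponent ?w) \<le> 1" if c: "0 < c" "c < 1" for c
    proof -
      let ?u = "restrict (\<lambda>q. ?c (c / x v) q * x q) (topspace X)"
      have u: "?u \<in> V.Ck k" by (rule V.mult_mem_Ck[OF cM x(1)])
      have "\<bar>?u v\<bar> < 1" using c x(2) v(1) by simp
      then have "f ?u ?w \<le> 1" using v(2) u unfolding good_def by (blast dest: abs_le_D1)
      moreover have "f ?u ?w = m (c / x v) * f x ?w" unfolding m_def by (rule f_mult[OF cM x(1) w])
      moreover have "m (c / x v) = c powr exponent ?w / x v powr exponent ?w"
        using mc[of "c / x v"] c x(2) by (simp add: powr_divide)
      ultimately show ?thesis by simp
    qed
    have "((\<lambda>c. c powr exponent ?w * (f x ?w / x v powr exponent ?w)) \<longlongrightarrow>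
        1 powr exponent ?w * (f x ?w / x v powr exponent ?w)) (at_left 1)"
      by (intro tendsto_intros) auto
    moreover have "\<forall>\<^sub>F c in at_left (1::real). c powr exponent ?w * (f x ?w / x v powr exponent ?w) \<le> 1"
      unfolding eventually_at_left[OF zero_less_one] using bound by (intro exI[of _ 0]) auto
    ultimately have "1 powr exponent ?w * (f x ?w / x v powr exponent ?w) \<le> 1"
      by (rule tendsto_upperbound) auto
    then show ?thesis using x(2) by simp
  qed
  show "f x ?w = x v powr exponent ?w" if x: "x \<in> V.Ck k" "x v > 0"
  proof -
    let ?N = "{q \<in> topspace X. x q \<in> {0<..}}"
    have N: "openin X ?N" by (rule V.open_Ck_preimage[OF x(1)]) auto
    have vN: "v \<in> ?N" using v x by simp
    have ck: "ck_at k \<A> (\<lambda>q. inverse (x q)) q" if "q \<in> ?N" for q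
      by (intro ck_at_inverse V.CkD[OF x(1)]) (use that in auto)
    obtain y N' where y: "y \<in> V.Ck k" "openin X N'" "v \<in> N'" "N' \<subseteq> ?N"
      "\<And>q. q \<in> N' \<Longrightarrow> y q = inverse (x q)"
      by (rule V.local_extension[OF N vN ck], assumption) (rule that; assumption)
    have "f x ?w * f y ?w = f (restrict (\<lambda>q. x q * y q) (topspace X)) ?w"
      by (rule f_mult[OF x(1) y(1) w, symmetric])
    also have "\<dots> = f (?c 1) ?w"
    proof (rule f_local[OF V.mult_mem_Ck[OF x(1) y(1)] cM w y(2)])
      show "\<phi> ?w \<in> N'" using pw y(3) by simp
      fix q assume q: "q \<in> N'"
      then have "x q > 0" "q \<in> topspace X" using y(4) by auto
      then show "restrict (\<lambda>q. x q * y q) (topspace X) q = ?c 1 q"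
        using y(5)[OF q] by simp
    qed
    also have "\<dots> = 1" by (rule f_one[OF w])
    finally have xy: "f x ?w * f y ?w = 1" .
    have yv: "y v = inverse (x v)" using y(3,5) by blast
    have "f y ?w \<le> y v powr exponent ?w" by (rule upper[OF y(1)]) (use yv x in simp)
    also have "\<dots> = inverse (x v powr exponent ?w)"
      using yv x by (simp add: powr_divide inverse_eq_divide)
    finally have "f x ?w * f y ?w \<le> f x ?w * inverse (x v powr exponent ?w)"
      using f_pos[OF x(1) w] x(2) pw by (intro mult_left_mono) auto
    then have "x v powr exponent ?w \<le> f x ?w"
      using xy x(2) by (simp add: inverse_eq_divide pos_le_divide_eq)
    then show ?thesis using upper[OF x] by simp
  qed
qed

section \<open>Passage to the limit at arbitrary points\<close>

lemma atin_nontrivial: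
  assumes "p \<in> topspace X"
  shows "atin X p \<noteq> bot"
proof
  assume "atin X p = bot"
  then have "\<forall>\<^sub>F q in atin X p. False" by simp
  then obtain N where "openin X N" "p \<in> N" "N - {p} = {}"
    using assms unfolding eventually_atin by blast
  then show False using V.not_isolated[of N p] by blast
qed

lemma f_psi_tendsto:
  assumes "x \<in> V.Ck k" "p \<in> topspace X"
  shows "(x \<longlongrightarrow> x p) (atin X p)" "((\<lambda>q. f x (\<psi> q)) \<longlongrightarrow> f x (\<psi> p)) (atin X p)"
proof -
  interpret S: ck_iso Y \<B> X \<A> k g f by (rule swap)
  show "(x \<longlongrightarrow> x p) (atin X p)"
    using V.continuous_map_Ck[OF assms(1)] assms(2) unfolding continuous_map_atin by simp
  have "continuous_map X euclideanreal (f x \<circ> \<psi>)"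
    by (rule continuous_map_compose[OF S.continuous_phi W.continuous_map_Ck[OF f_mem[OF assms(1)]]])
  then show "((\<lambda>q. f x (\<psi> q)) \<longlongrightarrow> f x (\<psi> p)) (atin X p)"
    using assms(2) unfolding continuous_map_atin by (simp add: o_def)
qed

lemma f_exp_pos:
  assumes "w \<in> topspace Y"
  shows "f (restrict (\<lambda>_. exp 1) (topspace X)) w > 0"
  by (rule f_pos[OF V.const_mem_Ck assms]) (use phi_mem[OF assms] in simp)

lemma exponent_nonneg:
  assumes w: "w \<in> topspace Y"
  shows "0 \<le> exponent w"
proof -
  interpret S: ck_iso Y \<B> X \<A> k g f by (rule swap)
  note p = phi_mem[OF w]
  have pw: "\<psi> (\<phi> w) = w" by (rule psi_phi[OF w])
  have "((\<lambda>q. exponent (\<psi> q)) \<longlongrightarrow> exponent (\<psi> (\<phi> w))) (atin X (\<phi> w))"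
    unfolding exponent_def using f_exp_pos[OF w] pw
    by (intro tendsto_ln f_psi_tendsto V.const_mem_Ck p) simp
  moreover have "\<forall>\<^sub>F q in atin X (\<phi> w). 0 \<le> exponent (\<psi> q)"
  proof (rule eventually_mono[OF eventually_conj[OF eventually_good[OF p]]])
    show "\<forall>\<^sub>F q in atin X (\<phi> w). q \<in> topspace X"
      by (auto simp: eventually_atin intro: exI[of _ "topspace X"])
  qed (use good_representation(1) in blast)
  ultimately have "0 \<le> exponent (\<psi> (\<phi> w))"
    by (rule tendsto_lowerbound[OF _ _ atin_nontrivial[OF p]])
  then show ?thesis by (simp add: pw)
qed

lemma f_eq_powr:
  assumes x: "x \<in> V.Ck k" and w: "w \<in> topspace Y" and pos: "x (\<phi> w) > 0"
  shows "f x w = x (\<phi> w) powr exponent w"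
proof -
  interpret S: ck_iso Y \<B> X \<A> k g f by (rule swap)
  note p = phi_mem[OF w]
  have pw: "\<psi> (\<phi> w) = w" by (rule psi_phi[OF w])
  let ?A = "atin X (\<phi> w)"
  have "((\<lambda>q. x q powr exponent (\<psi> q)) \<longlongrightarrow> x (\<phi> w) powr exponent (\<psi> (\<phi> w))) ?A"
    unfolding exponent_def using f_exp_pos[OF w] pw pos
    by (intro tendsto_powr tendsto_ln f_psi_tendsto V.const_mem_Ck x p) simp_all
  moreover have "\<forall>\<^sub>F q in ?A. f x (\<psi> q) = x q powr exponent (\<psi> q)"
  proof -
    have "\<forall>\<^sub>F q in ?A. q \<in> topspace X"
      by (auto simp: eventually_atin intro: exI[of _ "topspace X"])
    moreover have "\<forall>\<^sub>F q in ?A. x q > 0"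
      by (rule order_tendstoD(1)[OF f_psi_tendsto(1)[OF x p] pos])
    ultimately show ?thesis
      using eventually_good[OF p]
    proof eventually_elim
      case (elim q)
      show ?case by (rule good_representation(2)[OF elim(1,3) x elim(2)])
    qed
  qed
  ultimately have "((\<lambda>q. f x (\<psi> q)) \<longlongrightarrow> x (\<phi> w) powr exponent (\<psi> (\<phi> w))) ?A"
    by (rule tendsto_cong[THEN iffD2, rotated])
  then have "f x (\<psi> (\<phi> w)) = x (\<phi> w) powr exponent (\<psi> (\<phi> w))"
    by (rule tendsto_unique[OF atin_nontrivial[OF p] f_psi_tendsto(2)[OF x p]])
  then show ?thesis by (simp add: pw)
qed

lemma f_representation:
  assumes x: "x \<in> V.Ck k" and w: "w \<in> topspace Y"
  shows "f x w = sgn (x (\<phi> w)) * \<bar>x (\<phi> w)\<bar> powr exponent w"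
proof -
  consider "x (\<phi> w) > 0" | "x (\<phi> w) = 0" | "x (\<phi> w) < 0" by linarith
  then show ?thesis
  proof cases
    case 1
    then show ?thesis using f_eq_powr[OF x w] by simp
  next
    case 2
    then show ?thesis using f_eq_0_iff[OF w x] by simp
  next
    case 3
    let ?m = "restrict (\<lambda>_. - 1) (topspace X)"
    let ?y = "restrict (\<lambda>q. ?m q * x q) (topspace X)"
    have y: "?y \<in> V.Ck k" by (rule V.mult_mem_Ck[OF V.const_mem_Ck x])
    have yw: "?y (\<phi> w) = - x (\<phi> w)" using phi_mem[OF w] by simp
    have "f x w = - f ?y w"
      using f_mult[OF V.const_mem_Ck x w, of "- 1"] f_minus_one[OF w] by simp
    also have "f ?y w = \<bar>x (\<phi> w)\<bar> powr exponent w"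
      using f_eq_powr[OF y w] 3 yw by simp
    finally show ?thesis using 3 by simp
  qed
qed

text \<open>Evaluate \<open>f (g e) = e\<close> at \<open>w\<close> for the constant
  \<open>e = exp 1\<close>. The relation makes a nonnegative exponent positive and later turns two
  lower bounds into equality.\<close>

lemma exponent_inverse:
  assumes w: "w \<in> topspace Y"
  shows "ck_iso.exponent Y g (\<phi> w) * exponent w = 1"
proof -
  interpret S: ck_iso Y \<B> X \<A> k g f by (rule swap)
  let ?e = "restrict (\<lambda>_. exp 1) (topspace Y)"
  have e: "?e \<in> W.Ck k" by (rule W.const_mem_Ck)
  have ge: "g ?e (\<phi> w) = exp 1 powr S.exponent (\<phi> w)"
    using S.f_eq_powr[OF e phi_mem[OF w]] psi_phi[OF w] w by simp
  then have "f (g ?e) w = (exp 1 powr S.exponent (\<phi> w)) powr exponent w"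
    using f_eq_powr[OF g_mem[OF e] w] by simp
  then have "exp 1 powr (S.exponent (\<phi> w) * exponent w) = exp 1"
    using fg[OF e] w by (simp add: powr_powr)
  then show ?thesis by (simp add: powr_def)
qed

lemma exponent_pos:
  assumes w: "w \<in> topspace Y"
  shows "0 < exponent w"
  using exponent_nonneg[OF w] exponent_inverse[OF w] by (cases "exponent w = 0") auto

lemma ck_at_exponent:
  assumes w: "w \<in> topspace Y"
  shows "ck_at k \<B> exponent w"
  unfolding exponent_def
  by (intro ck_at_ln W.CkD f_mem V.const_mem_Ck w f_exp_pos[OF w])

end

section \<open>Regularity of the point map\<close>

context ck_iso
begin

lemma continuous_exponent: "continuous_map Y euclideanreal exponent"
  by (rule W.ck_at_continuous_map) (rule ck_at_exponent)

text \<open>Where \<open>f y\<close> is positive the power formula can be solved for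
  \<open>y \<circ> \<phi>\<close>, because the exponent is itself C^k and positive.\<close>

lemma ck_at_comp_phi:
  assumes x: "x \<in> V.Ck k" and w: "w \<in> topspace Y"
  shows "ck_at k \<B> (\<lambda>q. x (\<phi> q)) w"
proof -
  \<comment> \<open>Shifts the value at \<open>\<phi> w\<close> to 1, so that the logarithm is
    available; the shift is undone at the end.\<close>
  define c where "c = 1 - x (\<phi> w)"
  let ?y = "restrict (\<lambda>q. x q + c) (topspace X)"
  have y: "?y \<in> V.Ck k" by (rule V.add_const_mem_Ck[OF x])
  let ?N = "{q \<in> topspace Y. f ?y q \<in> {0<..}}"
  have N: "openin Y ?N" by (rule W.open_Ck_preimage[OF f_mem[OF y]]) auto
  have fy: "f ?y w > 0" by (rule f_pos[OF y w]) (use phi_mem[OF w] in \<open>simp add: c_def\<close>)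
  have eq: "exp (inverse (exponent q) * ln (f ?y q)) + - c = x (\<phi> q)" if "q \<in> ?N" for q
  proof -
    have q: "q \<in> topspace Y" "f ?y q > 0" using that by auto
    have yq: "?y (\<phi> q) = x (\<phi> q) + c" using phi_mem[OF q(1)] by simp
    have "sgn (?y (\<phi> q)) * \<bar>?y (\<phi> q)\<bar> powr exponent q > 0"
      using q(2) unfolding f_representation[OF y q(1)] .
    then have pos: "?y (\<phi> q) > 0"
      by (smt (verit) mult_nonpos_nonneg powr_ge_zero sgn_real_def)
    then show ?thesis
      unfolding f_eq_powr[OF y q(1) pos] yq using pos[unfolded yq] exponent_pos[OF q(1)]
      by (simp add: ln_powr flip: mult.assoc)
  qed
  have "ck_at k \<B> (\<lambda>q. exp (inverse (exponent q) * ln (f ?y q)) + - c) w"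
    using exponent_pos[OF w]
    by (intro ck_at_add_const ck_at_exp ck_at_mult ck_at_inverse ck_at_exponent ck_at_ln W.CkD f_mem y w fy) simp
  then show ?thesis
    by (rule W.ck_at_cong[OF N _ eq, rotated 2]) (use w fy in auto)
qed

lemma comp_phi_mem_Ck: "x \<in> V.Ck k \<Longrightarrow> restrict (\<lambda>q. x (\<phi> q)) (topspace Y) \<in> W.Ck k"
  by (rule W.restrict_mem_Ck) (rule ck_at_comp_phi)

text \<open>Each coordinate of the chart \<open>h\<close> agrees near \<open>\<phi> w\<close> with a
  global C^k function, whose composite with \<open>\<phi>\<close> is C^k. The finitely many
  coordinates are then reassembled on a common neighbourhood.\<close>

lemma Ck_map_phi: "Ck_map k Y \<B> X \<A> \<phi>"
proof -
  have "Ck_on k (h' ` (U' \<inter> \<phi> -` U)) (h \<circ> \<phi> \<circ> inv_into U' h')"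
    if c: "(U', h') \<in> \<B>" "(U, h) \<in> \<A>" for U' h' U h
    unfolding Ck_on_iff
  proof
    fix a assume "a \<in> h' ` (U' \<inter> \<phi> -` U)"
    then obtain w where w: "w \<in> U'" "\<phi> w \<in> U" "a = h' w" by blast
    have wY: "w \<in> topspace Y" by (rule W.chart_subset[OF c(1) w(1)])
    have "\<exists>T g. open T \<and> h' w \<in> T \<and> Ck_open k T g \<and> (\<forall>q\<in>U'. h' q \<in> T \<longrightarrow> g (h' q) = h (\<phi> q) \<bullet> b)" for b
    proof -
      have "Ck_open k UNIV (\<lambda>z. z \<bullet> b)"
        unfolding Ck_open_def
        by (intro allI impI Cn_on_open_bounded_linear_compose[OF _ bounded_linear_inner_left] Cn_on_open_id open_UNIV)
      then have ck: "ck_at k \<A> (\<lambda>q. h q \<bullet> b) q" if "q \<in> U" for q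
        by (rule V.ck_at_chartI[OF c(2) that open_UNIV UNIV_I]) simp
      obtain y N where y: "y \<in> V.Ck k" "openin X N" "\<phi> w \<in> N" "N \<subseteq> U" "\<And>q. q \<in> N \<Longrightarrow> y q = h q \<bullet> b"
        by (rule V.local_extension[OF V.chart_open[OF c(2)] w(2) ck], assumption) (rule that; assumption)
      obtain T g where T: "open T" "h' w \<in> T" "Ck_open k T g" "\<And>q. q \<in> U' \<Longrightarrow> h' q \<in> T \<Longrightarrow> g (h' q) = y (\<phi> q)"
        by (rule W.ck_at_chartE[OF ck_at_comp_phi[OF y(1) wY] c(1) w(1)]) (rule that; assumption)
      have M: "openin Y {q \<in> topspace Y. \<phi> q \<in> N}"
        by (rule openin_continuous_map_preimage[OF continuous_phi y(2)])
      have wM: "w \<in> {q \<in> topspace Y. \<phi> q \<in> N}" using wY y(3) by simp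
      obtain T' where T': "open T'" "h' w \<in> T'" "\<And>q. q \<in> U' \<Longrightarrow> h' q \<in> T' \<Longrightarrow> q \<in> {q \<in> topspace Y. \<phi> q \<in> N}"
        by (rule W.chart_image_open[OF c(1) M wM w(1)]) (rule that; assumption)
      have "g (h' q) = h (\<phi> q) \<bullet> b" if q: "q \<in> U'" "h' q \<in> T \<inter> T'" for q
        using T(4)[of q] T'(3)[of q] y(5)[of "\<phi> q"] q by simp
      moreover have "Ck_open k (T \<inter> T') g" by (rule Ck_open_subset[OF T(3)]) auto
      moreover have "open (T \<inter> T')" "h' w \<in> T \<inter> T'" using T T' by auto
      ultimately show ?thesis by blast
    qed
    then obtain T g where T: "\<And>b. open (T b)" "\<And>b. h' w \<in> T b" "\<And>b. Ck_open k (T b) (g b)"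
      "\<And>b q. q \<in> U' \<Longrightarrow> h' q \<in> T b \<Longrightarrow> g b (h' q) = h (\<phi> q) \<bullet> b"
      by metis
    let ?T = "\<Inter>b\<in>Basis. T b" and ?G = "\<lambda>z. \<Sum>b\<in>Basis. g b z *\<^sub>R b"
    have oT: "open ?T" using T(1) by (intro open_INT) auto
    have "Ck_open k ?T ?G"
      unfolding Ck_open_def
    proof (intro allI impI)
      fix n assume n: "enat n \<le> k"
      show "Cn_on_open n ?T ?G"
      proof (rule Cn_on_open_sum[OF oT])
        fix b :: 'a assume "b \<in> Basis"
        then have "Cn_on_open n ?T (g b)"
          using T(3)[of b] n unfolding Ck_open_def by (blast intro: Cn_on_open_subset[of n "T b"])
        then show "Cn_on_open n ?T (\<lambda>z. g b z *\<^sub>R b)"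
          by (rule Cn_on_open_bounded_linear_compose[OF oT bounded_linear_scaleR_left])
      qed
    qed
    moreover have "?G z = (h \<circ> \<phi> \<circ> inv_into U' h') z" if z: "z \<in> h' ` (U' \<inter> \<phi> -` U) \<inter> ?T" for z
    proof -
      obtain q where q: "q \<in> U'" "z = h' q" using z by blast
      then have "g b z = h (\<phi> q) \<bullet> b" if "b \<in> Basis" for b using T(4)[of q b] z that by blast
      then have "?G z = (\<Sum>b\<in>Basis. (h (\<phi> q) \<bullet> b) *\<^sub>R b)" by simp
      also have "\<dots> = h (\<phi> q)" by (rule euclidean_representation)
      finally show ?thesis using q W.chart_inv[OF c(1) q(1)] by simp
    qed
    moreover have "a \<in> ?T" using T(2) w(3) by simp
    ultimately show "\<exists>T G. open T \<and> a \<in> T \<and> Ck_open k T G \<and>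
        (\<forall>z\<in>h' ` (U' \<inter> \<phi> -` U) \<inter> T. G z = (h \<circ> \<phi> \<circ> inv_into U' h') z)"
      using oT by (intro exI[of _ ?T] exI[of _ ?G]) blast
  qed
  then show ?thesis unfolding Ck_map_def using continuous_phi by blast
qed

text \<open>On a curve through \<open>w\<close> along which \<open>x \<circ> \<phi>\<close> is \<open>s t\<close>, the function \<open>f x\<close> is \<open>(s t)\<close> to the power
  \<open>exponent\<close>, which has a one-sided derivative at \<open>t = 0\<close> only if the exponent at \<open>w\<close> is at least \<open>1\<close>.\<close>

lemma exponent_ge_1:
  assumes k: "1 \<le> k" and w: "w \<in> topspace Y"
  shows "1 \<le> exponent w"
proof (rule ccontr)
  assume "\<not> 1 \<le> exponent w"
  \<comment> \<open>The exponent varies along the curve, so a fixed \<open>\<beta>\<close> strictly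
    between \<open>exponent w\<close> and 1 bounds it near \<open>w\<close>.\<close>
  define \<beta> where "\<beta> = (exponent w + 1) / 2"
  have \<beta>: "exponent w < \<beta>" "\<beta> < 1" using \<open>\<not> 1 \<le> exponent w\<close> by (auto simp: \<beta>_def)
  interpret S: ck_iso Y \<B> X \<A> k g f by (rule swap)
  obtain U h where c: "(U, h) \<in> \<B>" "w \<in> U" using W.chart_cover[OF w] by blast
  let ?a = "h w"
  obtain v e where v: "v \<noteq> 0" "e > 0" "\<And>t. 0 \<le> t \<Longrightarrow> t < e \<Longrightarrow> ?a + t *\<^sub>R v \<in> h ` U"
    by (rule W.chart_direction[OF c]) (rule that; assumption)
  define s where "s = v \<bullet> v"
  have s: "s > 0" using v(1) by (simp add: s_def)
  have "Ck_open k UNIV (\<lambda>z. z \<bullet> v + - (?a \<bullet> v))"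
    unfolding Ck_open_def
    by (intro allI impI Cn_on_open_add Cn_on_open_const
        Cn_on_open_bounded_linear_compose[OF _ bounded_linear_inner_left] Cn_on_open_id open_UNIV)
  then have ck: "ck_at k \<B> (\<lambda>q. h q \<bullet> v + - (?a \<bullet> v)) q" if "q \<in> U" for q
    by (rule W.ck_at_chartI[OF c(1) that open_UNIV UNIV_I]) simp
  obtain y N where y: "y \<in> W.Ck k" "openin Y N" "w \<in> N" "N \<subseteq> U"
    "\<And>q. q \<in> N \<Longrightarrow> y q = h q \<bullet> v + - (?a \<bullet> v)"
    by (rule W.local_extension[OF W.chart_open[OF c(1)] c(2) ck], assumption) (rule that; assumption)
  define x where "x = restrict (\<lambda>q. y (\<psi> q)) (topspace X)"
  have x: "x \<in> V.Ck k" unfolding x_def by (rule S.comp_phi_mem_Ck[OF y(1)])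
  have xphi: "x (\<phi> q) = y q" if "q \<in> topspace Y" for q
    using phi_mem[OF that] psi_phi[OF that] by (simp add: x_def)
  let ?M = "{q \<in> topspace Y. exponent q \<in> {..<\<beta>}}"
  have "openin Y ?M" by (rule openin_continuous_map_preimage[OF continuous_exponent]) simp
  then have NM: "openin Y (N \<inter> ?M)" using y(2) by blast
  have wNM: "w \<in> N \<inter> ?M" using y(3) w \<beta> by simp
  obtain T' where T': "open T'" "?a \<in> T'" "\<And>q. q \<in> U \<Longrightarrow> h q \<in> T' \<Longrightarrow> q \<in> N \<inter> ?M"
    by (rule W.chart_image_open[OF c(1) NM wNM c(2)]) (rule that; assumption)
  obtain T G where T: "open T" "?a \<in> T" "Ck_open k T G" "\<And>q. q \<in> U \<Longrightarrow> h q \<in> T \<Longrightarrow> G (h q) = f x q"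
    by (rule W.ck_at_chartE[OF W.CkD[OF f_mem[OF x] w] c]) (rule that; assumption)
  have "Cn_on_open (Suc 0) T G" using T(3) k unfolding Ck_open_def by (simp del: Cn_on_open.simps add: one_enat_def)
  then obtain D where D: "(G has_derivative D) (at ?a)" using T(2) Cn_on_open_SucD(1) by blast
  have Ga: "G ?a = 0"
    using T(4)[OF c(2) T(2)] f_eq_0_iff[OF w x] xphi[OF w] y(5)[OF y(3)] by simp
  let ?\<gamma> = "\<lambda>t. ?a + t *\<^sub>R v"
  \<comment> \<open>The curve need stay in the chart image only for \<open>t \<ge> 0\<close>, but
    the extension \<open>G\<close> is differentiable on an open set, which covers boundary
    points.\<close>
  have "((\<lambda>t. G (?\<gamma> t)) has_derivative (\<lambda>t. D (t *\<^sub>R v))) (at 0)"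
    by (rule has_derivative_compose[of ?\<gamma> "\<lambda>t. t *\<^sub>R v" 0 UNIV G D])
      (use D in \<open>auto intro!: derivative_eq_intros\<close>)
  moreover have "(\<lambda>t. D (t *\<^sub>R v)) = (\<lambda>t. D v * t)"
    using linear_cmul[OF has_derivative_linear[OF D]] by (auto simp: mult.commute)
  ultimately have "((\<lambda>t. G (?\<gamma> t)) has_real_derivative D v) (at 0)"
    by (simp only: has_field_derivative_def)
  then have "((\<lambda>t. G (?\<gamma> t) / t) \<longlongrightarrow> D v) (at 0)"
    unfolding DERIV_def by (simp add: Ga)
  then have "((\<lambda>t. G (?\<gamma> t) / t) \<longlongrightarrow> D v) (at_right 0)"
    by (rule filterlim_mono) (simp_all add: at_le)
  \<comment> \<open>Multiplied by this factor, the convergent difference quotient tends to 0,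
    although the product stays above the positive constant \<open>s powr \<beta>\<close>.\<close>
  moreover have "((\<lambda>t. t powr (1 - \<beta>)) \<longlongrightarrow> 0) (at_right (0 :: real))"
    using \<beta>(2) by (intro tendsto_zero_powrI[where b = "1 - \<beta>"] tendsto_const tendsto_ident_at)
      (auto simp: eventually_at_filter)
  ultimately have "((\<lambda>t. G (?\<gamma> t) / t * t powr (1 - \<beta>)) \<longlongrightarrow> D v * 0) (at_right 0)"
    by (rule tendsto_mult)
  moreover have "\<forall>\<^sub>F t in at_right 0. s powr \<beta> \<le> G (?\<gamma> t) / t * t powr (1 - \<beta>)"
  proof -
    have "(?\<gamma> \<longlongrightarrow> ?a + 0 *\<^sub>R v) (at_right 0)" by (intro tendsto_intros)
    then have "\<forall>\<^sub>F t in at_right 0. ?\<gamma> t \<in> T \<inter> T'"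
      by (rule topological_tendstoD) (use T T' in auto)
    moreover have "\<forall>\<^sub>F t in at_right 0. t < min e (1 / s)"
      using s v(2) by (intro eventually_at_right_less[THEN eventually_mono] order_tendstoD(2)[OF tendsto_ident_at]) auto
    moreover have "\<forall>\<^sub>F t in at_right (0::real). 0 < t" by (simp add: eventually_at_right_less)
    ultimately show ?thesis
    proof eventually_elim
      case (elim t)
      then obtain q where q: "q \<in> U" "?\<gamma> t = h q" using v(3)[of t] by auto
      then have qN: "q \<in> N" "q \<in> topspace Y" "exponent q < \<beta>" using T'(3)[of q] elim(1) by auto
      have yq: "y q = t * s" using y(5)[OF qN(1)] q(2)[symmetric] by (simp add: s_def inner_add_left)
      have ts: "0 < t * s" "t * s < 1" using elim(2,3) s by (simp_all add: field_simps)
      have "(t * s) powr \<beta> \<le> (t * s) powr exponent q"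
        using ts qN(3) by (intro powr_mono') auto
      also have "\<dots> = f x q" using f_eq_powr[OF x qN(2)] xphi[OF qN(2)] yq ts by simp
      also have "\<dots> = G (?\<gamma> t)" using T(4)[OF q(1)] q(2) elim(1) by simp
      finally have "(t * s) powr \<beta> / t * t powr (1 - \<beta>) \<le> G (?\<gamma> t) / t * t powr (1 - \<beta>)"
        using elim(3) by (intro mult_right_mono divide_right_mono) auto
      moreover have "(t * s) powr \<beta> / t * t powr (1 - \<beta>) = s powr \<beta>"
        using elim(3) s by (simp add: powr_mult powr_diff)
      ultimately show ?case by simp
    qed
  qed
  ultimately have "s powr \<beta> \<le> D v * 0"
    by (rule tendsto_lowerbound) simp
  then show False using s by simp
qed

lemma exponent_eq_1:
  assumes k: "1 \<le> k" and w: "w \<in> topspace Y"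
  shows "exponent w = 1"
proof -
  interpret S: ck_iso Y \<B> X \<A> k g f by (rule swap)
  have ge: "1 \<le> exponent w" "1 \<le> S.exponent (\<phi> w)"
    by (rule exponent_ge_1[OF k w]) (rule S.exponent_ge_1[OF k phi_mem[OF w]])
  have "exponent w \<le> S.exponent (\<phi> w) * exponent w"
    using mult_right_mono[OF ge(2), of "exponent w"] ge(1) by simp
  then show ?thesis using exponent_inverse[OF w] ge(1) by simp
qed

text \<open>The inverse required by the definition is \<open>inv_into\<close>, which agrees with
  \<open>\<psi>\<close> only on the carrier; regularity of \<open>\<psi>\<close> comes from the
  swapped locale and is carried over there.\<close>

lemma Ck_diffeomorphism_phi: "Ck_diffeomorphism k Y \<B> X \<A> \<phi>"
proof -
  interpret S: ck_iso Y \<B> X \<A> k g f by (rule swap)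
  let ?\<psi> = "inv_into (topspace Y) \<phi>"
  have bij: "bij_betw \<phi> (topspace Y) (topspace X)"
    by (rule bij_betw_byWitness[where f' = \<psi>]) (use psi_phi S.psi_phi phi_mem S.phi_mem in auto)
  have eq: "?\<psi> v = \<psi> v" if "v \<in> topspace X" for v
    using inv_into_f_f[OF bij_betw_imp_inj_on[OF bij] S.phi_mem[OF that]] S.psi_phi[OF that] by simp
  have "Ck_on k (h' ` (U' \<inter> ?\<psi> -` U)) (h \<circ> ?\<psi> \<circ> inv_into U' h')"
    if c: "(U', h') \<in> \<A>" "(U, h) \<in> \<B>" for U' h' U h
  proof -
    have sets: "U' \<inter> ?\<psi> -` U = U' \<inter> \<psi> -` U"
      using eq V.chart_subset[OF c(1)] by auto
    have "(h \<circ> ?\<psi> \<circ> inv_into U' h') z = (h \<circ> \<psi> \<circ> inv_into U' h') z" if "z \<in> h' ` (U' \<inter> \<psi> -` U)" for z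
      using that eq V.chart_subset[OF c(1)] V.chart_inv[OF c(1)] by auto
    moreover have "Ck_on k (h' ` (U' \<inter> \<psi> -` U)) (h \<circ> \<psi> \<circ> inv_into U' h')"
      using S.Ck_map_phi c unfolding Ck_map_def by fast
    ultimately show ?thesis unfolding sets Ck_on_def by (metis (no_types, lifting) IntD1)
  qed
  moreover have "continuous_map X Y ?\<psi>"
    by (rule continuous_map_eq[OF S.continuous_phi]) (simp add: eq)
  ultimately have "Ck_map k X \<A> Y \<B> ?\<psi>" unfolding Ck_map_def by blast
  then show ?thesis unfolding Ck_diffeomorphism_def using bij Ck_map_phi by blast
qed

end

section \<open>From the semigroup isomorphism to the point map\<close>

lemma ck_iso_of_iso:
  assumes "smooth_manifold V \<A>" "smooth_manifold W \<B>"
    and f: "f \<in> iso (Ck_semigroup k V \<A>) (Ck_semigroup k W \<B>)"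
  shows "ck_iso V \<A> W \<B> k f (inv_into (carrier (Ck_semigroup k V \<A>)) f)"
proof -
  interpret V: smooth_mfd V \<A> by unfold_locales (rule assms(1))
  interpret W: smooth_mfd W \<B> by unfold_locales (rule assms(2))
  let ?g = "inv_into (V.Ck k) f"
  have bij: "bij_betw f (V.Ck k) (W.Ck k)" using f by (simp add: iso_def)
  have f_mem: "f x \<in> W.Ck k" if "x \<in> V.Ck k" for x
    using bij_betwE[OF bij] that by blast
  have g_mem: "?g y \<in> V.Ck k" if "y \<in> W.Ck k" for y
    using bij_betwE[OF bij_betw_inv_into[OF bij]] that by blast
  have gf: "?g (f x) = x" if "x \<in> V.Ck k" for x
    by (rule bij_betw_inv_into_left[OF bij that])
  have fg: "f (?g y) = y" if "y \<in> W.Ck k" for y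
    by (rule bij_betw_inv_into_right[OF bij that])
  have mult: "f (restrict (\<lambda>q. x q * x' q) (topspace V)) = restrict (\<lambda>q. f x q * f x' q) (topspace W)"
    if "x \<in> V.Ck k" "x' \<in> V.Ck k" for x x'
    using f that unfolding iso_def hom_def by (auto simp: Ck_semigroup_def)
  have g_mult: "?g (restrict (\<lambda>q. y q * y' q) (topspace W)) = restrict (\<lambda>q. ?g y q * ?g y' q) (topspace V)"
    if "y \<in> W.Ck k" "y' \<in> W.Ck k" for y y'
    using mult[OF g_mem[OF that(1)] g_mem[OF that(2)]] fg that
      gf[OF V.mult_mem_Ck[OF g_mem[OF that(1)] g_mem[OF that(2)]]] by simp
  show ?thesis
    by unfold_locales (use f_mem g_mem gf fg mult g_mult in simp_all)
qed

theorem corollary9p6: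
  fixes V :: "'p topology" and \<A> :: "('p, 'a::euclidean_space) chart set"
    and W :: "'q topology" and \<B> :: "('q, 'b::euclidean_space) chart set"
    and k :: enat and f :: "('p \<Rightarrow> real) \<Rightarrow> ('q \<Rightarrow> real)"
  assumes "smooth_manifold V \<A>" and "smooth_manifold W \<B>"
    and "f \<in> iso (Ck_semigroup k V \<A>) (Ck_semigroup k W \<B>)"
  shows "(1 \<le> k \<longrightarrow>
            (\<exists>\<phi>. Ck_diffeomorphism k W \<B> V \<A> \<phi> \<and>
                 (\<forall>x\<in>carrier (Ck_semigroup k V \<A>). \<forall>w\<in>topspace W. f x w = x (\<phi> w)))) \<and>
         (k = 0 \<longrightarrow>
            (\<exists>\<phi> \<alpha>. homeomorphic_map W V \<phi> \<and>
                   continuous_map W euclideanreal \<alpha> \<and> (\<forall>w\<in>topspace W. 0 < \<alpha> w) \<and>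
                   (\<forall>x\<in>carrier (Ck_semigroup k V \<A>). \<forall>w\<in>topspace W.
                      f x w = sgn (x (\<phi> w)) * \<bar>x (\<phi> w)\<bar> powr \<alpha> w)))"
proof (intro conjI impI)
  interpret ck_iso V \<A> W \<B> k f "inv_into (carrier (Ck_semigroup k V \<A>)) f"
    by (rule ck_iso_of_iso[OF assms])
  show "\<exists>\<phi>. Ck_diffeomorphism k W \<B> V \<A> \<phi> \<and>
      (\<forall>x\<in>carrier (Ck_semigroup k V \<A>). \<forall>w\<in>topspace W. f x w = x (\<phi> w))" if "1 \<le> k"
  proof (intro exI conjI ballI)
    show "Ck_diffeomorphism k W \<B> V \<A> \<phi>" by (rule Ck_diffeomorphism_phi)
    fix x w assume "x \<in> carrier (Ck_semigroup k V \<A>)" "w \<in> topspace W"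
    then show "f x w = x (\<phi> w)"
      using f_representation[of x w] exponent_eq_1[OF that, of w] by (simp add: sgn_mult_abs)
  qed
  show "\<exists>\<phi> \<alpha>. homeomorphic_map W V \<phi> \<and> continuous_map W euclideanreal \<alpha> \<and>
      (\<forall>w\<in>topspace W. 0 < \<alpha> w) \<and>
      (\<forall>x\<in>carrier (Ck_semigroup k V \<A>). \<forall>w\<in>topspace W.
         f x w = sgn (x (\<phi> w)) * \<bar>x (\<phi> w)\<bar> powr \<alpha> w)"
  proof (intro exI conjI ballI)
    show "homeomorphic_map W V \<phi>"
      using homeomorphic_maps_phi_psi homeomorphic_map_maps by blast
  qed (rule continuous_exponent exponent_pos f_representation; assumption)+
qed

end
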